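(* Let $(M',J,g')$ be a Kähler manifold with Norden metric, $\dim M'=2n+2\ge4$, of constant totally real sectional curvatures $\nu'$ and $\widetilde{\nu'}$, and let $(M,\varphi,\xi,\eta,g)$, $\dim M=2n+1$, be a real time-like hypersurface of it, with function $t$ and second fundamental tensor $A$. Let $K$ be the canonical curvature tensor of $M$. Then $K$ is Kählerian, i.e. $K(x,y,z,u)=-K(x,y,\varphi z,\varphi u)$, and $$K(x,y,z,u)=\left\{\nu'[\pi_1-\pi_2-\pi_4]+\widetilde{\nu'}[\pi_3+\pi_5]\right\}(x,y,z,u)-\cos t\left\{\cos t[\pi_1-\pi_2-\pi_4]+\sin t[\pi_3+\pi_5]\right\}(Ax,Ay,z,u),$$ $$\tau(K)=4n(n-1)\nu'-\cos t\,(a\cos t+2b\sin t),$$ $$\widetilde\tau(K)=4n(n-1)\widetilde{\nu'}-\cos t\,(a\sin t-2b\cos t),$$ where $$a=(\mathrm{tr}A)^2-\mathrm{tr}A^2-[\mathrm{tr}(A\circ\varphi)]^2+\mathrm{tr}\big((A\circ\varphi)^2\big)-2\eta(A\xi)\,\mathrm{tr}A+2g(A\xi,A\xi),$$ $$b=\mathrm{tr}(A^2\circ\varphi)-\mathrm{tr}A\,\mathrm{tr}(A\circ\varphi)+\eta(A\xi)\,\mathrm{tr}(A\circ\varphi)-g(\varphi A\xi,A\xi).$$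
   Context: Kähler manifold with Norden metric: a $(2n+2)$-dimensional manifold $M'$ with an almost complex structure $J$ ($J^2=-\mathrm{id}$) and a pseudo-Riemannian metric $g'$ such that $g'(JX,JY)=-g'(X,Y)$ and $\nabla'J=0$, where $\nabla'$ is the Levi-Civita connection of $g'$. The signature of $g'$ is neutral. Curvature tensor: $R'(X,Y)Z=\nabla'_X\nabla'_YZ-\nabla'_Y\nabla'_XZ-\nabla'_{[X,Y]}Z$, $R'(X,Y,Z,U)=g'(R'(X,Y)Z,U)$, and $\widetilde{R'}(X,Y,Z,U)=R'(X,Y,Z,JU)$. Put $\pi_1'(x,y,z,u)=g'(y,z)g'(x,u)-g'(x,z)g'(y,u)$. A 2-plane (section) with basis $\{x,y\}$ is nondegenerate if $\pi_1'(x,y,y,x)\ne0$. $M'$ is of constant totally real sectional curvatures $\nu'$, $\widetilde{\nu'}$ (functions on $M'$) if for every $p'\in M'$ and every nondegenerate section $\alpha'\subset T_{p'}M'$ with $J\alpha'\perp\alpha'$ and basis $\{x,y\}$, $R'(x,y,y,x)/\pi_1'(x,y,y,x)=\nu'(p')$ and $\widetilde{R'}(x,y,y,x)/\pi_1'(x,y,y,x)=\widetilde{\nu'}(p')$. Real time-like hypersurface: a hypersurface $M$ of $M'$ with unit normal field $N$, $g'(N,N)=-1$, equipped with the structure $$\varphi=J+\cos t\,g'(\cdot,JN)\{\cos t\,N-\sin t\,JN\},\quad \xi=\sin t\,N+\cos t\,JN,\quad \eta=\cos t\,g'(\cdot,JN),\quad g=g'|_M,$$ where $t=\arctan\{g'(N,JN)\}\in(-\pi/2,\pi/2)$.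 This is an almost contact structure with Norden metric: $\varphi^2X=-X+\eta(X)\xi$, $\eta(\xi)=1$, $g(\varphi X,\varphi Y)=-g(X,Y)+\eta(X)\eta(Y)$. The second fundamental tensor $A$ is given by $\nabla'_XY=\nabla_XY-g(AX,Y)N$, $\nabla'_XN=-AX$, where $\nabla$ is the Levi-Civita connection of $g$. Along $M$, $\nu'$ and $\widetilde{\nu'}$ denote their restrictions. The canonical connection on $M$ is $$D_XY=\nabla_XY+\tfrac12\{(\nabla_X\varphi)\varphi Y+(\nabla_X\eta)Y\cdot\xi\}-\eta(Y)\nabla_X\xi,$$ and the canonical curvature tensor is $K(X,Y)Z=D_XD_YZ-D_YD_XZ-D_{[X,Y]}Z$, $K(X,Y,Z,U)=g(K(X,Y)Z,U)$. Tensors on $M$: $\pi_1(x,y,z,u)=g(y,z)g(x,u)-g(x,z)g(y,u)$; $\pi_2(x,y,z,u)=g(y,\varphi z)g(x,\varphi u)-g(x,\varphi z)g(y,\varphi u)$; $\pi_3(x,y,z,u)=-g(y,z)g(x,\varphi u)+g(x,z)g(y,\varphi u)-g(y,\varphi z)g(x,u)+g(x,\varphi z)g(y,u)$; $\pi_4(x,y,z,u)=\eta(y)\eta(z)g(x,u)-\eta(x)\eta(z)g(y,u)+\eta(x)\eta(u)g(y,z)-\eta(y)\eta(u)g(x,z)$; $\pi_5(x,y,z,u)=\eta(y)\eta(z)g(x,\varphi u)-\eta(x)\eta(z)g(y,\varphi u)+\eta(x)\eta(u)g(y,\varphi z)-\eta(y)\eta(u)g(x,\varphi z)$. For any basis $(f_a)$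 of $T_pM$ with $(g^{ab})$ the inverse of $(g(f_a,f_b))$: $\tau(K)=g^{ad}g^{bc}K(f_a,f_b,f_c,f_d)$ and $\widetilde\tau(K)=g^{ad}g^{bc}K(f_a,f_b,f_c,\varphi f_d)$. *)

theory Defs
  imports "HOL-Analysis.Analysis"
begin

section \<open>Smooth manifolds and tangent vectors\<close>

primrec Ck_on :: "nat \<Rightarrow> 'a::real_normed_vector set \<Rightarrow> ('a \<Rightarrow> 'b::real_normed_vector) \<Rightarrow> bool" where
  "Ck_on 0 S h \<longleftrightarrow> continuous_on S h"
| "Ck_on (Suc k) S h \<longleftrightarrow> (\<forall>x\<in>S. h differentiable (at x)) \<and>
     (\<forall>v. Ck_on k S (\<lambda>x. frechet_derivative h (at x) v))"

text \<open>Only used for open \<open>S\<close>.\<close>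

definition smooth_on :: "'a::real_normed_vector set \<Rightarrow> ('a \<Rightarrow> 'b::real_normed_vector) \<Rightarrow> bool" where
  "smooth_on S h \<longleftrightarrow> (\<forall>k. Ck_on k S h)"

datatype ('m, 'e) chart = Chart (cdom: "'m set") (cmap: "'m \<Rightarrow> 'e")

definition cinv :: "('m, 'e) chart \<Rightarrow> 'e \<Rightarrow> 'm" where
  "cinv c = inv_into (cdom c) (cmap c)"

definition is_chart :: "('m::topological_space, 'e::euclidean_space) chart \<Rightarrow> bool" where
  "is_chart c \<longleftrightarrow> open (cdom c) \<and> open (cmap c ` cdom c) \<and>
     homeomorphism (cdom c) (cmap c ` cdom c) (cmap c) (cinv c)"

text \<open>A manifold is a type in the classes \<open>t2_space\<close> and \<open>second_countable_topology\<close> together with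
  a smooth atlas; its dimension is the dimension of the model space \<open>'e\<close>.\<close>

definition smooth_atlas ::
  "('m::{t2_space,second_countable_topology}, 'e::euclidean_space) chart set \<Rightarrow> bool" where
  "smooth_atlas A \<longleftrightarrow> (\<forall>c\<in>A. is_chart c) \<and> (\<Union>c\<in>A. cdom c) = UNIV \<and>
     (\<forall>c\<in>A. \<forall>d\<in>A. smooth_on (cmap c ` (cdom c \<inter> cdom d)) (cmap d \<circ> cinv c))"

text \<open>The tangent space at \<open>p\<close> is represented by the model space \<open>'e\<close>: a tangent vector at \<open>p\<close> is
  given by its components in one chart \<open>chart_at A p\<close> around \<open>p\<close>, chosen once and for all. Its
  components in an arbitrary chart are obtained with the Jacobian of the change of coordinates.
  Hence a section of the tangent bundle, or of its pullback along a map, is a function into the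
  model space, but its smoothness must be read off after the conversion \<open>tcoord\<close> to the components
  in a fixed chart.\<close>

definition chart_at :: "('m, 'e) chart set \<Rightarrow> 'm \<Rightarrow> ('m, 'e) chart" where
  "chart_at A p = (SOME c. c \<in> A \<and> p \<in> cdom c)"

text \<open>\<open>mderiv A h p v\<close> is the derivative at \<open>p\<close> of the vector-valued function \<open>h\<close> in the direction of
  the tangent vector \<open>v\<close>.\<close>

definition mderiv ::
  "('m, 'e::euclidean_space) chart set \<Rightarrow> ('m \<Rightarrow> 'v::real_normed_vector) \<Rightarrow> 'm \<Rightarrow> 'e \<Rightarrow> 'v" where
  "mderiv A h p v =
     frechet_derivative (h \<circ> cinv (chart_at A p)) (at (cmap (chart_at A p) p)) v"

text \<open>\<open>tcoord A c p v\<close>: the components in the chart \<open>c\<close> of the tangent vector \<open>v\<close> at \<open>p\<close>.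
  \<open>tvec A c p w\<close>: the tangent vector at \<open>p\<close> whose components in the chart \<open>c\<close> are \<open>w\<close>; thus
  \<open>\<lambda>q. tvec A c q w\<close> is the coordinate vector field with constant components \<open>w\<close>.\<close>

definition tcoord ::
  "('m, 'e::euclidean_space) chart set \<Rightarrow> ('m, 'e) chart \<Rightarrow> 'm \<Rightarrow> 'e \<Rightarrow> 'e" where
  "tcoord A c p v = mderiv A (cmap c) p v"

definition tvec ::
  "('m, 'e::euclidean_space) chart set \<Rightarrow> ('m, 'e) chart \<Rightarrow> 'm \<Rightarrow> 'e \<Rightarrow> 'e" where
  "tvec A c p w = frechet_derivative (cmap (chart_at A p) \<circ> cinv c) (at (cmap c p)) w"

definition smooth_fun_on ::
  "('m, 'e::euclidean_space) chart set \<Rightarrow> 'm set \<Rightarrow> ('m \<Rightarrow> 'v::real_normed_vector) \<Rightarrow> bool" where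
  "smooth_fun_on A W h \<longleftrightarrow> (\<forall>c\<in>A. smooth_on (cmap c ` (W \<inter> cdom c)) (h \<circ> cinv c))"

definition smooth_map ::
  "('m::topological_space, 'e::euclidean_space) chart set \<Rightarrow>
   ('n::topological_space, 'f::euclidean_space) chart set \<Rightarrow> ('m \<Rightarrow> 'n) \<Rightarrow> bool" where
  "smooth_map A B f \<longleftrightarrow> continuous_on UNIV f \<and>
     (\<forall>d\<in>B. smooth_fun_on A (f -` cdom d) (cmap d \<circ> f))"

definition tmap ::
  "('m, 'e::euclidean_space) chart set \<Rightarrow> ('n, 'f::euclidean_space) chart set \<Rightarrow>
   ('m \<Rightarrow> 'n) \<Rightarrow> 'm \<Rightarrow> 'e \<Rightarrow> 'f" where
  "tmap A B f p v = mderiv A (cmap (chart_at B (f p)) \<circ> f) p v"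

definition immersion ::
  "('m::topological_space, 'e::euclidean_space) chart set \<Rightarrow>
   ('n::topological_space, 'f::euclidean_space) chart set \<Rightarrow> ('m \<Rightarrow> 'n) \<Rightarrow> bool" where
  "immersion A B f \<longleftrightarrow> smooth_map A B f \<and> (\<forall>p. inj (tmap A B f p))"

definition smooth_section_along ::
  "('m, 'e::euclidean_space) chart set \<Rightarrow> ('n, 'f::euclidean_space) chart set \<Rightarrow>
   ('m \<Rightarrow> 'n) \<Rightarrow> 'm set \<Rightarrow> ('m \<Rightarrow> 'f) \<Rightarrow> bool" where
  "smooth_section_along A B f W s \<longleftrightarrow>
     (\<forall>d\<in>B. smooth_fun_on A (W \<inter> f -` cdom d) (\<lambda>q. tcoord B d (f q) (s q)))"

definition smooth_vf_on ::
  "('m, 'e::euclidean_space) chart set \<Rightarrow> 'm set \<Rightarrow> ('m \<Rightarrow> 'e) \<Rightarrow> bool" where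
  "smooth_vf_on A W X \<longleftrightarrow> smooth_section_along A A (\<lambda>q. q) W X"

definition lie_bracket ::
  "('m, 'e::euclidean_space) chart set \<Rightarrow> ('m \<Rightarrow> 'e) \<Rightarrow> ('m \<Rightarrow> 'e) \<Rightarrow> 'm \<Rightarrow> 'e" where
  "lie_bracket A X Y p =
     mderiv A (\<lambda>q. tcoord A (chart_at A p) q (Y q)) p (X p)
     - mderiv A (\<lambda>q. tcoord A (chart_at A p) q (X q)) p (Y p)"


section \<open>Metrics, connections, curvature\<close>

definition pseudo_riemannian ::
  "('m, 'e::euclidean_space) chart set \<Rightarrow> ('m \<Rightarrow> 'e \<Rightarrow> 'e \<Rightarrow> real) \<Rightarrow> bool" where
  "pseudo_riemannian A g \<longleftrightarrow>
     (\<forall>p. bilinear (g p) \<and> (\<forall>x y. g p x y = g p y x) \<and> (\<forall>x. (\<forall>y. g p x y = 0) \<longrightarrow> x = 0)) \<and>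
     (\<forall>c\<in>A. \<forall>v w. smooth_fun_on A (cdom c) (\<lambda>q. g q (tvec A c q v) (tvec A c q w)))"

text \<open>A connection is an operator on vector fields that may be defined on any open set only. Fields
  are total functions, the value \<open>nabla X Y p\<close> being meaningful when \<open>X\<close> and \<open>Y\<close> are smooth
  on some open set containing \<open>p\<close>.\<close>

definition affine_connection ::
  "('m::topological_space, 'e::euclidean_space) chart set \<Rightarrow>
   (('m \<Rightarrow> 'e) \<Rightarrow> ('m \<Rightarrow> 'e) \<Rightarrow> 'm \<Rightarrow> 'e) \<Rightarrow> bool" where
  "affine_connection A nabla \<longleftrightarrow>
     (\<forall>W X Y. open W \<longrightarrow> smooth_vf_on A W X \<longrightarrow> smooth_vf_on A W Y \<longrightarrow>
        smooth_vf_on A W (nabla X Y)) \<and>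
     (\<forall>W X Y Z. open W \<longrightarrow> smooth_vf_on A W X \<longrightarrow> smooth_vf_on A W Y \<longrightarrow> smooth_vf_on A W Z \<longrightarrow>
        (\<forall>p\<in>W. nabla (\<lambda>q. X q + Y q) Z p = nabla X Z p + nabla Y Z p \<and>
               nabla X (\<lambda>q. Y q + Z q) p = nabla X Y p + nabla X Z p)) \<and>
     (\<forall>W h X Y. open W \<longrightarrow> smooth_fun_on A W h \<longrightarrow> smooth_vf_on A W X \<longrightarrow> smooth_vf_on A W Y \<longrightarrow>
        (\<forall>p\<in>W. nabla (\<lambda>q. h q *\<^sub>R X q) Y p = h p *\<^sub>R nabla X Y p \<and>
               nabla X (\<lambda>q. h q *\<^sub>R Y q) p = mderiv A h p (X p) *\<^sub>R Y p + h p *\<^sub>R nabla X Y p))"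

definition levi_civita ::
  "('m::topological_space, 'e::euclidean_space) chart set \<Rightarrow> ('m \<Rightarrow> 'e \<Rightarrow> 'e \<Rightarrow> real) \<Rightarrow>
   (('m \<Rightarrow> 'e) \<Rightarrow> ('m \<Rightarrow> 'e) \<Rightarrow> 'm \<Rightarrow> 'e) \<Rightarrow> bool" where
  "levi_civita A g nabla \<longleftrightarrow> affine_connection A nabla \<and>
     (\<forall>W X Y. open W \<longrightarrow> smooth_vf_on A W X \<longrightarrow> smooth_vf_on A W Y \<longrightarrow>
        (\<forall>p\<in>W. nabla X Y p - nabla Y X p = lie_bracket A X Y p)) \<and>
     (\<forall>W X Y Z. open W \<longrightarrow> smooth_vf_on A W X \<longrightarrow> smooth_vf_on A W Y \<longrightarrow> smooth_vf_on A W Z \<longrightarrow>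
        (\<forall>p\<in>W. mderiv A (\<lambda>q. g q (Y q) (Z q)) p (X p)
               = g p (nabla X Y p) (Z p) + g p (Y p) (nabla X Z p)))"

definition curvature ::
  "('m, 'e::euclidean_space) chart set \<Rightarrow> (('m \<Rightarrow> 'e) \<Rightarrow> ('m \<Rightarrow> 'e) \<Rightarrow> 'm \<Rightarrow> 'e) \<Rightarrow>
   ('m \<Rightarrow> 'e) \<Rightarrow> ('m \<Rightarrow> 'e) \<Rightarrow> ('m \<Rightarrow> 'e) \<Rightarrow> 'm \<Rightarrow> 'e" where
  "curvature A nabla X Y Z p =
     nabla X (nabla Y Z) p - nabla Y (nabla X Z) p - nabla (lie_bracket A X Y) Z p"

text \<open>The value of the curvature on tangent vectors at \<open>p\<close>. As the curvature is tensorial, any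
  extension to smooth fields may be used; here the vectors are extended with constant components
  in the chart \<open>chart_at A p\<close>.\<close>

definition tangent_ext ::
  "('m, 'e::euclidean_space) chart set \<Rightarrow> 'm \<Rightarrow> 'e \<Rightarrow> 'm \<Rightarrow> 'e" where
  "tangent_ext A p v = (\<lambda>q. tvec A (chart_at A p) q v)"

definition curvature_tensor ::
  "('m, 'e::euclidean_space) chart set \<Rightarrow> ('m \<Rightarrow> 'e \<Rightarrow> 'e \<Rightarrow> real) \<Rightarrow>
   (('m \<Rightarrow> 'e) \<Rightarrow> ('m \<Rightarrow> 'e) \<Rightarrow> 'm \<Rightarrow> 'e) \<Rightarrow> 'm \<Rightarrow> 'e \<Rightarrow> 'e \<Rightarrow> 'e \<Rightarrow> 'e \<Rightarrow> real" where
  "curvature_tensor A g nabla p x y z u =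
     g p (curvature A nabla (tangent_ext A p x) (tangent_ext A p y) (tangent_ext A p z) p) u"

text \<open>The covariant derivative of a section \<open>s\<close> along \<open>f\<close> in the direction of \<open>v\<close>, i.e. the pullback
  by \<open>f\<close> of the connection \<open>nabla\<close>. In the coordinates of \<open>chart_at B (f p)\<close> the first summand is the
  derivative of the components of \<open>s\<close>, and the second is the Christoffel term.\<close>

definition cov_deriv_along ::
  "('m, 'e::euclidean_space) chart set \<Rightarrow> ('n, 'f::euclidean_space) chart set \<Rightarrow>
   (('n \<Rightarrow> 'f) \<Rightarrow> ('n \<Rightarrow> 'f) \<Rightarrow> 'n \<Rightarrow> 'f) \<Rightarrow> ('m \<Rightarrow> 'n) \<Rightarrow> ('m \<Rightarrow> 'f) \<Rightarrow> 'm \<Rightarrow> 'e \<Rightarrow> 'f" where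
  "cov_deriv_along A B nabla f s p v =
     mderiv A (\<lambda>q. tcoord B (chart_at B (f p)) (f q) (s q)) p v
     + nabla (tangent_ext B (f p) (tmap A B f p v)) (tangent_ext B (f p) (s p)) (f p)"


section \<open>Curvature-like tensors at a point\<close>

definition pi1 :: "('e \<Rightarrow> 'e \<Rightarrow> real) \<Rightarrow> 'e \<Rightarrow> 'e \<Rightarrow> 'e \<Rightarrow> 'e \<Rightarrow> real" where
  "pi1 g x y z u = g y z * g x u - g x z * g y u"

definition pi2 :: "('e \<Rightarrow> 'e \<Rightarrow> real) \<Rightarrow> ('e \<Rightarrow> 'e) \<Rightarrow> 'e \<Rightarrow> 'e \<Rightarrow> 'e \<Rightarrow> 'e \<Rightarrow> real" where
  "pi2 g \<phi> x y z u = g y (\<phi> z) * g x (\<phi> u) - g x (\<phi> z) * g y (\<phi> u)"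

definition pi3 :: "('e \<Rightarrow> 'e \<Rightarrow> real) \<Rightarrow> ('e \<Rightarrow> 'e) \<Rightarrow> 'e \<Rightarrow> 'e \<Rightarrow> 'e \<Rightarrow> 'e \<Rightarrow> real" where
  "pi3 g \<phi> x y z u = - g y z * g x (\<phi> u) + g x z * g y (\<phi> u)
                     - g y (\<phi> z) * g x u + g x (\<phi> z) * g y u"

definition pi4 :: "('e \<Rightarrow> 'e \<Rightarrow> real) \<Rightarrow> ('e \<Rightarrow> real) \<Rightarrow> 'e \<Rightarrow> 'e \<Rightarrow> 'e \<Rightarrow> 'e \<Rightarrow> real" where
  "pi4 g \<eta> x y z u = \<eta> y * \<eta> z * g x u - \<eta> x * \<eta> z * g y u
                     + \<eta> x * \<eta> u * g y z - \<eta> y * \<eta> u * g x z"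

definition pi5 ::
  "('e \<Rightarrow> 'e \<Rightarrow> real) \<Rightarrow> ('e \<Rightarrow> 'e) \<Rightarrow> ('e \<Rightarrow> real) \<Rightarrow> 'e \<Rightarrow> 'e \<Rightarrow> 'e \<Rightarrow> 'e \<Rightarrow> real" where
  "pi5 g \<phi> \<eta> x y z u = \<eta> y * \<eta> z * g x (\<phi> u) - \<eta> x * \<eta> z * g y (\<phi> u)
                       + \<eta> x * \<eta> u * g y (\<phi> z) - \<eta> y * \<eta> u * g x (\<phi> z)"

text \<open>\<open>G\<close> is the matrix \<open>(g\<^sup>a\<^sup>b)\<close> of the components of the inverse of \<open>g\<close> in the basis \<open>F\<close>, whose
  elements serve as their own indices.\<close>

definition inverse_gram :: "('e \<Rightarrow> 'e \<Rightarrow> real) \<Rightarrow> 'e set \<Rightarrow> ('e \<Rightarrow> 'e \<Rightarrow> real) \<Rightarrow> bool" where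
  "inverse_gram g F G \<longleftrightarrow>
     (\<forall>a\<in>F. \<forall>b\<in>F. (\<Sum>c\<in>F. G a c * g c b) = (if a = b then 1 else 0) \<and>
                  (\<Sum>c\<in>F. g a c * G c b) = (if a = b then 1 else 0))"

definition scalar_curv ::
  "'e set \<Rightarrow> ('e \<Rightarrow> 'e \<Rightarrow> real) \<Rightarrow> ('e \<Rightarrow> 'e \<Rightarrow> 'e \<Rightarrow> 'e \<Rightarrow> real) \<Rightarrow> real" where
  "scalar_curv F G K = (\<Sum>a\<in>F. \<Sum>b\<in>F. \<Sum>c\<in>F. \<Sum>d\<in>F. G a d * G b c * K a b c d)"

definition assoc_scalar_curv ::
  "'e set \<Rightarrow> ('e \<Rightarrow> 'e \<Rightarrow> real) \<Rightarrow> ('e \<Rightarrow> 'e) \<Rightarrow> ('e \<Rightarrow> 'e \<Rightarrow> 'e \<Rightarrow> 'e \<Rightarrow> real) \<Rightarrow> real" where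
  "assoc_scalar_curv F G \<phi> K =
     (\<Sum>a\<in>F. \<Sum>b\<in>F. \<Sum>c\<in>F. \<Sum>d\<in>F. G a d * G b c * K a b c (\<phi> d))"

abbreviation tr :: "(real ^ 'k \<Rightarrow> real ^ 'k) \<Rightarrow> real" where
  "tr L \<equiv> trace (matrix L)"


section \<open>Kaehler manifolds with Norden metric and their time-like hypersurfaces\<close>

definition almost_complex ::
  "('n, 'f::euclidean_space) chart set \<Rightarrow> ('n \<Rightarrow> 'f \<Rightarrow> 'f) \<Rightarrow> bool" where
  "almost_complex B J \<longleftrightarrow>
     (\<forall>p. linear (J p) \<and> (\<forall>x. J p (J p x) = - x)) \<and>
     (\<forall>c\<in>B. \<forall>v. smooth_vf_on B (cdom c) (\<lambda>q. J q (tvec B c q v)))"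

text \<open>The signature of \<open>g\<close> is not mentioned: it is neutral since \<open>J p\<close> is an anti-isometry. The last
  conjunct is \<open>(\<nabla>\<^sub>X J) Y = 0\<close>.\<close>

definition kaehler_norden ::
  "('n::{t2_space,second_countable_topology}, 'f::euclidean_space) chart set \<Rightarrow> ('n \<Rightarrow> 'f \<Rightarrow> 'f) \<Rightarrow>
   ('n \<Rightarrow> 'f \<Rightarrow> 'f \<Rightarrow> real) \<Rightarrow> (('n \<Rightarrow> 'f) \<Rightarrow> ('n \<Rightarrow> 'f) \<Rightarrow> 'n \<Rightarrow> 'f) \<Rightarrow> bool" where
  "kaehler_norden B J g nabla \<longleftrightarrow>
     smooth_atlas B \<and> almost_complex B J \<and> pseudo_riemannian B g \<and>
     (\<forall>p x y. g p (J p x) (J p y) = - g p x y) \<and>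
     levi_civita B g nabla \<and>
     (\<forall>W X Y. open W \<longrightarrow> smooth_vf_on B W X \<longrightarrow> smooth_vf_on B W Y \<longrightarrow>
        (\<forall>p\<in>W. nabla X (\<lambda>q. J q (Y q)) p - J p (nabla X Y p) = 0))"

definition const_totally_real_curv ::
  "('n, 'f::euclidean_space) chart set \<Rightarrow> ('n \<Rightarrow> 'f \<Rightarrow> 'f) \<Rightarrow> ('n \<Rightarrow> 'f \<Rightarrow> 'f \<Rightarrow> real) \<Rightarrow>
   (('n \<Rightarrow> 'f) \<Rightarrow> ('n \<Rightarrow> 'f) \<Rightarrow> 'n \<Rightarrow> 'f) \<Rightarrow> ('n \<Rightarrow> real) \<Rightarrow> ('n \<Rightarrow> real) \<Rightarrow> bool" where
  "const_totally_real_curv B J g nabla \<nu> \<nu>t \<longleftrightarrow>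
     (\<forall>p x y. x \<noteq> y \<and> independent {x, y} \<and> pi1 (g p) x y y x \<noteq> 0 \<and>
        (\<forall>v\<in>span {x, y}. \<forall>w\<in>span {x, y}. g p (J p v) w = 0) \<longrightarrow>
        curvature_tensor B g nabla p x y y x / pi1 (g p) x y y x = \<nu> p \<and>
        curvature_tensor B g nabla p x y y (J p x) / pi1 (g p) x y y x = \<nu>t p)"

text \<open>A hypersurface is a manifold \<open>(A)\<close> immersed by \<open>f\<close> with codimension one; embedded
  hypersurfaces are the case in which \<open>f\<close> is an embedding.\<close>

definition timelike_hypersurface ::
  "('m::{t2_space,second_countable_topology}, 'e::euclidean_space) chart set \<Rightarrow>
   ('n::topological_space, 'f::euclidean_space) chart set \<Rightarrow> ('n \<Rightarrow> 'f \<Rightarrow> 'f \<Rightarrow> real) \<Rightarrow>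
   ('m \<Rightarrow> 'n) \<Rightarrow> ('m \<Rightarrow> 'f) \<Rightarrow> bool" where
  "timelike_hypersurface A B g f N \<longleftrightarrow>
     smooth_atlas A \<and> DIM('f) = DIM('e) + 1 \<and> immersion A B f \<and>
     smooth_section_along A B f UNIV N \<and>
     (\<forall>p. g (f p) (N p) (N p) = -1 \<and> (\<forall>x. g (f p) (tmap A B f p x) (N p) = 0))"

definition hyp_angle ::
  "('n \<Rightarrow> 'f \<Rightarrow> 'f) \<Rightarrow> ('n \<Rightarrow> 'f \<Rightarrow> 'f \<Rightarrow> real) \<Rightarrow> ('m \<Rightarrow> 'n) \<Rightarrow> ('m \<Rightarrow> 'f) \<Rightarrow> 'm \<Rightarrow> real" where
  "hyp_angle J g f N p = arctan (g (f p) (N p) (J (f p) (N p)))"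

text \<open>\<open>gM\<close> is the induced metric. As the differential of \<open>f\<close> is injective, the equations determine
  \<open>\<phi>\<close> and \<open>\<xi>\<close>.\<close>

definition induced_structure ::
  "('m, 'e::euclidean_space) chart set \<Rightarrow> ('n, 'f::euclidean_space) chart set \<Rightarrow>
   ('n \<Rightarrow> 'f \<Rightarrow> 'f) \<Rightarrow> ('n \<Rightarrow> 'f \<Rightarrow> 'f \<Rightarrow> real) \<Rightarrow> ('m \<Rightarrow> 'n) \<Rightarrow> ('m \<Rightarrow> 'f) \<Rightarrow>
   ('m \<Rightarrow> 'e \<Rightarrow> 'e) \<Rightarrow> ('m \<Rightarrow> 'e) \<Rightarrow> ('m \<Rightarrow> 'e \<Rightarrow> real) \<Rightarrow> ('m \<Rightarrow> 'e \<Rightarrow> 'e \<Rightarrow> real) \<Rightarrow> bool" where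
  "induced_structure A B J g f N \<phi> \<xi> \<eta> gM \<longleftrightarrow>
     (\<forall>p. let t = hyp_angle J g f N p; df = tmap A B f p; JN = J (f p) (N p) in
        (\<forall>x. df (\<phi> p x) = J (f p) (df x)
               + (cos t * g (f p) (df x) JN) *\<^sub>R (cos t *\<^sub>R N p - sin t *\<^sub>R JN)) \<and>
        df (\<xi> p) = sin t *\<^sub>R N p + cos t *\<^sub>R JN \<and>
        (\<forall>x. \<eta> p x = cos t * g (f p) (df x) JN) \<and>
        (\<forall>x y. gM p x y = g (f p) (df x) (df y)))"

text \<open>The formulas of Gauss and Weingarten for the second fundamental tensor \<open>S\<close>, as identities
  between sections along \<open>f\<close>.\<close>

definition second_fundamental_tensor ::
  "('m::topological_space, 'e::euclidean_space) chart set \<Rightarrow> ('n, 'f::euclidean_space) chart set \<Rightarrow>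
   (('n \<Rightarrow> 'f) \<Rightarrow> ('n \<Rightarrow> 'f) \<Rightarrow> 'n \<Rightarrow> 'f) \<Rightarrow> ('m \<Rightarrow> 'n) \<Rightarrow> ('m \<Rightarrow> 'f) \<Rightarrow>
   ('m \<Rightarrow> 'e \<Rightarrow> 'e \<Rightarrow> real) \<Rightarrow> (('m \<Rightarrow> 'e) \<Rightarrow> ('m \<Rightarrow> 'e) \<Rightarrow> 'm \<Rightarrow> 'e) \<Rightarrow> ('m \<Rightarrow> 'e \<Rightarrow> 'e) \<Rightarrow> bool" where
  "second_fundamental_tensor A B nabla' f N gM nabla S \<longleftrightarrow>
     (\<forall>W X Y. open W \<longrightarrow> smooth_vf_on A W X \<longrightarrow> smooth_vf_on A W Y \<longrightarrow>
        (\<forall>p\<in>W. cov_deriv_along A B nabla' f (\<lambda>q. tmap A B f q (Y q)) p (X p)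
               = tmap A B f p (nabla X Y p) - gM p (S p (X p)) (Y p) *\<^sub>R N p)) \<and>
     (\<forall>p x. cov_deriv_along A B nabla' f N p x = - tmap A B f p (S p x))"

definition canonical_connection ::
  "('m, 'e::euclidean_space) chart set \<Rightarrow> ('m \<Rightarrow> 'e \<Rightarrow> 'e) \<Rightarrow> ('m \<Rightarrow> 'e) \<Rightarrow> ('m \<Rightarrow> 'e \<Rightarrow> real) \<Rightarrow>
   (('m \<Rightarrow> 'e) \<Rightarrow> ('m \<Rightarrow> 'e) \<Rightarrow> 'm \<Rightarrow> 'e) \<Rightarrow> ('m \<Rightarrow> 'e) \<Rightarrow> ('m \<Rightarrow> 'e) \<Rightarrow> 'm \<Rightarrow> 'e" where
  "canonical_connection A \<phi> \<xi> \<eta> nabla X Y p =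
     (let nabla_phi = (\<lambda>Z. nabla X (\<lambda>q. \<phi> q (Z q)) p - \<phi> p (nabla X Z p));
          nabla_eta = (\<lambda>Z. mderiv A (\<lambda>q. \<eta> q (Z q)) p (X p) - \<eta> p (nabla X Z p))
      in nabla X Y p
         + (1/2) *\<^sub>R (nabla_phi (\<lambda>q. \<phi> q (Y q)) + nabla_eta Y *\<^sub>R \<xi> p)
         - \<eta> p (Y p) *\<^sub>R nabla X \<xi> p)"

definition canonical_curvature ::
  "('m, 'e::euclidean_space) chart set \<Rightarrow> ('m \<Rightarrow> 'e \<Rightarrow> 'e) \<Rightarrow> ('m \<Rightarrow> 'e) \<Rightarrow> ('m \<Rightarrow> 'e \<Rightarrow> real) \<Rightarrow>
   ('m \<Rightarrow> 'e \<Rightarrow> 'e \<Rightarrow> real) \<Rightarrow> (('m \<Rightarrow> 'e) \<Rightarrow> ('m \<Rightarrow> 'e) \<Rightarrow> 'm \<Rightarrow> 'e) \<Rightarrow>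
   'm \<Rightarrow> 'e \<Rightarrow> 'e \<Rightarrow> 'e \<Rightarrow> 'e \<Rightarrow> real" where
  "canonical_curvature A \<phi> \<xi> \<eta> g nabla =
     curvature_tensor A g (canonical_connection A \<phi> \<xi> \<eta> nabla)"

end

theory Submission
  imports Defs
begin

text \<open>
  Let \<open>H\<close> be the distribution \<open>ker \<eta>\<close> on \<open>M\<close>. It is \<open>J\<close>-invariant, and its orthogonal complement in
  \<open>TM'\<close> along \<open>M\<close> is the complex line spanned by \<open>N\<close>. The canonical connection annihilates \<open>\<xi>\<close>, and on
  sections of \<open>H\<close> it is the orthogonal projection of \<open>\<nabla>'\<close> onto \<open>H\<close>. Its curvature is therefore given by
  an equation of Gauss in which the second fundamental form of \<open>H\<close> takes values in that complex line;
  by Weingarten's formula that form is expressed by \<open>S\<close>, and the factor \<open>- cos t (cos t - \<i> sin t)\<close> is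
  the inverse of the complex length \<open>- (1 + \<i> tan t)\<close> of \<open>N\<close>. The curvature of \<open>M'\<close> is the complex
  analogue of a tensor of constant sectional curvature: a Kaehler curvature tensor that vanishes on
  totally real planes vanishes.
\<close>

section \<open>Smooth functions on open sets\<close>

text \<open>What shapes the proof is that a tangent vector at \<open>q\<close> is written in the
  chart \<open>chart_at A q\<close>, which may jump with \<open>q\<close>: nothing can be
  differentiated before it is moved to one fixed chart. So a chart \<open>c\<close> of M and a chart
  \<open>d\<close> of M' are fixed, \<open>f\<close> becomes a smooth \<open>F\<close>, and sections
  along \<open>f\<close> become functions differentiated by
  \<open>dd s u v + \<Gamma> (F u) (dd F u v) (s u)\<close>. Nothing is extended from M to a
  neighbourhood in M', and coordinate fields commute, so bracket terms drop out.

  Smoothness of \<open>\<xi>\<close>, \<open>\<phi> X\<close> and \<open>D X Y\<close> must be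
  proved before \<open>D\<close> can be applied twice. Only their images under \<open>df\<close> are
  visibly smooth; the way back inverts the Gram matrix of the coordinate vectors, which is
  nondegenerate because \<open>N\<close> is not isotropic.

  The angle enters through \<open>C = cos t\<close> and \<open>m = tan t\<close> alone, tied by
  \<open>C * C * (1 + m * m) = 1\<close>, which keeps the algebra polynomial. The two bracketed
  tensors of the formula are real and imaginary part of one complex tensor on ker \<eta>, so the
  second scalar curvature is the first with rotated coefficients.\<close>

abbreviation dd :: "('a::real_normed_vector \<Rightarrow> 'b::real_normed_vector) \<Rightarrow> 'a \<Rightarrow> 'a \<Rightarrow> 'b" where
  "dd h x v \<equiv> frechet_derivative h (at x) v"

lemma dd_eqI: "(h has_derivative h') (at x) \<Longrightarrow> dd h x v = h' v"
  using frechet_derivative_at by metis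

lemma has_derivative_dd: "h differentiable (at x) \<Longrightarrow> (h has_derivative dd h x) (at x)"
  by (simp add: frechet_derivative_works)

lemma dd_cong_open:
  assumes "open S" "x \<in> S" "\<And>y. y \<in> S \<Longrightarrow> h y = k y"
  shows "dd h x v = dd k x v"
proof -
  have "(h has_derivative h') (at x) \<longleftrightarrow> (k has_derivative h') (at x)" for h'
    using has_derivative_transform_within_open[OF _ assms(1,2), of h h' UNIV k]
      has_derivative_transform_within_open[OF _ assms(1,2), of k h' UNIV h] assms(3) by auto
  then show ?thesis
    by (simp add: frechet_derivative_def)
qed

lemma differentiable_cong_open:
  assumes "open S" "x \<in> S" "\<And>y. y \<in> S \<Longrightarrow> h y = k y" "h differentiable (at x)"
  shows "k differentiable (at x)"
  using assms has_derivative_transform_within_open[OF _ assms(1,2), of h _ UNIV k]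
  unfolding differentiable_def by blast

text \<open>On an open set a derivative sees only the germ. This is what permits replacing
  \<open>h \<circ> cinv c\<close>, which is arbitrary outside the chart, by a formula valid only on
  it.\<close>

lemma Ck_on_cong:
  assumes "open S" "\<And>y. y \<in> S \<Longrightarrow> h y = k y" "Ck_on n S h"
  shows "Ck_on n S k"
  using assms(2,3)
proof (induction n arbitrary: h k)
  case 0
  then show ?case using continuous_on_cong[of S S h k] by simp
next
  case (Suc n)
  show ?case unfolding Ck_on.simps
  proof (intro conjI ballI allI)
    fix x assume "x \<in> S"
    then show "k differentiable (at x)"
      using differentiable_cong_open[OF assms(1) \<open>x \<in> S\<close> Suc.prems(1)] Suc.prems(2) by simp
  next
    fix v
    have "dd h x v = dd k x v" if "x \<in> S" for x
      using dd_cong_open[OF assms(1) that] Suc.prems(1) by blast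
    with Suc.prems Suc.IH[of "\<lambda>x. dd h x v" "\<lambda>x. dd k x v"]
    show "Ck_on n S (\<lambda>x. dd k x v)" by simp
  qed
qed

lemma Ck_on_subset: "Ck_on n S h \<Longrightarrow> T \<subseteq> S \<Longrightarrow> Ck_on n T h"
  by (induction n arbitrary: h) (auto intro: continuous_on_subset)

lemma Ck_on_SucD: "Ck_on (Suc n) S h \<Longrightarrow> Ck_on n S h"
proof (induction n arbitrary: h)
  case 0
  then show ?case
    by (auto simp: continuous_at_imp_continuous_on differentiable_imp_continuous_within)
next
  case (Suc n)
  then show ?case by (metis Ck_on.simps(2))
qed

lemma Ck_on_const: "Ck_on n S (\<lambda>x. c)"
  by (induction n arbitrary: c) simp_all

lemma Ck_on_bounded_linear:
  assumes "open S" "bounded_linear T" "Ck_on n S h"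
  shows "Ck_on n S (\<lambda>x. T (h x))"
  using assms(3)
proof (induction n arbitrary: h)
  case 0
  then show ?case using assms(2) by (simp add: bounded_linear.continuous_on)
next
  case (Suc n)
  have D: "((\<lambda>x. T (h x)) has_derivative (\<lambda>v. T (dd h x v))) (at x)" if "x \<in> S" for x
    using Suc.prems that by (auto intro!: bounded_linear.has_derivative[OF assms(2)] has_derivative_dd)
  have "Ck_on n S (\<lambda>x. dd (\<lambda>x. T (h x)) x v)" for v
    by (rule Ck_on_cong[OF assms(1) _ Suc.IH[of "\<lambda>x. dd h x v"]])
       (use Suc.prems D in \<open>auto simp: dd_eqI[OF D]\<close>)
  then show ?case using D by (auto simp: differentiable_def)
qed

lemma Ck_on_add:
  assumes "open S" "Ck_on n S h" "Ck_on n S k"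
  shows "Ck_on n S (\<lambda>x. h x + k x)"
  using assms(2,3)
proof (induction n arbitrary: h k)
  case 0
  then show ?case by (simp add: continuous_on_add)
next
  case (Suc n)
  have D: "((\<lambda>x. h x + k x) has_derivative (\<lambda>v. dd h x v + dd k x v)) (at x)" if "x \<in> S" for x
    using Suc.prems that by (auto intro!: has_derivative_add has_derivative_dd)
  have "Ck_on n S (\<lambda>x. dd (\<lambda>x. h x + k x) x v)" for v
    by (rule Ck_on_cong[OF assms(1) _ Suc.IH[of "\<lambda>x. dd h x v" "\<lambda>x. dd k x v"]])
       (use Suc.prems D in \<open>auto simp: dd_eqI[OF D]\<close>)
  then show ?case using D by (auto simp: differentiable_def)
qed

lemma Ck_on_bilinear:
  assumes "open S" "bounded_bilinear P" "Ck_on n S h" "Ck_on n S k"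
  shows "Ck_on n S (\<lambda>x. P (h x) (k x))"
  using assms(3,4)
proof (induction n arbitrary: h k)
  case 0
  then show ?case using assms(2) by (simp add: bounded_bilinear.continuous_on)
next
  case (Suc n)
  have D: "((\<lambda>x. P (h x) (k x)) has_derivative (\<lambda>v. P (h x) (dd k x v) + P (dd h x v) (k x))) (at x)"
    if "x \<in> S" for x
    using Suc.prems that by (auto intro!: bounded_bilinear.FDERIV[OF assms(2)] has_derivative_dd)
  \<comment> \<open>The product rule leaves one factor undifferentiated, so the induction hypothesis
    is also applied to \<open>h\<close> and \<open>k\<close> themselves.\<close>
  have "Ck_on n S h" "Ck_on n S k"
    using Suc.prems Ck_on_SucD by blast+
  then have "Ck_on n S (\<lambda>x. dd (\<lambda>x. P (h x) (k x)) x v)" for v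
    by (intro Ck_on_cong[OF assms(1) _ Ck_on_add[OF assms(1)
            Suc.IH[of h "\<lambda>x. dd k x v"] Suc.IH[of "\<lambda>x. dd h x v" k]]])
       (use Suc.prems D in \<open>auto simp: dd_eqI[OF D]\<close>)
  then show ?case using D by (auto simp: differentiable_def)
qed

lemma Ck_on_sum:
  assumes "open S" "\<And>i. i \<in> I \<Longrightarrow> Ck_on n S (h i)"
  shows "Ck_on n S (\<lambda>x. \<Sum>i\<in>I. h i x)"
  using assms(2)
  by (induction I rule: infinite_finite_induct)
     (auto simp: Ck_on_const intro!: Ck_on_add[OF assms(1)])

lemma smooth_on_cong:
  "open S \<Longrightarrow> (\<And>y. y \<in> S \<Longrightarrow> h y = k y) \<Longrightarrow> smooth_on S h \<Longrightarrow> smooth_on S k"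
  unfolding smooth_on_def using Ck_on_cong by blast

lemma smooth_on_subset: "smooth_on S h \<Longrightarrow> T \<subseteq> S \<Longrightarrow> smooth_on T h"
  unfolding smooth_on_def using Ck_on_subset by blast

lemma smooth_on_const: "smooth_on S (\<lambda>x. c)"
  by (simp add: smooth_on_def Ck_on_const)

lemma smooth_on_bounded_linear:
  "open S \<Longrightarrow> bounded_linear T \<Longrightarrow> smooth_on S h \<Longrightarrow> smooth_on S (\<lambda>x. T (h x))"
  by (simp add: smooth_on_def Ck_on_bounded_linear)

lemma smooth_on_add:
  "open S \<Longrightarrow> smooth_on S h \<Longrightarrow> smooth_on S k \<Longrightarrow> smooth_on S (\<lambda>x. h x + k x)"
  by (simp add: smooth_on_def Ck_on_add)

lemma smooth_on_minus: "open S \<Longrightarrow> smooth_on S h \<Longrightarrow> smooth_on S (\<lambda>x. - h x)"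
  by (rule smooth_on_bounded_linear[OF _ bounded_linear_minus[OF bounded_linear_ident]])

lemma smooth_on_diff:
  "open S \<Longrightarrow> smooth_on S h \<Longrightarrow> smooth_on S k \<Longrightarrow> smooth_on S (\<lambda>x. h x - k x)"
  using smooth_on_add[of S h "\<lambda>x. - k x"] smooth_on_minus[of S k] by simp

lemma smooth_on_scaleR:
  "open S \<Longrightarrow> smooth_on S h \<Longrightarrow> smooth_on S k \<Longrightarrow> smooth_on S (\<lambda>x. h x *\<^sub>R k x)"
  by (simp add: smooth_on_def Ck_on_bilinear[OF _ bounded_bilinear_scaleR])

lemma smooth_on_mult:
  fixes h k :: "'a::real_normed_vector \<Rightarrow> 'b::real_normed_algebra"
  shows "open S \<Longrightarrow> smooth_on S h \<Longrightarrow> smooth_on S k \<Longrightarrow> smooth_on S (\<lambda>x. h x * k x)"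
  by (simp add: smooth_on_def Ck_on_bilinear[OF _ bounded_bilinear_mult])

lemma smooth_on_inner:
  fixes h k :: "'a::real_normed_vector \<Rightarrow> 'b::real_inner"
  shows "open S \<Longrightarrow> smooth_on S h \<Longrightarrow> smooth_on S k \<Longrightarrow> smooth_on S (\<lambda>x. h x \<bullet> k x)"
  by (simp add: smooth_on_def Ck_on_bilinear[OF _ bounded_bilinear_inner])

lemma smooth_on_sum:
  "open S \<Longrightarrow> (\<And>i. i \<in> I \<Longrightarrow> smooth_on S (h i)) \<Longrightarrow> smooth_on S (\<lambda>x. \<Sum>i\<in>I. h i x)"
  by (simp add: smooth_on_def Ck_on_sum)

lemma smooth_on_prod:
  fixes h :: "'i \<Rightarrow> 'a::real_normed_vector \<Rightarrow> real"
  assumes "open S" "\<And>i. i \<in> I \<Longrightarrow> smooth_on S (h i)"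
  shows "smooth_on S (\<lambda>x. \<Prod>i\<in>I. h i x)"
  using assms(2)
  by (induction I rule: infinite_finite_induct)
     (auto simp: smooth_on_const intro!: smooth_on_mult[OF assms(1)])

lemma smooth_on_ident: "smooth_on S (\<lambda>x. x)"
proof -
  have "Ck_on n S (\<lambda>x. x)" for n
    by (cases n) (auto simp: Ck_on_const)
  then show ?thesis by (simp add: smooth_on_def)
qed

lemma smooth_onD: "smooth_on S h \<Longrightarrow> x \<in> S \<Longrightarrow> h differentiable (at x)"
  using Ck_on.simps(2)[of 0 S h] unfolding smooth_on_def by blast

lemma smooth_on_has_derivative: "smooth_on S h \<Longrightarrow> x \<in> S \<Longrightarrow> (h has_derivative dd h x) (at x)"
  using smooth_onD has_derivative_dd by blast

lemma smooth_on_dd: "smooth_on S h \<Longrightarrow> smooth_on S (\<lambda>x. dd h x v)"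
  using Ck_on.simps(2)[of _ S h] unfolding smooth_on_def by blast

lemma smooth_on_continuous_on: "smooth_on S h \<Longrightarrow> continuous_on S h"
  using Ck_on.simps(1) unfolding smooth_on_def by blast

lemma smooth_on_components:
  fixes h :: "'a::real_normed_vector \<Rightarrow> 'b::euclidean_space"
  assumes "open S" "\<And>b. b \<in> Basis \<Longrightarrow> smooth_on S (\<lambda>x. h x \<bullet> b)"
  shows "smooth_on S h"
proof -
  have "smooth_on S (\<lambda>x. \<Sum>b\<in>Basis. (h x \<bullet> b) *\<^sub>R b)"
    using assms by (intro smooth_on_sum smooth_on_scaleR smooth_on_const) auto
  then show ?thesis by (simp add: euclidean_representation)
qed

text \<open>The derivative of \<open>1 / h\<close> is a polynomial in \<open>1 / h\<close> and the
  derivative of \<open>h\<close>, so each order of regularity of \<open>1 / h\<close> yields the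
  next.\<close>

lemma smooth_on_inverse:
  fixes h :: "'a::real_normed_vector \<Rightarrow> real"
  assumes "open S" "smooth_on S h" "\<And>x. x \<in> S \<Longrightarrow> h x \<noteq> 0"
  shows "smooth_on S (\<lambda>x. inverse (h x))"
proof -
  have D: "((\<lambda>x. inverse (h x)) has_derivative (\<lambda>v. - (inverse (h x) * dd h x v * inverse (h x)))) (at x)"
    if "x \<in> S" for x
    using smooth_on_has_derivative[OF assms(2) that] assms(3)[OF that]
    by (auto intro!: has_derivative_inverse)
  have "Ck_on n S (\<lambda>x. inverse (h x))" for n
  proof (induction n)
    case 0
    show ?case using smooth_on_continuous_on[OF assms(2)] assms(3)
      by (auto intro!: continuous_on_inverse)
  next
    case (Suc n)
    have "Ck_on n S (\<lambda>x. dd h x v)" for v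
      using smooth_on_dd[OF assms(2)] by (simp add: smooth_on_def)
    then have "Ck_on n S (\<lambda>x. (- 1) * (inverse (h x) * dd h x v * inverse (h x)))" for v
      by (intro Ck_on_bilinear[OF assms(1) bounded_bilinear_mult] Suc Ck_on_const) auto
    note smooth' = this
    have "Ck_on n S (\<lambda>x. dd (\<lambda>x. inverse (h x)) x v)" for v
      by (intro Ck_on_cong[OF assms(1) _ smooth'[of v]]) (subst dd_eqI[OF D], assumption, simp)
    then show ?case using D by (auto simp: differentiable_def)
  qed
  then show ?thesis by (simp add: smooth_on_def)
qed

text \<open>The same bootstrap as for the inverse: \<open>c = cos (arctan h)\<close> satisfies
  \<open>dc = - h c^3 dh\<close>, an equation whose right side involves no new function.\<close>

lemma smooth_on_cos_arctan:
  fixes h :: "'a::real_normed_vector \<Rightarrow> real"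
  assumes "open S" "smooth_on S h"
  shows "smooth_on S (\<lambda>x. cos (arctan (h x)))"
proof -
  let ?c = "\<lambda>x. cos (arctan (h x))"
  have D: "(?c has_derivative (\<lambda>v. (- h x) * dd h x v * ?c x * (?c x * ?c x))) (at x)"
    if "x \<in> S" for x
  proof -
    have c0: "?c x \<noteq> 0"
      using cos_arctan_not_zero by blast
    have "?c x * ?c x = inverse (1 + (h x)\<^sup>2)"
      using tan_sec[OF c0] by (simp add: tan_arctan power_inverse power2_eq_square)
    moreover have "sin (arctan (h x)) = h x * ?c x"
      using c0 tan_arctan[of "h x"] by (simp add: tan_def divide_simps)
    moreover have "(?c has_derivative (\<lambda>v. (inverse (1 + (h x)\<^sup>2) * dd h x v) * (- sin (arctan (h x))))) (at x)"
    proof -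
      have "((\<lambda>x. arctan (h x)) has_derivative (\<lambda>v. inverse (1 + (h x)\<^sup>2) * dd h x v)) (at x)"
        using has_derivative_compose[OF smooth_on_has_derivative[OF assms(2) that]
            DERIV_arctan[of "h x", unfolded has_field_derivative_def]]
        by (simp add: mult.commute)
      from has_derivative_compose[OF this DERIV_cos[of "arctan (h x)", unfolded has_field_derivative_def]]
      show ?thesis by (simp add: mult.commute)
    qed
    ultimately show ?thesis
      by (auto elim!: has_derivative_eq_rhs simp: algebra_simps)
  qed
  have "Ck_on n S ?c" for n
  proof (induction n)
    case 0
    show ?case using smooth_on_continuous_on[OF assms(2)]
      by (auto intro!: continuous_intros)
  next
    case (Suc n)
    have "Ck_on n S (\<lambda>x. dd h x v)" "Ck_on n S (\<lambda>x. - h x)" for v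
      using smooth_on_dd[OF assms(2)] smooth_on_minus[OF assms] by (simp_all add: smooth_on_def)
    then have "Ck_on n S (\<lambda>x. (- h x) * dd h x v * ?c x * (?c x * ?c x))" for v
      by (intro Ck_on_bilinear[OF assms(1) bounded_bilinear_mult] Suc) auto
    note smooth' = this
    have "Ck_on n S (\<lambda>x. dd ?c x v)" for v
      by (intro Ck_on_cong[OF assms(1) _ smooth'[of v]]) (subst dd_eqI[OF D], assumption, simp)
    then show ?case using D by (auto simp: differentiable_def)
  qed
  then show ?thesis by (simp add: smooth_on_def)
qed

section \<open>Rules for directional derivatives and composition\<close>

lemma dd_add: "h differentiable (at x) \<Longrightarrow> k differentiable (at x) \<Longrightarrow>
    dd (\<lambda>x. h x + k x) x v = dd h x v + dd k x v"
  by (rule dd_eqI[OF has_derivative_add[OF has_derivative_dd has_derivative_dd]])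

lemma dd_diff: "h differentiable (at x) \<Longrightarrow> k differentiable (at x) \<Longrightarrow>
    dd (\<lambda>x. h x - k x) x v = dd h x v - dd k x v"
  by (rule dd_eqI[OF has_derivative_diff[OF has_derivative_dd has_derivative_dd]])

lemma dd_scaleR: "h differentiable (at x) \<Longrightarrow> k differentiable (at x) \<Longrightarrow>
    dd (\<lambda>x. h x *\<^sub>R k x) x v = dd h x v *\<^sub>R k x + h x *\<^sub>R dd k x v"
  by (subst dd_eqI[OF has_derivative_scaleR[OF has_derivative_dd has_derivative_dd]])
    (simp_all add: add.commute)

lemma dd_sum:
  "(\<And>i. i \<in> I \<Longrightarrow> h i differentiable (at x)) \<Longrightarrow> dd (\<lambda>x. \<Sum>i\<in>I. h i x) x v = (\<Sum>i\<in>I. dd (h i) x v)"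
  by (rule dd_eqI[OF has_derivative_sum[OF has_derivative_dd]])

lemma dd_bounded_linear:
  "bounded_linear T \<Longrightarrow> h differentiable (at x) \<Longrightarrow> dd (\<lambda>x. T (h x)) x v = T (dd h x v)"
  by (rule dd_eqI[OF bounded_linear.has_derivative[OF _ has_derivative_dd]])

lemma dd_compose:
  assumes "h differentiable (at x)" "k differentiable (at (h x))"
  shows "dd (\<lambda>x. k (h x)) x v = dd k (h x) (dd h x v)"
  by (rule dd_eqI[OF has_derivative_compose[OF assms[THEN has_derivative_dd]]])

lemma linear_dd: "h differentiable (at x) \<Longrightarrow> linear (dd h x)"
  by (rule linear_frechet_derivative)

lemmas linear_comp = linear_compose[unfolded o_def]

lemma linear_expand:
  fixes L :: "'a::euclidean_space \<Rightarrow> 'b::real_vector"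
  assumes "linear L"
  shows "L w = (\<Sum>b\<in>Basis. (w \<bullet> b) *\<^sub>R L b)"
proof -
  have "L w = L (\<Sum>b\<in>Basis. (w \<bullet> b) *\<^sub>R b)" by (simp add: euclidean_representation)
  then show ?thesis using assms by (simp add: linear_sum linear_scale)
qed

text \<open>Expanding the chain rule in a basis writes the derivative as a sum of smooth
  coefficients times \<open>dd k (h x) b\<close> with constant \<open>b\<close>. These are again
  compositions with \<open>h\<close>, so the induction runs over all smooth \<open>k\<close> for one
  fixed \<open>h\<close>.\<close>

lemma smooth_on_compose:
  fixes h :: "'a::real_normed_vector \<Rightarrow> 'b::euclidean_space"
  assumes "open S" "open T" "h ` S \<subseteq> T" "smooth_on S h" "smooth_on T k"
  shows "smooth_on S (\<lambda>x. k (h x))"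
proof -
  have "Ck_on n S (\<lambda>x. k (h x))" if "smooth_on T k" for n and k :: "'b \<Rightarrow> 'c"
    using that
  proof (induction n arbitrary: k)
    case 0
    then show ?case
      using continuous_on_compose2[OF smooth_on_continuous_on smooth_on_continuous_on[OF assms(4)]]
        assms(3) by simp
  next
    case (Suc n)
    have d: "h differentiable (at x)" "k differentiable (at (h x))" if "x \<in> S" for x
      using smooth_onD[OF assms(4) that] smooth_onD[OF Suc.prems] assms(3) that
      by auto
    have e: "dd (\<lambda>x. k (h x)) x v = (\<Sum>b\<in>Basis. (dd h x v \<bullet> b) *\<^sub>R dd k (h x) b)" if "x \<in> S" for x v
      unfolding dd_compose[OF d[OF that]] by (rule linear_expand[OF linear_dd[OF d(2)[OF that]]])
    have c: "Ck_on n S (\<lambda>x. \<Sum>b\<in>Basis. (dd h x v \<bullet> b) *\<^sub>R dd k (h x) b)" for v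
    proof (intro Ck_on_sum[OF assms(1)] Ck_on_bilinear[OF assms(1) bounded_bilinear_scaleR])
      fix b :: 'b assume "b \<in> Basis"
      show "Ck_on n S (\<lambda>x. dd h x v \<bullet> b)"
        using smooth_on_inner[OF assms(1) smooth_on_dd[OF assms(4), of v] smooth_on_const[of S b]]
        by (simp add: smooth_on_def)
      show "Ck_on n S (\<lambda>x. dd k (h x) b)"
        by (rule Suc.IH[OF smooth_on_dd[OF Suc.prems]])
    qed
    have "Ck_on n S (\<lambda>x. dd (\<lambda>x. k (h x)) x v)" for v
      by (rule Ck_on_cong[OF assms(1) e[symmetric] c])
    moreover have "(\<lambda>x. k (h x)) differentiable (at x)" if "x \<in> S" for x
      using differentiable_chain_at[OF d[OF that]] by (simp add: o_def)
    ultimately show ?case by simp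
  qed
  with assms(5) show ?thesis by (simp add: smooth_on_def)
qed

text \<open>The product rule for a varying linear map applied to a varying vector. Smoothness is
  asked only of \<open>L x w\<close> for constant \<open>w\<close>, the form in which Jacobians,
  metrics and endomorphism fields present themselves.\<close>

lemma linear_family:
  fixes L :: "'a::real_normed_vector \<Rightarrow> 'b::euclidean_space \<Rightarrow> 'c::real_normed_vector"
  assumes "open S" "\<And>x. x \<in> S \<Longrightarrow> linear (L x)" "\<And>w. smooth_on S (\<lambda>x. L x w)" "smooth_on S s"
  shows smooth_on_linear_family: "smooth_on S (\<lambda>x. L x (s x))"
    and dd_linear_family: "x \<in> S \<Longrightarrow>
      dd (\<lambda>x. L x (s x)) x v = dd (\<lambda>y. L y (s x)) x v + L x (dd s x v)"
proof -
  have E: "L x (s' x) = (\<Sum>b\<in>Basis. (s' x \<bullet> b) *\<^sub>R L x b)" if "x \<in> S" for x and s' :: "'a \<Rightarrow> 'b"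
    using linear_expand[OF assms(2)[OF that]] .
  have sm: "smooth_on S (\<lambda>x. s x \<bullet> b)" for b
    by (intro smooth_on_inner assms(1,4) smooth_on_const)
  have "smooth_on S (\<lambda>x. \<Sum>b\<in>Basis. (s x \<bullet> b) *\<^sub>R L x b)"
    by (intro smooth_on_sum smooth_on_scaleR sm assms(1,3))
  then show "smooth_on S (\<lambda>x. L x (s x))"
    by (rule smooth_on_cong[OF assms(1), rotated]) (simp add: E)
  assume x: "x \<in> S"
  note df = smooth_onD[OF _ x]
  have "dd (\<lambda>x. L x (s x)) x v = dd (\<lambda>x. \<Sum>b\<in>Basis. (s x \<bullet> b) *\<^sub>R L x b) x v"
    by (rule dd_cong_open[OF assms(1) x]) (simp add: E)
  also have "\<dots> = (\<Sum>b\<in>Basis. (dd s x v \<bullet> b) *\<^sub>R L x b + (s x \<bullet> b) *\<^sub>R dd (\<lambda>x. L x b) x v)"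
    by (subst dd_sum, rule differentiable_scaleR[OF df[OF sm] df[OF assms(3)]])
       (simp add: dd_scaleR[OF df[OF sm] df[OF assms(3)]]
          dd_bounded_linear[OF bounded_linear_inner_left df[OF assms(4)]])
  also have "\<dots> = L x (dd s x v) + (\<Sum>b\<in>Basis. (s x \<bullet> b) *\<^sub>R dd (\<lambda>x. L x b) x v)"
    by (simp add: sum.distrib linear_expand[OF assms(2)[OF x], of "dd s x v"])
  also have "(\<Sum>b\<in>Basis. (s x \<bullet> b) *\<^sub>R dd (\<lambda>x. L x b) x v) = dd (\<lambda>y. L y (s x)) x v"
  proof -
    have "dd (\<lambda>y. L y (s x)) x v = dd (\<lambda>y. \<Sum>b\<in>Basis. (s x \<bullet> b) *\<^sub>R L y b) x v"
      by (rule dd_cong_open[OF assms(1) x]) (rule linear_expand[OF assms(2)])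
    also have "\<dots> = (\<Sum>b\<in>Basis. (s x \<bullet> b) *\<^sub>R dd (\<lambda>x. L x b) x v)"
      by (subst dd_sum, rule differentiable_scaleR[OF differentiable_const df[OF assms(3)]])
        (simp add: dd_scaleR[OF differentiable_const df[OF assms(3)]])
    finally show ?thesis by simp
  qed
  finally show "dd (\<lambda>x. L x (s x)) x v = dd (\<lambda>y. L y (s x)) x v + L x (dd s x v)"
    by (simp add: add.commute)
qed

text \<open>Two applications of the mean value theorem, in the direction \<open>v\<close> and then
  \<open>w\<close>. The left side is symmetric in \<open>v\<close> and \<open>w\<close>, the right
  side is one of the two mixed derivatives at a nearby point.\<close>

lemma second_difference:
  fixes h :: "'a::real_normed_vector \<Rightarrow> real"
  assumes "smooth_on S h" "0 < e"
    and S: "\<And>s t. 0 \<le> s \<Longrightarrow> s \<le> e \<Longrightarrow> 0 \<le> t \<Longrightarrow> t \<le> e \<Longrightarrow> x + s *\<^sub>R v + t *\<^sub>R w \<in> S"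
  obtains s t where "0 < s" "s < e" "0 < t" "t < e"
    "h (x + e *\<^sub>R v + e *\<^sub>R w) - h (x + e *\<^sub>R v) - h (x + e *\<^sub>R w) + h x
      = e * e * dd (\<lambda>y. dd h y v) (x + s *\<^sub>R v + t *\<^sub>R w) w"
proof -
  have D: "((\<lambda>s. k (y + s *\<^sub>R u)) has_real_derivative dd k (y + s *\<^sub>R u) u) (at s)"
    if "smooth_on S k" "y + s *\<^sub>R u \<in> S" for k :: "'a \<Rightarrow> real" and y u s
  proof -
    have "((\<lambda>s. y + s *\<^sub>R u) has_derivative (\<lambda>r. r *\<^sub>R u)) (at s)"
      by (auto intro!: derivative_eq_intros)
    from has_derivative_compose[OF this smooth_on_has_derivative[OF that]]
    show ?thesis
      by (simp add: has_field_derivative_def linear_scale[OF linear_dd[OF smooth_onD[OF that]]]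
          mult_commute_abs)
  qed
  let ?k = "\<lambda>s. h (x + e *\<^sub>R w + s *\<^sub>R v) - h (x + s *\<^sub>R v)"
  have "(?k has_real_derivative dd h (x + e *\<^sub>R w + s *\<^sub>R v) v - dd h (x + s *\<^sub>R v) v) (at s)"
    if "0 \<le> s" "s \<le> e" for s
    using D[OF assms(1), of "x + e *\<^sub>R w" s v] D[OF assms(1), of x s v] S[OF that, of e] S[OF that, of 0] assms(2)
    by (intro DERIV_diff) (auto simp: algebra_simps)
  from MVT2[OF assms(2) this] obtain s where s: "0 < s" "s < e"
    "?k e - ?k 0 = e * (dd h (x + e *\<^sub>R w + s *\<^sub>R v) v - dd h (x + s *\<^sub>R v) v)"
    by auto
  let ?m = "\<lambda>t. dd h (x + s *\<^sub>R v + t *\<^sub>R w) v"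
  have "(?m has_real_derivative dd (\<lambda>y. dd h y v) (x + s *\<^sub>R v + t *\<^sub>R w) w) (at t)" if "0 \<le> t" "t \<le> e" for t
    by (rule D[OF smooth_on_dd[OF assms(1)]]) (use S[OF _ _ that, of s] s in auto)
  from MVT2[OF assms(2) this] obtain t where t: "0 < t" "t < e"
    "?m e - ?m 0 = e * dd (\<lambda>y. dd h y v) (x + s *\<^sub>R v + t *\<^sub>R w) w"
    by auto
  have "dd h (x + e *\<^sub>R w + s *\<^sub>R v) v - dd h (x + s *\<^sub>R v) v = ?m e - ?m 0"
    by (simp add: algebra_simps)
  with s(3) t(3) have "?k e - ?k 0 = e * e * dd (\<lambda>y. dd h y v) (x + s *\<^sub>R v + t *\<^sub>R w) w"
    by simp
  then show thesis
    using that[OF s(1,2) t(1,2)] by (simp add: algebra_simps)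
qed

text \<open>Evaluating the second difference in both orders makes the two mixed derivatives agree at
  a pair of points arbitrarily close to \<open>x\<close>; by continuity they cannot differ at
  \<open>x\<close>.\<close>

lemma mixed_dd_real:
  fixes h :: "'a::real_normed_vector \<Rightarrow> real"
  assumes "open S" "smooth_on S h" "x \<in> S"
  shows "dd (\<lambda>y. dd h y v) x w = dd (\<lambda>y. dd h y w) x v"
proof (rule ccontr)
  let ?G = "\<lambda>y. dd (\<lambda>y. dd h y v) y w" and ?H = "\<lambda>y. dd (\<lambda>y. dd h y w) y v"
  assume ne: "?G x \<noteq> ?H x"
  have "continuous (at x) ?G" "continuous (at x) ?H"
    using smooth_on_continuous_on[OF smooth_on_dd[OF smooth_on_dd[OF assms(2)]]]
    by (auto simp: continuous_on_eq_continuous_at[OF assms(1)] assms(3))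
  moreover have e: "\<bar>?G x - ?H x\<bar> / 2 > 0"
    using ne by simp
  ultimately obtain d1 d2 where d: "d1 > 0" "d2 > 0"
    "\<And>y. dist y x < d1 \<Longrightarrow> dist (?G y) (?G x) < \<bar>?G x - ?H x\<bar> / 2"
    "\<And>y. dist y x < d2 \<Longrightarrow> dist (?H y) (?H x) < \<bar>?G x - ?H x\<bar> / 2"
    unfolding continuous_at_eps_delta by blast
  obtain d3 where d3: "d3 > 0" "\<And>y. dist y x < d3 \<Longrightarrow> y \<in> S"
    using assms(1,3) unfolding open_dist by blast
  define d where "d = min d1 (min d2 d3)"
  \<comment> \<open>The summand 1 keeps the denominator positive when both vectors vanish; the
    factor 1/2 gives strict inequality for parameters up to \<open>e\<close> inclusive.\<close>
  define e where "e = d / 2 / (norm v + norm w + 1)"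
  have pos: "d > 0" "norm v + norm w + 1 > 0"
    using d d3 by (auto simp: d_def add_nonneg_pos)
  then have e0: "e > 0" by (simp add: e_def)
  have near: "dist (x + s *\<^sub>R v + t *\<^sub>R w) x < d" if "0 \<le> s" "s \<le> e" "0 \<le> t" "t \<le> e" for s t
  proof -
    have "dist (x + s *\<^sub>R v + t *\<^sub>R w) x \<le> s * norm v + t * norm w"
      using norm_triangle_ineq[of "s *\<^sub>R v" "t *\<^sub>R w"] that by (simp add: dist_norm add.assoc)
    also have "\<dots> \<le> e * (norm v + norm w + 1)"
      using mult_right_mono[OF that(2), of "norm v"] mult_right_mono[OF that(4), of "norm w"] e0
      by (simp add: algebra_simps)
    also have "\<dots> = d / 2"
      using pos(2) unfolding e_def by (intro nonzero_eq_divide_eq[THEN iffD1]) auto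
    also have "\<dots> < d"
      using pos by simp
    finally show ?thesis .
  qed
  have inS: "x + s *\<^sub>R v + t *\<^sub>R w \<in> S" "x + t *\<^sub>R w + s *\<^sub>R v \<in> S"
    if "0 \<le> s" "s \<le> e" "0 \<le> t" "t \<le> e" for s t
    using near[OF that] d3(2)[of "x + s *\<^sub>R v + t *\<^sub>R w"] by (auto simp: d_def ac_simps)
  obtain s t where st: "0 < s" "s < e" "0 < t" "t < e"
    "h (x + e *\<^sub>R v + e *\<^sub>R w) - h (x + e *\<^sub>R v) - h (x + e *\<^sub>R w) + h x = e * e * ?G (x + s *\<^sub>R v + t *\<^sub>R w)"
    using second_difference[OF assms(2) e0 inS(1)] by blast
  obtain s' t' where st': "0 < s'" "s' < e" "0 < t'" "t' < e"
    "h (x + e *\<^sub>R w + e *\<^sub>R v) - h (x + e *\<^sub>R w) - h (x + e *\<^sub>R v) + h x = e * e * ?H (x + s' *\<^sub>R w + t' *\<^sub>R v)"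
    using second_difference[OF assms(2) e0 inS(2)] by blast
  have "e * e * ?G (x + s *\<^sub>R v + t *\<^sub>R w) = e * e * ?H (x + s' *\<^sub>R w + t' *\<^sub>R v)"
    unfolding st(5)[symmetric] st'(5)[symmetric] by (simp add: add.commute add.left_commute)
  then have "?G (x + s *\<^sub>R v + t *\<^sub>R w) = ?H (x + s' *\<^sub>R w + t' *\<^sub>R v)"
    using e0 by simp
  moreover have "dist (x + s *\<^sub>R v + t *\<^sub>R w) x < d1" "dist (x + s' *\<^sub>R w + t' *\<^sub>R v) x < d2"
    using near[of s t] near[of t' s'] st st' by (auto simp: d_def ac_simps)
  ultimately have "\<bar>?H (x + s' *\<^sub>R w + t' *\<^sub>R v) - ?G x\<bar> < \<bar>?G x - ?H x\<bar> / 2"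
      "\<bar>?H (x + s' *\<^sub>R w + t' *\<^sub>R v) - ?H x\<bar> < \<bar>?G x - ?H x\<bar> / 2"
    using d(3)[of "x + s *\<^sub>R v + t *\<^sub>R w"] d(4)[of "x + s' *\<^sub>R w + t' *\<^sub>R v"]
    unfolding dist_real_def by metis+
  then show False by (auto simp: abs_if split: if_splits)
qed

lemma mixed_dd:
  fixes h :: "'a::real_normed_vector \<Rightarrow> 'b::euclidean_space"
  assumes "open S" "smooth_on S h" "x \<in> S"
  shows "dd (\<lambda>y. dd h y v) x w = dd (\<lambda>y. dd h y w) x v"
proof (rule euclidean_eqI)
  fix b :: 'b
  have i: "smooth_on S (\<lambda>y. h y \<bullet> b)"
    by (intro smooth_on_inner assms(1,2) smooth_on_const)
  have "dd (\<lambda>y. dd (\<lambda>y. h y \<bullet> b) y v) x w = dd (\<lambda>y. dd h y v) x w \<bullet> b" for v w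
  proof -
    have "dd (\<lambda>y. dd (\<lambda>y. h y \<bullet> b) y v) x w = dd (\<lambda>y. dd h y v \<bullet> b) x w"
      by (rule dd_cong_open[OF assms(1,3)])
        (rule dd_bounded_linear[OF bounded_linear_inner_left smooth_onD[OF assms(2)]])
    also have "\<dots> = dd (\<lambda>y. dd h y v) x w \<bullet> b"
      by (rule dd_bounded_linear[OF bounded_linear_inner_left
            smooth_onD[OF smooth_on_dd[OF assms(2)] assms(3)]])
    finally show ?thesis .
  qed
  with mixed_dd_real[OF assms(1) i assms(3), of v w]
  show "dd (\<lambda>y. dd h y v) x w \<bullet> b = dd (\<lambda>y. dd h y w) x v \<bullet> b"
    by simp
qed

section \<open>Charts and coordinate representations\<close>

locale atlas =
  fixes A :: "('m::{t2_space,second_countable_topology}, 'e::euclidean_space) chart set"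
  assumes smooth_atlas: "smooth_atlas A"
begin

lemma is_chart: "c \<in> A \<Longrightarrow> is_chart c"
  using smooth_atlas by (simp add: smooth_atlas_def)

lemma open_cdom: "c \<in> A \<Longrightarrow> open (cdom c)"
  using is_chart by (simp add: is_chart_def)

lemma chart_at: "chart_at A p \<in> A" "p \<in> cdom (chart_at A p)"
proof -
  have "\<exists>c. c \<in> A \<and> p \<in> cdom c"
    using smooth_atlas unfolding smooth_atlas_def by blast
  from someI_ex[OF this] show "chart_at A p \<in> A" "p \<in> cdom (chart_at A p)"
    unfolding chart_at_def by auto
qed

lemma cinv_cmap: "c \<in> A \<Longrightarrow> q \<in> cdom c \<Longrightarrow> cinv c (cmap c q) = q"
  using is_chart[of c] by (auto simp: is_chart_def homeomorphism_def)

lemma open_cmap_image: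
  assumes "c \<in> A" "open W" "W \<subseteq> cdom c"
  shows "open (cmap c ` W)"
proof -
  have "cmap c ` W = cinv c -` W \<inter> cmap c ` cdom c"
    using assms(3) cinv_cmap[OF assms(1)] by force
  moreover have "open (cinv c -` W \<inter> cmap c ` cdom c)"
    using is_chart[OF assms(1)] assms(2)
    by (subst Int_commute, intro continuous_open_preimage)
       (auto simp: is_chart_def homeomorphism_def)
  ultimately show ?thesis by simp
qed

lemma transition_smooth:
  "c \<in> A \<Longrightarrow> d \<in> A \<Longrightarrow> smooth_on (cmap c ` (cdom c \<inter> cdom d)) (cmap d \<circ> cinv c)"
  using smooth_atlas by (simp add: smooth_atlas_def)

lemma open_transition: "c \<in> A \<Longrightarrow> d \<in> A \<Longrightarrow> open (cmap c ` (cdom c \<inter> cdom d))"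
  by (intro open_cmap_image) (auto intro: open_cdom)

text \<open>The chain rule for a transition map frees derivatives from the distinguished chart
  \<open>chart_at A p\<close>: any chart around \<open>p\<close> computes them.\<close>

lemma mderiv_chart:
  assumes c: "c \<in> A" and p: "p \<in> cdom c" and h: "(h \<circ> cinv c) differentiable (at (cmap c p))"
  shows "mderiv A h p v = dd (h \<circ> cinv c) (cmap c p) (tcoord A c p v)"
proof -
  let ?e = "chart_at A p"
  let ?T = "cmap c \<circ> cinv ?e"
  let ?O = "cmap ?e ` (cdom ?e \<inter> cdom c)"
  note e = chart_at[of p]
  have O: "open ?O" "cmap ?e p \<in> ?O"
    using open_transition[OF e(1) c] e(2) p by auto
  have T: "?T differentiable (at (cmap ?e p))"
    using smooth_onD[OF transition_smooth[OF e(1) c] O(2)] .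
  have Tp: "?T (cmap ?e p) = cmap c p"
    using cinv_cmap e by simp
  have "dd (h \<circ> cinv ?e) (cmap ?e p) v = dd (\<lambda>u. (h \<circ> cinv c) (?T u)) (cmap ?e p) v"
    by (rule dd_cong_open[OF O]) (auto simp: cinv_cmap c e)
  also have "\<dots> = dd (h \<circ> cinv c) (?T (cmap ?e p)) (dd ?T (cmap ?e p) v)"
    using dd_compose[OF T, of "h \<circ> cinv c"] h Tp by simp
  finally show ?thesis
    unfolding Tp by (simp add: mderiv_def tcoord_def)
qed

lemma tcoord_self: "tcoord A (chart_at A p) p v = v"
proof -
  let ?e = "chart_at A p"
  have "dd (cmap ?e \<circ> cinv ?e) (cmap ?e p) v = dd (\<lambda>u. u) (cmap ?e p) v"
    using open_cmap_image[OF chart_at(1) open_cdom[OF chart_at(1)] order_refl, of p] chart_at[of p]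
    by (intro dd_cong_open[of "cmap ?e ` cdom ?e"]) (auto simp: cinv_cmap)
  then show ?thesis by (simp add: tcoord_def mderiv_def)
qed

lemma transition_differentiable:
  "c \<in> A \<Longrightarrow> d \<in> A \<Longrightarrow> p \<in> cdom c \<Longrightarrow> p \<in> cdom d \<Longrightarrow>
    (cmap d \<circ> cinv c) differentiable (at (cmap c p))"
  using smooth_onD[OF transition_smooth] by blast

lemma tcoord_change:
  assumes "c \<in> A" "d \<in> A" "p \<in> cdom c" "p \<in> cdom d"
  shows "tcoord A d p v = dd (cmap d \<circ> cinv c) (cmap c p) (tcoord A c p v)"
  unfolding tcoord_def[of A d p]
  by (rule mderiv_chart[OF assms(1,3) transition_differentiable[OF assms]])

lemma tvec_change:
  assumes "c \<in> A" "p \<in> cdom c"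
  shows "tcoord A c p (tvec A c p w) = w" "tvec A c p (tcoord A c p v) = v"
proof -
  let ?e = "chart_at A p"
  note e = chart_at[of p]
  have inv: "dd (cmap c \<circ> cinv d) (cmap d p) (dd (cmap d \<circ> cinv c) (cmap c p) w) = w"
    if "c \<in> A" "d \<in> A" "p \<in> cdom c" "p \<in> cdom d" for c d w
  proof -
    have "dd (cmap c \<circ> cinv d) ((cmap d \<circ> cinv c) (cmap c p)) (dd (cmap d \<circ> cinv c) (cmap c p) w)
        = dd (\<lambda>u. (cmap c \<circ> cinv d) ((cmap d \<circ> cinv c) u)) (cmap c p) w"
      using transition_differentiable[OF that] transition_differentiable[OF that(2,1,4,3)] that
      by (subst dd_compose) (auto simp: cinv_cmap)
    also have "\<dots> = dd (\<lambda>u. u) (cmap c p) w"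
      using that by (intro dd_cong_open[OF open_transition[of c d]]) (auto simp: cinv_cmap)
    finally show ?thesis using that by (simp add: cinv_cmap)
  qed
  have tc: "tcoord A c p v = dd (cmap c \<circ> cinv ?e) (cmap ?e p) v" for v
    by (simp add: tcoord_def mderiv_def)
  show "tcoord A c p (tvec A c p w) = w" "tvec A c p (tcoord A c p v) = v"
    unfolding tc tvec_def using inv assms e by auto
qed

lemma linear_tcoord: "c \<in> A \<Longrightarrow> p \<in> cdom c \<Longrightarrow> linear (tcoord A c p)"
  using linear_dd[OF transition_differentiable[OF chart_at(1) _ chart_at(2)]]
  by (simp add: tcoord_def[abs_def] mderiv_def)

lemma linear_tvec: "c \<in> A \<Longrightarrow> p \<in> cdom c \<Longrightarrow> linear (tvec A c p)"
  using linear_dd[OF transition_differentiable[OF _ chart_at(1) _ chart_at(2)]]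
  by (simp add: tvec_def[abs_def])

lemma linear_mderiv:
  "c \<in> A \<Longrightarrow> p \<in> cdom c \<Longrightarrow> (h \<circ> cinv c) differentiable (at (cmap c p)) \<Longrightarrow> linear (mderiv A h p)"
  using linear_compose[OF linear_tcoord linear_dd, of c p "h \<circ> cinv c" "cmap c p"]
  by (simp add: mderiv_chart o_def fun_eq_iff linear_iff)

text \<open>Transition maps are smooth, so on a set inside one chart the test in that chart decides
  for all charts.\<close>

lemma smooth_fun_on_chart:
  assumes "c \<in> A" "open W" "W \<subseteq> cdom c"
  shows "smooth_fun_on A W h \<longleftrightarrow> smooth_on (cmap c ` W) (h \<circ> cinv c)"
proof
  assume "smooth_fun_on A W h"
  then show "smooth_on (cmap c ` W) (h \<circ> cinv c)"
    using assms by (auto simp: smooth_fun_on_def Int_absorb2)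
next
  assume h: "smooth_on (cmap c ` W) (h \<circ> cinv c)"
  show "smooth_fun_on A W h"
    unfolding smooth_fun_on_def
  proof
    fix d assume d: "d \<in> A"
    let ?O = "cmap d ` (W \<inter> cdom d)"
    have O: "open ?O"
      using assms d by (intro open_cmap_image) (auto intro: open_cdom)
    have "smooth_on ?O (\<lambda>u. (h \<circ> cinv c) ((cmap c \<circ> cinv d) u))"
      by (rule smooth_on_compose[OF O open_cmap_image[OF assms] _ smooth_on_subset[OF transition_smooth[OF d assms(1)]] h])
        (use assms d in \<open>auto simp: cinv_cmap\<close>)
    then show "smooth_on ?O (h \<circ> cinv d)"
      by (rule smooth_on_cong[OF O, rotated]) (use assms d in \<open>auto simp: cinv_cmap subset_iff\<close>)
  qed
qed

lemma smooth_fun_on_mderiv_differentiable: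
  "smooth_fun_on A W h \<Longrightarrow> c \<in> A \<Longrightarrow> q \<in> W \<Longrightarrow> q \<in> cdom c \<Longrightarrow>
    (h \<circ> cinv c) differentiable (at (cmap c q))"
  unfolding smooth_fun_on_def by (blast intro: smooth_onD)

lemma smooth_map_id: "smooth_map A A (\<lambda>q. q)"
proof -
  have "smooth_on (cmap c ` (cdom d \<inter> cdom c)) (cmap d \<circ> cinv c)" if "c \<in> A" "d \<in> A" for c d
    using transition_smooth[OF that] by (simp add: Int_commute)
  then show ?thesis by (simp add: smooth_map_def smooth_fun_on_def o_def)
qed

end

lemma smooth_section_along_subset:
  "smooth_section_along A B f W s \<Longrightarrow> V \<subseteq> W \<Longrightarrow> smooth_section_along A B f V s"
  unfolding smooth_section_along_def smooth_fun_on_def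
  by (meson Int_mono image_mono order_refl smooth_on_subset)

section \<open>Sections along a smooth map\<close>

locale smooth_manifold_map = A: atlas A + B: atlas B
  for A :: "('m::{t2_space,second_countable_topology}, 'e::euclidean_space) chart set"
    and B :: "('n::{t2_space,second_countable_topology}, 'f::euclidean_space) chart set" +
  fixes f :: "'m \<Rightarrow> 'n"
  assumes smooth: "smooth_map A B f"
begin

lemma open_preimage: "d \<in> B \<Longrightarrow> open (f -` cdom d)"
  using smooth B.open_cdom by (auto simp: smooth_map_def continuous_on_open_vimage)

lemma smooth_coords:
  assumes "c \<in> A" "d \<in> B" "W \<subseteq> cdom c \<inter> f -` cdom d"
  shows "smooth_on (cmap c ` W) (\<lambda>u. cmap d (f (cinv c u)))"
proof -
  have "smooth_on (cmap c ` (f -` cdom d \<inter> cdom c)) (\<lambda>u. cmap d (f (cinv c u)))"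
    using smooth assms by (auto simp: smooth_map_def smooth_fun_on_def o_def)
  then show ?thesis
    by (rule smooth_on_subset) (use assms(3) in auto)
qed

text \<open>Between two charts of the target the components change by the Jacobian of the transition
  map evaluated along \<open>F\<close>, a smooth family of linear maps; one chart on each side
  therefore suffices.\<close>

lemma smooth_section_along_chart:
  assumes c: "c \<in> A" and d: "d \<in> B" and W: "open W" "W \<subseteq> cdom c \<inter> f -` cdom d"
  shows "smooth_section_along A B f W s \<longleftrightarrow>
    smooth_on (cmap c ` W) (\<lambda>u. tcoord B d (f (cinv c u)) (s (cinv c u)))"
proof
  assume "smooth_section_along A B f W s"
  then have "smooth_fun_on A (W \<inter> f -` cdom d) (\<lambda>q. tcoord B d (f q) (s q))"
    using d by (auto simp: smooth_section_along_def)
  then show "smooth_on (cmap c ` W) (\<lambda>u. tcoord B d (f (cinv c u)) (s (cinv c u)))"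
    using c W by (auto simp: smooth_fun_on_def o_def Int_absorb2)
next
  let ?s = "\<lambda>u. tcoord B d (f (cinv c u)) (s (cinv c u))"
  let ?F = "\<lambda>u. cmap d (f (cinv c u))"
  assume s: "smooth_on (cmap c ` W) ?s"
  show "smooth_section_along A B f W s"
    unfolding smooth_section_along_def
  proof
    fix d' assume d': "d' \<in> B"
    let ?W = "W \<inter> f -` cdom d'"
    let ?T = "cmap d' \<circ> cinv d"
    let ?V = "cmap d ` (cdom d \<inter> cdom d')"
    have W': "open ?W" "?W \<subseteq> cdom c"
      using W open_preimage[OF d'] by auto
    have O: "open (cmap c ` ?W)"
      by (rule A.open_cmap_image[OF c W'])
    have "smooth_on (cmap c ` ?W) (\<lambda>u. dd ?T (?F u) (?s u))"
    proof (rule smooth_on_linear_family[OF O, where L = "\<lambda>u. dd ?T (?F u)"])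
      show "linear (dd ?T (?F u))" if "u \<in> cmap c ` ?W" for u
        using that W c by (intro linear_dd) (auto simp: A.cinv_cmap subset_iff
            intro!: B.transition_differentiable[OF d d'])
      have "?F ` cmap c ` ?W \<subseteq> ?V" "?W \<subseteq> cdom c \<inter> f -` cdom d"
        using W c by (auto simp: A.cinv_cmap subset_iff)
      then show "smooth_on (cmap c ` ?W) (\<lambda>u. dd ?T (?F u) w)" for w
        using smooth_on_compose[OF O B.open_transition[OF d d'] _ smooth_coords[OF c d]
            smooth_on_dd[OF B.transition_smooth[OF d d']]] by blast
      show "smooth_on (cmap c ` ?W) ?s"
        using s by (rule smooth_on_subset) auto
    qed
    then have "smooth_on (cmap c ` ?W) ((\<lambda>q. tcoord B d' (f q) (s q)) \<circ> cinv c)"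
    proof (rule smooth_on_cong[OF O, rotated])
      fix u assume "u \<in> cmap c ` ?W"
      then obtain q where "u = cmap c q" "q \<in> cdom c" "f q \<in> cdom d" "f q \<in> cdom d'"
        using W by auto
      then show "dd ?T (?F u) (?s u) = ((\<lambda>q. tcoord B d' (f q) (s q)) \<circ> cinv c) u"
        using B.tcoord_change[OF d d'] c by (simp add: A.cinv_cmap)
    qed
    then show "smooth_fun_on A ?W (\<lambda>q. tcoord B d' (f q) (s q))"
      by (rule A.smooth_fun_on_chart[OF c W', THEN iffD2])
  qed
qed

lemma tcoord_tmap:
  assumes "c \<in> A" "d \<in> B" "q \<in> cdom c" "f q \<in> cdom d"
  shows "tcoord B d (f q) (tmap A B f q v)
    = dd (\<lambda>u. cmap d (f (cinv c u))) (cmap c q) (tcoord A c q v)"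
proof -
  let ?e = "chart_at B (f q)"
  note e = B.chart_at[of "f q"]
  let ?F = "\<lambda>u. cmap ?e (f (cinv c u))"
  let ?W = "cdom c \<inter> f -` cdom ?e \<inter> f -` cdom d"
  have F: "?F differentiable (at (cmap c q))"
    using smooth_onD[OF smooth_coords[OF assms(1) e(1) order_refl]] assms e by auto
  have O: "open (cmap c ` ?W)" "cmap c q \<in> cmap c ` ?W"
    using assms e by (auto intro!: A.open_cmap_image open_Int A.open_cdom open_preimage)
  have "tcoord B d (f q) (tmap A B f q v)
      = dd (cmap d \<circ> cinv ?e) (?F (cmap c q)) (dd ?F (cmap c q) (tcoord A c q v))"
    using A.mderiv_chart[OF assms(1,3), of "cmap ?e \<circ> f" v] F assms
    by (simp add: tmap_def tcoord_def[of B] mderiv_def[of B] o_def A.cinv_cmap)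
  also have "\<dots> = dd (\<lambda>u. (cmap d \<circ> cinv ?e) (?F u)) (cmap c q) (tcoord A c q v)"
    using B.transition_differentiable[OF e(1) assms(2) e(2) assms(4)] assms
    by (intro dd_compose[OF F, symmetric]) (simp add: A.cinv_cmap)
  also have "\<dots> = dd (\<lambda>u. cmap d (f (cinv c u))) (cmap c q) (tcoord A c q v)"
    using assms e by (intro dd_cong_open[OF O]) (auto simp: A.cinv_cmap B.cinv_cmap)
  finally show ?thesis .
qed

end

section \<open>Vector fields in a chart\<close>

context atlas
begin

lemma id_map: "smooth_manifold_map A A (\<lambda>q. q)"
  by unfold_locales (rule smooth_map_id)

abbreviation coords :: "('m, 'e) chart \<Rightarrow> ('m \<Rightarrow> 'e) \<Rightarrow> 'e \<Rightarrow> 'e" where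
  "coords c X u \<equiv> tcoord A c (cinv c u) (X (cinv c u))"

lemma smooth_vf_on_chart:
  "c \<in> A \<Longrightarrow> open W \<Longrightarrow> W \<subseteq> cdom c \<Longrightarrow>
    smooth_vf_on A W X \<longleftrightarrow> smooth_on (cmap c ` W) (coords c X)"
  using smooth_manifold_map.smooth_section_along_chart[OF id_map] by (simp add: smooth_vf_on_def)

lemma smooth_vf_on_subset: "smooth_vf_on A W X \<Longrightarrow> V \<subseteq> W \<Longrightarrow> smooth_vf_on A V X"
  unfolding smooth_vf_on_def by (rule smooth_section_along_subset)

lemma smooth_vf_on_tvec:
  assumes "c \<in> A"
  shows "smooth_vf_on A (cdom c) (\<lambda>q. tvec A c q w)"
proof -
  have "smooth_on (cmap c ` cdom c) (coords c (\<lambda>q. tvec A c q w))"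
    by (rule smooth_on_cong[OF open_cmap_image[OF assms open_cdom[OF assms] order_refl] _ smooth_on_const[of _ w]])
      (use assms in \<open>auto simp: cinv_cmap tvec_change\<close>)
  then show ?thesis
    using smooth_vf_on_chart[OF assms open_cdom[OF assms]] by simp
qed

lemma tangent_ext_self: "tangent_ext A p v p = v"
  using tvec_change(2)[OF chart_at, of p v] tcoord_self[of p v] by (simp add: tangent_ext_def)

text \<open>Read in \<open>chart_at A q\<close>, a coordinate field of \<open>c\<close> is a
  directional derivative of the transition map. The bracket is thus a difference of mixed second
  derivatives.\<close>

lemma lie_bracket_tvec:
  assumes c: "c \<in> A" and q: "q \<in> cdom c"
  shows "lie_bracket A (\<lambda>q. tvec A c q v) (\<lambda>q. tvec A c q w) q = 0"
proof -
  let ?e = "chart_at A q"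
  let ?T = "cmap ?e \<circ> cinv c"
  let ?O = "cmap c ` (cdom c \<inter> cdom ?e)"
  note e = chart_at[of q]
  have O: "open ?O" "cmap c q \<in> ?O"
    using open_transition[OF c e(1)] e(2) q by auto
  have T: "smooth_on ?O ?T"
    by (rule transition_smooth[OF c e(1)])
  have "mderiv A (\<lambda>q'. tcoord A ?e q' (tvec A c q' w)) q (tvec A c q v)
      = dd (\<lambda>u. dd ?T u w) (cmap c q) v" for v w
  proof -
    let ?h = "(\<lambda>q'. tcoord A ?e q' (tvec A c q' w)) \<circ> cinv c"
    have h: "dd ?T u w = ?h u" if "u \<in> ?O" for u
      using that tcoord_change[OF c e(1)] tvec_change(1)[OF c] c by (auto simp: cinv_cmap)
    have "smooth_on ?O ?h"
      by (rule smooth_on_cong[OF O(1) h smooth_on_dd[OF T]])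
    from mderiv_chart[OF c q smooth_onD[OF this O(2)]]
    have "mderiv A (\<lambda>q'. tcoord A ?e q' (tvec A c q' w)) q (tvec A c q v) = dd ?h (cmap c q) v"
      using tvec_change(1)[OF c q] by simp
    also have "\<dots> = dd (\<lambda>u. dd ?T u w) (cmap c q) v"
      by (rule dd_cong_open[OF O h[symmetric]])
    finally show ?thesis .
  qed
  then show ?thesis
    unfolding lie_bracket_def using mixed_dd[OF O(1) T O(2)] by simp
qed

end

section \<open>Affine connections in coordinates\<close>

context atlas
begin

lemma smooth_vf_on_chart_intros:
  assumes c: "c \<in> A" "open W" "W \<subseteq> cdom c"
  shows smooth_vf_on_add: "smooth_vf_on A W X \<Longrightarrow> smooth_vf_on A W Y \<Longrightarrow> smooth_vf_on A W (\<lambda>q. X q + Y q)"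
    and smooth_vf_on_diff: "smooth_vf_on A W X \<Longrightarrow> smooth_vf_on A W Y \<Longrightarrow> smooth_vf_on A W (\<lambda>q. X q - Y q)"
    and smooth_vf_on_scaleR: "smooth_fun_on A W h \<Longrightarrow> smooth_vf_on A W X \<Longrightarrow> smooth_vf_on A W (\<lambda>q. h q *\<^sub>R X q)"
    and smooth_vf_on_cong: "(\<And>q. q \<in> W \<Longrightarrow> X q = Y q) \<Longrightarrow> smooth_vf_on A W X \<Longrightarrow> smooth_vf_on A W Y"
    and smooth_vf_on_zero: "smooth_vf_on A W (\<lambda>q. 0)"
proof -
  note O = open_cmap_image[OF c]
  note ch = smooth_vf_on_chart[OF c]
  have lin: "linear (tcoord A c (cinv c u))" if "u \<in> cmap c ` W" for u
    using that c by (auto simp: cinv_cmap subset_iff intro!: linear_tcoord)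
  show "smooth_vf_on A W (\<lambda>q. X q + Y q)" if "smooth_vf_on A W X" "smooth_vf_on A W Y"
    unfolding ch
    by (rule smooth_on_cong[OF O _ smooth_on_add[OF O that[unfolded ch]]]) (auto simp: linear_add[OF lin])
  show "smooth_vf_on A W (\<lambda>q. X q - Y q)" if "smooth_vf_on A W X" "smooth_vf_on A W Y"
    unfolding ch
    by (rule smooth_on_cong[OF O _ smooth_on_diff[OF O that[unfolded ch]]]) (auto simp: linear_diff[OF lin])
  show "smooth_vf_on A W (\<lambda>q. h q *\<^sub>R X q)" if "smooth_fun_on A W h" "smooth_vf_on A W X"
    unfolding ch
    by (rule smooth_on_cong[OF O _ smooth_on_scaleR[OF O that[unfolded ch smooth_fun_on_chart[OF c]]]])
      (auto simp: linear_scale[OF lin])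
  show "smooth_vf_on A W Y" if "\<And>q. q \<in> W \<Longrightarrow> X q = Y q" "smooth_vf_on A W X"
    using that(2) unfolding ch
    by (rule smooth_on_cong[OF O, rotated]) (use that(1) c in \<open>auto simp: cinv_cmap subset_iff\<close>)
  show "smooth_vf_on A W (\<lambda>q. 0)"
    unfolding ch by (rule smooth_on_cong[OF O _ smooth_on_const[of _ 0]]) (simp add: linear_0[OF lin])
qed

lemma smooth_vf_on_sum:
  assumes c: "c \<in> A" "open W" "W \<subseteq> cdom c" and "finite I" "\<And>i. i \<in> I \<Longrightarrow> smooth_vf_on A W (X i)"
  shows "smooth_vf_on A W (\<lambda>q. \<Sum>i\<in>I. X i q)"
  using assms(4,5)
  by (induction I rule: finite_induct)
    (auto intro: smooth_vf_on_add[OF c] smooth_vf_on_zero[OF c])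

lemma mderiv_cong:
  assumes "open W" "p \<in> W" "\<And>q. q \<in> W \<Longrightarrow> h q = k q"
  shows "mderiv A h p v = mderiv A k p v"
  unfolding mderiv_def
proof (rule dd_cong_open)
  let ?e = "chart_at A p"
  show "open (cmap ?e ` (W \<inter> cdom ?e))"
    using assms(1) chart_at by (auto intro: open_cmap_image open_cdom)
qed (use assms chart_at in \<open>auto simp: cinv_cmap[OF chart_at(1)]\<close>)

lemma mderiv_const [simp]: "mderiv A (\<lambda>q. c) p v = 0"
  by (simp add: mderiv_def o_def)

lemma smooth_fun_on_locally_const:
  assumes "open W" "\<And>q. q \<in> W \<Longrightarrow> h q = c"
  shows "smooth_fun_on A W h"
  unfolding smooth_fun_on_def
proof
  fix d assume d: "d \<in> A"
  show "smooth_on (cmap d ` (W \<inter> cdom d)) (h \<circ> cinv d)"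
    by (rule smooth_on_cong[OF _ _ smooth_on_const[of _ c]])
      (use assms d in \<open>auto simp: cinv_cmap intro!: open_cmap_image open_cdom\<close>)
qed

end

section \<open>Locality of a connection and its Christoffel symbols\<close>

locale affine_manifold = atlas A
  for A :: "('m::{t2_space,second_countable_topology}, 'e::euclidean_space) chart set" +
  fixes nabla :: "('m \<Rightarrow> 'e) \<Rightarrow> ('m \<Rightarrow> 'e) \<Rightarrow> 'm \<Rightarrow> 'e"
  assumes affine_connection: "affine_connection A nabla"
begin

context
  fixes W :: "'m set"
  assumes W: "open W"
begin

lemma nabla_smooth:
  "smooth_vf_on A W X \<Longrightarrow> smooth_vf_on A W Y \<Longrightarrow> smooth_vf_on A W (nabla X Y)"
  using affine_connection W by (simp add: affine_connection_def)

lemma nabla_add_left: "smooth_vf_on A W X \<Longrightarrow> smooth_vf_on A W Y \<Longrightarrow> smooth_vf_on A W Z \<Longrightarrow> p \<in> W \<Longrightarrow>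
    nabla (\<lambda>q. X q + Y q) Z p = nabla X Z p + nabla Y Z p"
  using affine_connection W by (auto simp: affine_connection_def)

lemma nabla_add_right: "smooth_vf_on A W X \<Longrightarrow> smooth_vf_on A W Y \<Longrightarrow> smooth_vf_on A W Z \<Longrightarrow> p \<in> W \<Longrightarrow>
    nabla X (\<lambda>q. Y q + Z q) p = nabla X Y p + nabla X Z p"
  using affine_connection W by (auto simp: affine_connection_def)

lemma nabla_scaleR_left: "smooth_fun_on A W h \<Longrightarrow> smooth_vf_on A W X \<Longrightarrow> smooth_vf_on A W Y \<Longrightarrow> p \<in> W \<Longrightarrow>
    nabla (\<lambda>q. h q *\<^sub>R X q) Y p = h p *\<^sub>R nabla X Y p"
  using affine_connection W unfolding affine_connection_def by blast

lemma nabla_scaleR_right: "smooth_fun_on A W h \<Longrightarrow> smooth_vf_on A W X \<Longrightarrow> smooth_vf_on A W Y \<Longrightarrow> p \<in> W \<Longrightarrow>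
    nabla X (\<lambda>q. h q *\<^sub>R Y q) p = mderiv A h p (X p) *\<^sub>R Y p + h p *\<^sub>R nabla X Y p"
  using affine_connection W unfolding affine_connection_def by blast

text \<open>The multiplier is 0 on \<open>W\<close> and 1 off it, so the product with
  \<open>X\<close> is \<open>X\<close> as a total function although the multiplier vanishes at
  \<open>p\<close>. It is smooth on \<open>W\<close> because only its constant value there
  counts.\<close>

lemma nabla_zero_left:
  assumes "\<And>q. q \<in> W \<Longrightarrow> X q = 0" "smooth_vf_on A W X" "smooth_vf_on A W Y" "p \<in> W"
  shows "nabla X Y p = 0"
proof -
  let ?h = "\<lambda>q. if q \<in> W then 0 else 1 :: real"
  have "(\<lambda>q. ?h q *\<^sub>R X q) = X"
    using assms(1) by auto
  moreover have "smooth_fun_on A W ?h"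
    by (rule smooth_fun_on_locally_const[OF W]) auto
  ultimately show ?thesis
    using nabla_scaleR_left[of ?h X Y p] assms by simp
qed

text \<open>Multiplication by the indicator of \<open>W\<close> makes fields that agree on \<open>W\<close> equal, whatever their
  values elsewhere.\<close>

lemma nabla_cong:
  assumes "\<And>q. q \<in> W \<Longrightarrow> X q = X' q" "\<And>q. q \<in> W \<Longrightarrow> Y q = Y' q" "p \<in> W"
    "smooth_vf_on A W X" "smooth_vf_on A W X'" "smooth_vf_on A W Y" "smooth_vf_on A W Y'"
  shows "nabla X Y p = nabla X' Y' p"
proof -
  let ?h = "\<lambda>q. if q \<in> W then 1 else 0 :: real"
  have h: "smooth_fun_on A W ?h"
    by (rule smooth_fun_on_locally_const[OF W]) auto
  have h0: "mderiv A ?h p v = 0" for v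
    using mderiv_cong[OF W assms(3), of ?h "\<lambda>_. 1"] by simp
  have "nabla X Y p = nabla (\<lambda>q. ?h q *\<^sub>R X q) Y p"
    using nabla_scaleR_left[OF h assms(4,6,3)] assms(3) by simp
  also have "(\<lambda>q. ?h q *\<^sub>R X q) = (\<lambda>q. ?h q *\<^sub>R X' q)"
    using assms(1) by auto
  also have "nabla (\<lambda>q. ?h q *\<^sub>R X' q) Y p = nabla X' Y p"
    using nabla_scaleR_left[OF h assms(5,6,3)] assms(3) by simp
  also have "\<dots> = nabla X' (\<lambda>q. ?h q *\<^sub>R Y q) p"
    using nabla_scaleR_right[OF h assms(5,6,3)] assms(3) h0 by simp
  also have "(\<lambda>q. ?h q *\<^sub>R Y q) = (\<lambda>q. ?h q *\<^sub>R Y' q)"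
    using assms(2) by auto
  also have "nabla X' (\<lambda>q. ?h q *\<^sub>R Y' q) p = nabla X' Y' p"
    using nabla_scaleR_right[OF h assms(5,7,3)] assms(3) h0 by simp
  finally show ?thesis .
qed

lemma nabla_zero_right:
  assumes "smooth_vf_on A W X" "smooth_vf_on A W (\<lambda>q. 0)" "p \<in> W"
  shows "nabla X (\<lambda>q. 0) p = 0"
  using nabla_add_right[OF assms(1,2,2,3)] by simp

end

lemma nabla_sum_right:
  assumes c: "c \<in> A" "open W" "W \<subseteq> cdom c" and "finite I"
    and X: "smooth_vf_on A W X" and Y: "\<And>i. i \<in> I \<Longrightarrow> smooth_vf_on A W (Y i)" and p: "p \<in> W"
  shows "nabla X (\<lambda>q. \<Sum>i\<in>I. Y i q) p = (\<Sum>i\<in>I. nabla X (Y i) p)"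
  using assms(4) Y
proof (induction I rule: finite_induct)
  case empty
  then show ?case using nabla_zero_right[OF c(2) X smooth_vf_on_zero[OF c] p] by simp
next
  case (insert i I)
  then show ?case
    using nabla_add_right[OF c(2) X, of "Y i" "\<lambda>q. \<Sum>i\<in>I. Y i q"] smooth_vf_on_sum[OF c insert.hyps(1), of Y] p
    by simp
qed

lemma nabla_zero_left':
  assumes c: "c \<in> A" "open W" "W \<subseteq> cdom c" and Y: "smooth_vf_on A W Y" and p: "p \<in> W"
  shows "nabla (\<lambda>q. 0) Y p = 0"
  by (rule nabla_zero_left[OF c(2) _ smooth_vf_on_zero[OF c] Y p]) simp

lemma nabla_sum_left:
  assumes c: "c \<in> A" "open W" "W \<subseteq> cdom c" and "finite I"
    and X: "\<And>i. i \<in> I \<Longrightarrow> smooth_vf_on A W (X i)" and Y: "smooth_vf_on A W Y" and p: "p \<in> W"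
  shows "nabla (\<lambda>q. \<Sum>i\<in>I. X i q) Y p = (\<Sum>i\<in>I. nabla (X i) Y p)"
  using assms(4) X
proof (induction I rule: finite_induct)
  case empty
  then show ?case using nabla_zero_left'[OF c Y p] by simp
next
  case (insert i I)
  then show ?case
    using nabla_add_left[OF c(2) _ _ Y p, of "X i" "\<lambda>q. \<Sum>i\<in>I. X i q"] smooth_vf_on_sum[OF c insert.hyps(1), of X]
    by simp
qed

lemma frame_expansion:
  assumes c: "c \<in> A" "open W" "W \<subseteq> cdom c" and X: "smooth_vf_on A W X"
  shows "q \<in> W \<Longrightarrow> X q = (\<Sum>b\<in>Basis. (coords c X (cmap c q) \<bullet> b) *\<^sub>R tvec A c q b)"
    and "smooth_fun_on A W (\<lambda>q. coords c X (cmap c q) \<bullet> b)"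
    and "smooth_vf_on A W (\<lambda>q. tvec A c q b)"
    and "q \<in> W \<Longrightarrow> mderiv A (\<lambda>q. coords c X (cmap c q) \<bullet> b) q v
      = dd (coords c X) (cmap c q) (tcoord A c q v) \<bullet> b"
proof -
  note O = open_cmap_image[OF c]
  have smX: "smooth_on (cmap c ` W) (coords c X)"
    using X unfolding smooth_vf_on_chart[OF c] .
  show "X q = (\<Sum>b\<in>Basis. (coords c X (cmap c q) \<bullet> b) *\<^sub>R tvec A c q b)" if "q \<in> W"
  proof -
    have q: "q \<in> cdom c" using that c by auto
    then show ?thesis
      using linear_expand[OF linear_tvec[OF c(1) q], of "tcoord A c q (X q)"] tvec_change(2)[OF c(1) q]
        cinv_cmap[OF c(1)] by simp
  qed
  have eq: "coords c X u \<bullet> b = ((\<lambda>q. coords c X (cmap c q) \<bullet> b) \<circ> cinv c) u" if "u \<in> cmap c ` W" for u b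
    using that c by (auto simp: cinv_cmap subset_iff)
  show sm: "smooth_fun_on A W (\<lambda>q. coords c X (cmap c q) \<bullet> b)" for b
    unfolding smooth_fun_on_chart[OF c]
    by (rule smooth_on_cong[OF O eq smooth_on_inner[OF O smX smooth_on_const]])
  show "smooth_vf_on A W (\<lambda>q. tvec A c q b)"
    by (rule smooth_vf_on_subset[OF smooth_vf_on_tvec[OF c(1)] c(3)])
  assume q: "q \<in> W"
  have "mderiv A (\<lambda>q. coords c X (cmap c q) \<bullet> b) q v
      = dd ((\<lambda>q. coords c X (cmap c q) \<bullet> b) \<circ> cinv c) (cmap c q) (tcoord A c q v)"
    using q c smooth_fun_on_mderiv_differentiable[OF sm c(1)] by (intro mderiv_chart) auto
  also have "\<dots> = dd (\<lambda>u. coords c X u \<bullet> b) (cmap c q) (tcoord A c q v)"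
    using q by (intro dd_cong_open[OF O _ eq[symmetric]]) auto
  also have "\<dots> = dd (coords c X) (cmap c q) (tcoord A c q v) \<bullet> b"
    using q by (intro dd_bounded_linear[OF bounded_linear_inner_left] smooth_onD[OF smX]) auto
  finally show "mderiv A (\<lambda>q. coords c X (cmap c q) \<bullet> b) q v
      = dd (coords c X) (cmap c q) (tcoord A c q v) \<bullet> b" .
qed

text \<open>Expansion in \<open>Basis\<close> makes this bilinear in \<open>v\<close> and
  \<open>w\<close> at every \<open>u\<close>, even off the image of the chart, where nothing is
  known about \<open>nabla\<close>. On the image it is the covariant derivative of coordinate
  fields, by \<open>nabla_tvec_coords\<close>.\<close>

definition christoffel :: "('m, 'e) chart \<Rightarrow> 'e \<Rightarrow> 'e \<Rightarrow> 'e \<Rightarrow> 'e" where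
  "christoffel c u v w = (\<Sum>b\<in>Basis. (w \<bullet> b) *\<^sub>R (\<Sum>a\<in>Basis. (v \<bullet> a) *\<^sub>R
     coords c (nabla (\<lambda>q. tvec A c q a) (\<lambda>q. tvec A c q b)) u))"

lemma bilinear_christoffel: "bilinear (christoffel c u)"
  unfolding bilinear_def christoffel_def linear_iff
  by (simp add: inner_add_left scaleR_add_left scaleR_add_right sum.distrib scaleR_sum_right distrib_left mult_ac)

lemma smooth_christoffel:
  assumes "c \<in> A"
  shows "smooth_on (cmap c ` cdom c) (\<lambda>u. christoffel c u v w)"
proof -
  note c = assms open_cdom[OF assms] order_refl
  note O = open_cmap_image[OF c]
  show ?thesis
    unfolding christoffel_def
    using nabla_smooth[OF c(2) smooth_vf_on_tvec[OF c(1)] smooth_vf_on_tvec[OF c(1)]]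
    unfolding smooth_vf_on_chart[OF c]
    by (intro smooth_on_sum smooth_on_scaleR O smooth_on_const) auto
qed

lemma nabla_coords:
  assumes c: "c \<in> A" "open W" "W \<subseteq> cdom c" and X: "smooth_vf_on A W X" and Y: "smooth_vf_on A W Y"
    and p: "p \<in> W"
  shows "tcoord A c p (nabla X Y p) = dd (coords c Y) (cmap c p) (tcoord A c p (X p))
    + christoffel c (cmap c p) (tcoord A c p (X p)) (tcoord A c p (Y p))"
proof -
  let ?E = "\<lambda>b q. tvec A c q b"
  let ?h = "\<lambda>X b q. coords c X (cmap c q) \<bullet> b"
  note fX = frame_expansion[OF c X] and fY = frame_expansion[OF c Y]
  have pc: "p \<in> cdom c" and ci [simp]: "cinv c (cmap c p) = p"
    using p c by (auto simp: cinv_cmap)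
  note lin = linear_tcoord[OF c(1) pc]
  have sm: "smooth_vf_on A W (\<lambda>q. ?h X b q *\<^sub>R ?E b q)" "smooth_vf_on A W (\<lambda>q. ?h Y b q *\<^sub>R ?E b q)" for b
    using smooth_vf_on_scaleR[OF c fX(2,3)] smooth_vf_on_scaleR[OF c fY(2,3)] by auto
  have "nabla X (?E b) p = nabla (\<lambda>q. \<Sum>a\<in>Basis. ?h X a q *\<^sub>R ?E a q) (?E b) p" for b
    by (rule nabla_cong[OF c(2) fX(1) refl p X smooth_vf_on_sum[OF c _ sm(1)] fX(3,3)]) auto
  also have "\<dots> b = (\<Sum>a\<in>Basis. nabla (\<lambda>q. ?h X a q *\<^sub>R ?E a q) (?E b) p)" for b
    by (rule nabla_sum_left[OF c _ sm(1) fX(3) p]) auto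
  also have "\<dots> b = (\<Sum>a\<in>Basis. ?h X a p *\<^sub>R nabla (?E a) (?E b) p)" for b
    by (intro sum.cong refl nabla_scaleR_left[OF c(2) fX(2,3,3) p])
  finally have XE: "nabla X (?E b) p = (\<Sum>a\<in>Basis. ?h X a p *\<^sub>R nabla (?E a) (?E b) p)" for b .
  have "nabla X Y p = nabla X (\<lambda>q. \<Sum>b\<in>Basis. ?h Y b q *\<^sub>R ?E b q) p"
    by (rule nabla_cong[OF c(2) refl fY(1) p X X Y smooth_vf_on_sum[OF c _ sm(2)]]) auto
  also have "\<dots> = (\<Sum>b\<in>Basis. nabla X (\<lambda>q. ?h Y b q *\<^sub>R ?E b q) p)"
    by (rule nabla_sum_right[OF c _ X sm(2) p]) auto
  also have "\<dots> = (\<Sum>b\<in>Basis. mderiv A (?h Y b) p (X p) *\<^sub>R ?E b p + ?h Y b p *\<^sub>R nabla X (?E b) p)"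
    by (intro sum.cong refl nabla_scaleR_right[OF c(2) fY(2) X fY(3) p])
  finally have "tcoord A c p (nabla X Y p)
      = (\<Sum>b\<in>Basis. mderiv A (?h Y b) p (X p) *\<^sub>R b + ?h Y b p *\<^sub>R tcoord A c p (nabla X (?E b) p))"
    using tvec_change(1)[OF c(1) pc] by (simp add: linear_sum[OF lin] linear_add[OF lin] linear_scale[OF lin])
  also have "\<dots> = dd (coords c Y) (cmap c p) (tcoord A c p (X p))
      + (\<Sum>b\<in>Basis. ?h Y b p *\<^sub>R tcoord A c p (nabla X (?E b) p))"
    using fY(4)[OF p] by (simp add: sum.distrib euclidean_representation)
  also have "(\<Sum>b\<in>Basis. ?h Y b p *\<^sub>R tcoord A c p (nabla X (?E b) p))
      = christoffel c (cmap c p) (tcoord A c p (X p)) (tcoord A c p (Y p))"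
    unfolding XE christoffel_def by (simp add: linear_sum[OF lin] linear_scale[OF lin])
  finally show ?thesis .
qed

lemma nabla_tvec_coords:
  assumes "c \<in> A" "p \<in> cdom c"
  shows "tcoord A c p (nabla (\<lambda>q. tvec A c q v) (\<lambda>q. tvec A c q w) p) = christoffel c (cmap c p) v w"
proof -
  note c = assms(1) open_cdom[OF assms(1)] order_refl
  have "dd (coords c (\<lambda>q. tvec A c q w)) (cmap c p) v = dd (\<lambda>_. w) (cmap c p) v"
    by (rule dd_cong_open[OF open_cmap_image[OF c]])
      (use assms in \<open>auto simp: cinv_cmap tvec_change\<close>)
  then show ?thesis
    using nabla_coords[OF c smooth_vf_on_tvec[OF assms(1)] smooth_vf_on_tvec[OF assms(1)] assms(2), of v w]
    by (simp add: tvec_change[OF assms])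
qed

text \<open>This is \<open>cov_deriv_along\<close> for the identity map. Applied to coordinate
  fields of a chart other than \<open>chart_at A p\<close> it yields the transformation law of
  Christoffel symbols.\<close>

lemma nabla_at:
  assumes W: "open W" "p \<in> W" and X: "smooth_vf_on A W X" and Y: "smooth_vf_on A W Y"
  shows "nabla X Y p = mderiv A (\<lambda>q. tcoord A (chart_at A p) q (Y q)) p (X p)
    + nabla (tangent_ext A p (X p)) (tangent_ext A p (Y p)) p"
proof -
  let ?e = "chart_at A p"
  let ?W = "W \<inter> cdom ?e"
  note e = chart_at[of p]
  have c: "?e \<in> A" "open ?W" "?W \<subseteq> cdom ?e"
    using e W open_cdom by auto
  have "dd (coords ?e Y) (cmap ?e p) (X p) = mderiv A (\<lambda>q. tcoord A ?e q (Y q)) p (X p)"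
    by (simp add: mderiv_def o_def)
  moreover have "christoffel ?e (cmap ?e p) (X p) (Y p)
      = nabla (tangent_ext A p (X p)) (tangent_ext A p (Y p)) p"
    using nabla_tvec_coords[OF e, of "X p" "Y p"] by (simp add: tangent_ext_def tcoord_self)
  ultimately show ?thesis
    using nabla_coords[OF c smooth_vf_on_subset[OF X] smooth_vf_on_subset[OF Y], of p] W e
    by (simp add: tcoord_self)
qed

end

locale map_to_affine_manifold = smooth_manifold_map A B f + B: affine_manifold B nabla
  for A :: "('m::{t2_space,second_countable_topology}, 'e::euclidean_space) chart set"
    and B :: "('n::{t2_space,second_countable_topology}, 'f::euclidean_space) chart set"
    and f nabla
begin

text \<open>\<open>cov_deriv_along\<close> is defined with the chart \<open>chart_at B (f q)\<close>, which varies with \<open>q\<close>;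
  its coordinate expression is the same in every chart.\<close>

lemma cov_deriv_along_coords:
  assumes c: "c \<in> A" and d: "d \<in> B" and W: "open W" "W \<subseteq> cdom c \<inter> f -` cdom d" and q: "q \<in> W"
    and s: "smooth_section_along A B f W s"
  defines "F \<equiv> \<lambda>u. cmap d (f (cinv c u))" and "\<sigma> \<equiv> \<lambda>u. tcoord B d (f (cinv c u)) (s (cinv c u))"
  shows "tcoord B d (f q) (cov_deriv_along A B nabla f s q v)
    = dd \<sigma> (cmap c q) (tcoord A c q v)
      + B.christoffel d (cmap d (f q)) (dd F (cmap c q) (tcoord A c q v)) (tcoord B d (f q) (s q))"
proof -
  define e where "e = chart_at B (f q)"
  define T where "T = cmap e \<circ> cinv d"
  define u0 where "u0 = cmap c q"
  define v0 where "v0 = tcoord A c q v"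
  define s0 where "s0 = tcoord B d (f q) (s q)"
  define w0 where "w0 = dd F u0 v0"
  let ?W = "W \<inter> f -` cdom e"
  let ?O = "cmap c ` ?W"
  let ?V = "cmap d ` (cdom d \<inter> cdom e)"
  have e: "e \<in> B" "f q \<in> cdom e"
    unfolding e_def by (rule B.chart_at)+
  have qc: "q \<in> cdom c" "f q \<in> cdom d"
    using q W by auto
  have W': "open ?W" "?W \<subseteq> cdom c \<inter> f -` cdom d"
    using W open_preimage[OF e(1)] by auto
  have O: "open ?O" "u0 \<in> ?O"
    using A.open_cmap_image[OF c W'(1)] W' q e(2) by (auto simp: u0_def)
  have V: "open ?V" "F ` ?O \<subseteq> ?V" "cmap d (f q) \<in> ?V" and F0: "F u0 = cmap d (f q)" and \<sigma>0: "\<sigma> u0 = s0"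
  proof -
    have "cinv c (cmap c q') = q' \<and> f q' \<in> cdom d \<inter> cdom e" if "q' \<in> ?W" for q'
      using that W' by (auto intro!: A.cinv_cmap c)
    then show "F ` ?O \<subseteq> ?V"
      unfolding F_def by fastforce
  qed (use B.open_transition[OF d e(1)] c e qc in \<open>auto simp: F_def \<sigma>_def s0_def u0_def A.cinv_cmap\<close>)
  have sm: "smooth_on ?O F" "smooth_on ?O \<sigma>" "smooth_on ?V T"
    using smooth_coords[OF c d W'(2)] smooth_section_along_chart[OF c d W']
      smooth_section_along_subset[OF s, of ?W] B.transition_smooth[OF d e(1)]
    by (auto simp: F_def \<sigma>_def T_def)
  have smT: "smooth_on ?V (\<lambda>y. dd T y w)" for w
    by (rule smooth_on_dd[OF sm(3)])
  have Fd: "F differentiable (at u0)"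
    by (rule smooth_onD[OF sm(1) O(2)])
  \<comment> \<open>The second derivative of the transition map, the inhomogeneous term in the
    transformation of Christoffel symbols. It arises from differentiating the components of
    \<open>s\<close> in the chart \<open>e\<close>, and again in \<open>nabla_at\<close> for the
    fields \<open>X\<close>, \<open>Y\<close> constant in \<open>d\<close>; together with the
    Christoffel term of \<open>e\<close> it therefore makes up \<open>nabla X Y\<close>.\<close>
  let ?D = "dd (\<lambda>y. dd T y s0) (F u0) w0"
  have TF: "tcoord B e (f q') z = dd T (F (cmap c q')) (tcoord B d (f q') z)" if "q' \<in> ?W" for q' z
    using that W' c B.tcoord_change[OF d e(1), of "f q'" z] by (auto simp: T_def F_def A.cinv_cmap subset_iff)
  have "mderiv A (\<lambda>q'. tcoord B e (f q') (s q')) q v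
      = dd (\<lambda>u. dd T (F u) (\<sigma> u)) u0 v0"
  proof -
    let ?h = "(\<lambda>q'. tcoord B e (f q') (s q')) \<circ> cinv c"
    have "smooth_on ?O ?h"
      using smooth_section_along_chart[OF c e(1) W'(1)] smooth_section_along_subset[OF s, of ?W] W'
      by (auto simp: o_def)
    from A.mderiv_chart[OF c qc(1) smooth_onD[OF this O(2)[unfolded u0_def]], of v]
    have "mderiv A (\<lambda>q'. tcoord B e (f q') (s q')) q v = dd ?h u0 v0"
      unfolding u0_def v0_def .
    also have "\<dots> = dd (\<lambda>u. dd T (F u) (\<sigma> u)) u0 v0"
      by (rule dd_cong_open[OF O]) (use TF c W' in \<open>auto simp: \<sigma>_def A.cinv_cmap\<close>)
    finally show ?thesis .
  qed
  also have "\<dots> = dd (\<lambda>u. dd T (F u) (\<sigma> u0)) u0 v0 + dd T (F u0) (dd \<sigma> u0 v0)"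
  proof (rule dd_linear_family[OF O(1) _ _ sm(2) O(2), where L = "\<lambda>u. dd T (F u)"])
    show "linear (dd T (F u))" if "u \<in> ?O" for u
      using V that by (intro linear_dd smooth_onD[OF sm(3)]) auto
    show "smooth_on ?O (\<lambda>u. dd T (F u) w)" for w
      by (rule smooth_on_compose[OF O(1) V(1,2) sm(1) smT])
  qed
  also have "dd (\<lambda>u. dd T (F u) (\<sigma> u0)) u0 v0 = ?D"
    unfolding \<sigma>0 w0_def
    by (rule dd_compose[OF Fd smooth_onD[OF smT]]) (use V F0 in simp)
  finally have der: "mderiv A (\<lambda>q'. tcoord B e (f q') (s q')) q v = ?D + dd T (F u0) (dd \<sigma> u0 v0)" .
  define X where "X = (\<lambda>r. tvec B d r w0)"
  define Y where "Y = (\<lambda>r. tvec B d r s0)"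
  have XY: "X (f q) = tmap A B f q v" "Y (f q) = s q"
    using tcoord_tmap[OF c d qc, of v] B.tvec_change(2)[OF d qc(2), of "tmap A B f q v"]
      B.tvec_change(2)[OF d qc(2), of "s q"]
    by (auto simp: X_def Y_def w0_def s0_def F_def u0_def v0_def)
  have "nabla X Y (f q) = mderiv B (\<lambda>r. tcoord B e r (Y r)) (f q) (X (f q))
      + nabla (tangent_ext B (f q) (X (f q))) (tangent_ext B (f q) (Y (f q))) (f q)"
    unfolding X_def Y_def e_def
    by (rule B.nabla_at[OF B.open_cdom[OF d] qc(2) B.smooth_vf_on_tvec[OF d] B.smooth_vf_on_tvec[OF d]])
  moreover have "mderiv B (\<lambda>r. tcoord B e r (Y r)) (f q) (X (f q)) = ?D"
  proof -
    let ?h = "(\<lambda>r. tcoord B e r (Y r)) \<circ> cinv d"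
    have h: "dd T y s0 = ?h y" if "y \<in> ?V" for y
      using that B.tcoord_change[OF d e(1)] B.tvec_change(1)[OF d] d by (auto simp: Y_def T_def B.cinv_cmap)
    have "smooth_on ?V ?h"
      by (rule smooth_on_cong[OF V(1) h smT])
    from B.mderiv_chart[OF d qc(2) smooth_onD[OF this V(3)]]
    have "mderiv B (\<lambda>r. tcoord B e r (Y r)) (f q) (X (f q)) = dd ?h (F u0) w0"
      using B.tvec_change(1)[OF d qc(2)] F0 by (simp add: X_def)
    also have "\<dots> = ?D"
      using V F0 by (intro dd_cong_open[OF V(1) _ h[symmetric]]) auto
    finally show ?thesis .
  qed
  ultimately have "cov_deriv_along A B nabla f s q v = dd T (F u0) (dd \<sigma> u0 v0) + nabla X Y (f q)"
    using der by (simp add: cov_deriv_along_def XY e_def)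
  also have "dd T (F u0) (dd \<sigma> u0 v0) = tvec B d (f q) (dd \<sigma> u0 v0)"
    unfolding F0 T_def e_def by (simp add: tvec_def)
  finally show ?thesis
    using B.nabla_tvec_coords[OF d qc(2), of w0 s0]
    by (simp add: linear_add[OF B.linear_tcoord[OF d qc(2)]] B.tvec_change(1)[OF d qc(2)] X_def Y_def
        u0_def v0_def w0_def s0_def)
qed

end

section \<open>Pulled-back connections in coordinates\<close>

locale coord_connection =
  fixes V :: "'f::euclidean_space set" and \<Gamma> :: "'f \<Rightarrow> 'f \<Rightarrow> 'f \<Rightarrow> 'f"
  assumes open_V: "open V"
    and bilinear_\<Gamma>: "bilinear (\<Gamma> y)"
    and smooth_\<Gamma>: "smooth_on V (\<lambda>y. \<Gamma> y v w)"
begin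

text \<open>The curvature on fields with constant components, for which the bracket term
  vanishes.\<close>

definition Rm :: "'f \<Rightarrow> 'f \<Rightarrow> 'f \<Rightarrow> 'f \<Rightarrow> 'f" where
  "Rm y v w s = dd (\<lambda>y. \<Gamma> y w s) y v - dd (\<lambda>y. \<Gamma> y v s) y w + \<Gamma> y v (\<Gamma> y w s) - \<Gamma> y w (\<Gamma> y v s)"

lemma linear_\<Gamma>: "linear (\<Gamma> y v)" "linear (\<lambda>v. \<Gamma> y v w)"
  using bilinear_\<Gamma> unfolding bilinear_def by auto

end

locale pullback_connection = coord_connection V \<Gamma>
  for V :: "'f::euclidean_space set" and \<Gamma> :: "'f \<Rightarrow> 'f \<Rightarrow> 'f \<Rightarrow> 'f" +
  fixes U :: "'e::euclidean_space set" and F :: "'e \<Rightarrow> 'f"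
  assumes open_U: "open U" and F_V: "F ` U \<subseteq> V" and smooth_F: "smooth_on U F"
begin

definition nb :: "('e \<Rightarrow> 'f) \<Rightarrow> 'e \<Rightarrow> 'e \<Rightarrow> 'f" where
  "nb s v u = dd s u v + \<Gamma> (F u) (dd F u v) (s u)"

lemma smooth_compose_F: "smooth_on V k \<Longrightarrow> smooth_on U (\<lambda>u. k (F u))"
  by (rule smooth_on_compose[OF open_U open_V F_V smooth_F])

lemma dd_compose_F: "smooth_on V k \<Longrightarrow> u \<in> U \<Longrightarrow> dd (\<lambda>u. k (F u)) u v = dd k (F u) (dd F u v)"
  using F_V by (intro dd_compose smooth_onD[OF smooth_F] smooth_onD[of V]) auto

lemma pullback_bilinear:
  fixes b :: "'f \<Rightarrow> 'f \<Rightarrow> 'f \<Rightarrow> 'c::real_normed_vector"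
  assumes b: "\<And>y. y \<in> V \<Longrightarrow> bilinear (b y)" "\<And>v w. smooth_on V (\<lambda>y. b y v w)"
    and s: "smooth_on U s" and r: "smooth_on U r"
  shows smooth_pullback_bilinear: "smooth_on U (\<lambda>u. b (F u) (s u) (r u))"
    and dd_pullback_bilinear: "u \<in> U \<Longrightarrow> dd (\<lambda>u. b (F u) (s u) (r u)) u v
      = dd (\<lambda>y. b y (s u) (r u)) (F u) (dd F u v) + b (F u) (dd s u v) (r u) + b (F u) (s u) (dd r u v)"
proof -
  have lin: "linear (b (F u) v)" "linear (\<lambda>v. b (F u) v w)" if "u \<in> U" for u v w
    using b(1) F_V that unfolding bilinear_def by auto
  have 1: "smooth_on U (\<lambda>u. b (F u) (s u) w)" for w
    by (rule smooth_on_linear_family[OF open_U _ _ s, where L = "\<lambda>u v. b (F u) v w"])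
      (auto intro: lin smooth_compose_F b)
  show "smooth_on U (\<lambda>u. b (F u) (s u) (r u))"
    by (rule smooth_on_linear_family[OF open_U _ 1 r]) (rule lin)
  assume u: "u \<in> U"
  have "dd (\<lambda>u. b (F u) (s u) (r u)) u v
      = dd (\<lambda>x. b (F x) (s x) (r u)) u v + b (F u) (s u) (dd r u v)"
    by (rule dd_linear_family[OF open_U _ 1 r u]) (rule lin)
  also have "dd (\<lambda>x. b (F x) (s x) (r u)) u v
      = dd (\<lambda>x. b (F x) (s u) (r u)) u v + b (F u) (dd s u v) (r u)"
    by (rule dd_linear_family[OF open_U _ _ s u, where L = "\<lambda>x v. b (F x) v (r u)"])
      (auto intro: lin smooth_compose_F b)
  also have "dd (\<lambda>x. b (F x) (s u) (r u)) u v = dd (\<lambda>y. b y (s u) (r u)) (F u) (dd F u v)"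
    by (rule dd_compose_F[OF b(2) u])
  finally show "dd (\<lambda>u. b (F u) (s u) (r u)) u v
      = dd (\<lambda>y. b y (s u) (r u)) (F u) (dd F u v) + b (F u) (dd s u v) (r u) + b (F u) (s u) (dd r u v)" .
qed

lemma smooth_nb: "smooth_on U s \<Longrightarrow> smooth_on U (nb s v)"
  unfolding nb_def[abs_def]
  by (rule smooth_on_add[OF open_U smooth_on_dd
        smooth_pullback_bilinear[OF bilinear_\<Gamma> smooth_\<Gamma> smooth_on_dd[OF smooth_F]]])

lemma nb_diff: "smooth_on U s \<Longrightarrow> smooth_on U r \<Longrightarrow> u \<in> U \<Longrightarrow>
    nb (\<lambda>u. s u - r u) v u = nb s v u - nb r v u"
  by (simp add: nb_def dd_diff smooth_onD linear_diff[OF linear_\<Gamma>(1)])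

lemma nb_scaleR: "smooth_on U h \<Longrightarrow> smooth_on U s \<Longrightarrow> u \<in> U \<Longrightarrow>
    nb (\<lambda>u. h u *\<^sub>R s u) v u = dd h u v *\<^sub>R s u + h u *\<^sub>R nb s v u"
  by (simp add: nb_def dd_scaleR smooth_onD linear_scale[OF linear_\<Gamma>(1)] scaleR_add_right)

lemma nb_cong: "(\<And>u. u \<in> U \<Longrightarrow> s u = r u) \<Longrightarrow> u \<in> U \<Longrightarrow> nb s v u = nb r v u"
  using dd_cong_open[OF open_U, of u s r v] by (simp add: nb_def)

lemma linear_nb: "smooth_on U s \<Longrightarrow> u \<in> U \<Longrightarrow> linear (\<lambda>v. nb s v u)"
  unfolding nb_def
  by (rule linear_compose_add[OF linear_dd[OF smooth_onD]
        linear_compose[OF linear_dd[OF smooth_onD[OF smooth_F]] linear_\<Gamma>(2), unfolded o_def]])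

text \<open>Because \<open>v\<close> and \<open>w\<close> are constant and second derivatives of
  \<open>s\<close> and \<open>F\<close> are symmetric, all that survives is the curvature evaluated
  on the images under \<open>dd F u\<close>: curvature commutes with pullback.\<close>

lemma nb_commutator:
  assumes s: "smooth_on U s" and u: "u \<in> U"
  shows "nb (nb s w) v u - nb (nb s v) w u = Rm (F u) (dd F u v) (dd F u w) (s u)"
proof -
  have "dd (nb s w) u v = dd (\<lambda>u. dd s u w) u v + dd (\<lambda>y. \<Gamma> y (dd F u w) (s u)) (F u) (dd F u v)
      + \<Gamma> (F u) (dd (\<lambda>u. dd F u w) u v) (s u) + \<Gamma> (F u) (dd F u w) (dd s u v)" for v w
  proof -
    have F: "smooth_on U (\<lambda>u. dd F u w)"
      by (rule smooth_on_dd[OF smooth_F])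
    have "smooth_on U (\<lambda>u. \<Gamma> (F u) (dd F u w) (s u))"
      by (rule smooth_pullback_bilinear[OF bilinear_\<Gamma> smooth_\<Gamma> F s])
    then show ?thesis
      unfolding nb_def[abs_def]
      using dd_add[OF smooth_onD[OF smooth_on_dd[OF s] u] smooth_onD[OF _ u]]
        dd_pullback_bilinear[OF bilinear_\<Gamma> smooth_\<Gamma> F s u] by simp
  qed
  then show ?thesis
    using mixed_dd[OF open_U s u, of v w] mixed_dd[OF open_U smooth_F u, of v w]
    by (simp add: nb_def Rm_def linear_add[OF linear_\<Gamma>(1)])
qed

context
  fixes G :: "'f \<Rightarrow> 'f \<Rightarrow> 'f \<Rightarrow> real"
  assumes G: "\<And>y. y \<in> V \<Longrightarrow> bilinear (G y)" "\<And>v w. smooth_on V (\<lambda>y. G y v w)"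
    and parallel: "\<And>y v s r. y \<in> V \<Longrightarrow> dd (\<lambda>y. G y s r) y v = G y (\<Gamma> y v s) r + G y s (\<Gamma> y v r)"
begin

lemma dd_parallel_form:
  assumes s: "smooth_on U s" and r: "smooth_on U r" and u: "u \<in> U"
  shows "dd (\<lambda>u. G (F u) (s u) (r u)) u v = G (F u) (nb s v u) (r u) + G (F u) (s u) (nb r v u)"
  using u F_V G(1)[of "F u"] dd_pullback_bilinear[OF G s r u, of v] parallel[of "F u" "s u" "r u" "dd F u v"]
  by (auto simp: nb_def bilinear_ladd bilinear_radd)

text \<open>For parallel \<open>G\<close>, the commutator of two derivatives of the function
  \<open>G (F u) (s u) (r u)\<close> is the sum of the two curvature terms, and the commutator of
  derivatives of a function is 0.\<close>

lemma Rm_skew: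
  assumes s: "smooth_on U s" and r: "smooth_on U r" and u: "u \<in> U"
  shows "G (F u) (Rm (F u) (dd F u v) (dd F u w) (s u)) (r u)
    = - G (F u) (s u) (Rm (F u) (dd F u v) (dd F u w) (r u))"
proof -
  let ?k = "\<lambda>u. G (F u) (s u) (r u)"
  have bil: "bilinear (G (F u))"
    using G(1) F_V u by auto
  have "dd (\<lambda>x. dd ?k x w) u v = G (F u) (nb (nb s w) v u) (r u) + G (F u) (nb s w u) (nb r v u)
      + (G (F u) (nb s v u) (nb r w u) + G (F u) (s u) (nb (nb r w) v u))" for v w
  proof -
    have sm: "smooth_on U (\<lambda>x. G (F x) (nb s w x) (r x))" "smooth_on U (\<lambda>x. G (F x) (s x) (nb r w x))"
      using smooth_pullback_bilinear[OF G] smooth_nb s r by auto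
    have "dd (\<lambda>x. dd ?k x w) u v
        = dd (\<lambda>x. G (F x) (nb s w x) (r x) + G (F x) (s x) (nb r w x)) u v"
      by (rule dd_cong_open[OF open_U u]) (rule dd_parallel_form[OF s r])
    also have "\<dots> = dd (\<lambda>x. G (F x) (nb s w x) (r x)) u v + dd (\<lambda>x. G (F x) (s x) (nb r w x)) u v"
      by (rule dd_add[OF sm[THEN smooth_onD, OF u]])
    also have "\<dots> = G (F u) (nb (nb s w) v u) (r u) + G (F u) (nb s w u) (nb r v u)
      + (G (F u) (nb s v u) (nb r w u) + G (F u) (s u) (nb (nb r w) v u))"
      by (simp only: dd_parallel_form[OF smooth_nb[OF s] r u] dd_parallel_form[OF s smooth_nb[OF r] u])
    finally show ?thesis .
  qed
  from this[of w v] this[of v w] have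
    "G (F u) (nb (nb s w) v u - nb (nb s v) w u) (r u) = - G (F u) (s u) (nb (nb r w) v u - nb (nb r v) w u)"
    using mixed_dd[OF open_U smooth_pullback_bilinear[OF G s r] u, of w v]
    by (simp add: bilinear_lsub[OF bil] bilinear_rsub[OF bil])
  then show ?thesis
    by (simp only: nb_commutator[OF s u] nb_commutator[OF r u])
qed

end

context
  fixes J :: "'f \<Rightarrow> 'f \<Rightarrow> 'f"
  assumes J: "\<And>y. y \<in> V \<Longrightarrow> linear (J y)" "\<And>v. smooth_on V (\<lambda>y. J y v)"
    and parallel: "\<And>y v s. y \<in> V \<Longrightarrow> dd (\<lambda>y. J y s) y v + \<Gamma> y v (J y s) = J y (\<Gamma> y v s)"
begin

lemma smooth_pullback_linear: "smooth_on U s \<Longrightarrow> smooth_on U (\<lambda>u. J (F u) (s u))"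
  by (rule smooth_on_linear_family[OF open_U _ smooth_compose_F[OF J(2)]]) (use J(1) F_V in auto)

lemma nb_parallel_endo:
  assumes s: "smooth_on U s" and u: "u \<in> U"
  shows "nb (\<lambda>u. J (F u) (s u)) v u = J (F u) (nb s v u)"
proof -
  have lin: "linear (J (F u))" if "u \<in> U" for u
    using J(1) F_V that by auto
  have "dd (\<lambda>u. J (F u) (s u)) u v = dd (\<lambda>x. J (F x) (s u)) u v + J (F u) (dd s u v)"
    by (rule dd_linear_family[OF open_U _ smooth_compose_F[OF J(2)] s u]) (rule lin)
  also have "dd (\<lambda>x. J (F x) (s u)) u v = dd (\<lambda>y. J y (s u)) (F u) (dd F u v)"
    by (rule dd_compose_F[OF J(2) u])
  finally show ?thesis
    using parallel[of "F u" "s u" "dd F u v"] u F_V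
    by (auto simp: nb_def linear_add[OF lin[OF u]] algebra_simps)
qed

lemma Rm_parallel_endo:
  assumes s: "smooth_on U s" and u: "u \<in> U"
  shows "Rm (F u) (dd F u v) (dd F u w) (J (F u) (s u)) = J (F u) (Rm (F u) (dd F u v) (dd F u w) (s u))"
proof -
  have lin: "linear (J (F u))"
    using J(1) F_V u by auto
  have "nb (nb (\<lambda>u. J (F u) (s u)) w) v u = J (F u) (nb (nb s w) v u)" for v w
  proof -
    have "nb (nb (\<lambda>u. J (F u) (s u)) w) v u = nb (\<lambda>x. J (F x) (nb s w x)) v u"
      by (rule nb_cong[OF _ u]) (rule nb_parallel_endo[OF s])
    then show ?thesis
      by (simp only: nb_parallel_endo[OF smooth_nb[OF s] u])
  qed
  then show ?thesis
    using nb_commutator[OF smooth_pullback_linear[OF s] u, of w v] nb_commutator[OF s u, of w v]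
    by (simp add: linear_diff[OF lin, symmetric])
qed

end

end

context coord_connection
begin

text \<open>With \<open>F\<close> the identity, the statements about pulled-back sections specialise
  to identities of the curvature at a point.\<close>

lemma pullback_ident: "pullback_connection V \<Gamma> V (\<lambda>y. y)"
  by unfold_locales (auto simp: open_V smooth_on_ident)

end

section \<open>Curvature identities of a Kaehler connection in coordinates\<close>

locale kaehler_norden_coords = coord_connection V \<Gamma>
  for V :: "'f::euclidean_space set" and \<Gamma> :: "'f \<Rightarrow> 'f \<Rightarrow> 'f \<Rightarrow> 'f" +
  fixes G :: "'f \<Rightarrow> 'f \<Rightarrow> 'f \<Rightarrow> real" and J :: "'f \<Rightarrow> 'f \<Rightarrow> 'f"
  assumes \<Gamma>_sym: "y \<in> V \<Longrightarrow> \<Gamma> y v w = \<Gamma> y w v"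
    and bilinear_G: "y \<in> V \<Longrightarrow> bilinear (G y)"
    and smooth_G: "smooth_on V (\<lambda>y. G y v w)"
    and parallel_G: "y \<in> V \<Longrightarrow> dd (\<lambda>y. G y s r) y v = G y (\<Gamma> y v s) r + G y s (\<Gamma> y v r)"
    and linear_J: "y \<in> V \<Longrightarrow> linear (J y)"
    and smooth_J: "smooth_on V (\<lambda>y. J y v)"
    and parallel_J: "y \<in> V \<Longrightarrow> dd (\<lambda>y. J y s) y v + \<Gamma> y v (J y s) = J y (\<Gamma> y v s)"
begin

lemma Rm_antisym: "Rm y v w s = - Rm y w v s"
  by (simp add: Rm_def)

lemma Rm_bianchi:
  assumes y: "y \<in> V"
  shows "Rm y v w s + Rm y w s v + Rm y s v w = 0"
proof -
  have "dd (\<lambda>y. \<Gamma> y v w) y s = dd (\<lambda>y. \<Gamma> y w v) y s" for v w s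
    by (rule dd_cong_open[OF open_V y \<Gamma>_sym])
  from this[of v w s] this[of v s w] this[of w s v] show ?thesis
    using \<Gamma>_sym[OF y, of v w] \<Gamma>_sym[OF y, of v s] \<Gamma>_sym[OF y, of w s]
    by (simp add: Rm_def)
qed

lemma Rm_G_skew: "y \<in> V \<Longrightarrow> G y (Rm y v w s) r = - G y s (Rm y v w r)"
  using pullback_connection.Rm_skew[OF pullback_ident bilinear_G smooth_G parallel_G
      smooth_on_const smooth_on_const, of y v w s r] by simp

lemma Rm_J: "y \<in> V \<Longrightarrow> Rm y v w (J y s) = J y (Rm y v w s)"
  using pullback_connection.Rm_parallel_endo[OF pullback_ident linear_J smooth_J parallel_J
      smooth_on_const, of y v w s] by simp

lemma linear_Rm: "y \<in> V \<Longrightarrow> linear (Rm y v w)" and linear_Rm1: "y \<in> V \<Longrightarrow> linear (\<lambda>v. Rm y v w s)"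
proof -
  assume y: "y \<in> V"
  note df = smooth_onD[OF smooth_\<Gamma> y]
  have 1: "linear (\<lambda>s. dd (\<lambda>y. \<Gamma> y v s) y w)" "linear (\<lambda>v. dd (\<lambda>y. \<Gamma> y v s) y w)" for v w s
    by (auto intro!: linearI simp: linear_add[OF linear_\<Gamma>(1)] linear_scale[OF linear_\<Gamma>(1)]
        linear_add[OF linear_\<Gamma>(2)] linear_scale[OF linear_\<Gamma>(2)] dd_add[OF df df]
        dd_bounded_linear[OF bounded_linear_scaleR_right df])
  have 2: "linear (\<lambda>s. \<Gamma> y v (\<Gamma> y w s))" "linear (\<lambda>v. \<Gamma> y v w)" "linear (\<lambda>v. \<Gamma> y w (\<Gamma> y v s))" for v w s
    using linear_compose[OF linear_\<Gamma>(1) linear_\<Gamma>(1)] linear_compose[OF linear_\<Gamma>(2) linear_\<Gamma>(1)] linear_\<Gamma>(2)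
    by (auto simp: o_def)
  show "linear (Rm y v w)" "linear (\<lambda>v. Rm y v w s)"
    unfolding Rm_def[abs_def]
    by (intro linear_compose_add linear_compose_sub 1 2 linear_dd df)+
qed

end

section \<open>Kaehler curvature tensors on a vector space with Norden metric\<close>

locale norden_space =
  fixes g :: "'f::euclidean_space \<Rightarrow> 'f \<Rightarrow> real" and J :: "'f \<Rightarrow> 'f"
  assumes bilinear_g: "bilinear g" and g_sym: "g x y = g y x"
    and g_nondeg: "(\<And>y. g x y = 0) \<Longrightarrow> x = 0"
    and linear_J: "linear J" and J_J: "J (J x) = - x"
    and J_anti: "g (J x) (J y) = - g x y"
begin

lemmas g_simps = bilinear_ladd[OF bilinear_g] bilinear_radd[OF bilinear_g]
  bilinear_lmul[OF bilinear_g] bilinear_rmul[OF bilinear_g]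
  bilinear_lneg[OF bilinear_g] bilinear_rneg[OF bilinear_g]
  bilinear_lsub[OF bilinear_g] bilinear_rsub[OF bilinear_g]
  bilinear_lzero[OF bilinear_g] bilinear_rzero[OF bilinear_g]

lemmas J_simps = linear_add[OF linear_J] linear_scale[OF linear_J] linear_neg[OF linear_J]
  linear_diff[OF linear_J] linear_0[OF linear_J] J_J

lemma J_swap: "g (J x) y = g x (J y)"
  using J_anti[of x "J y"] by (simp add: J_simps g_simps)

text \<open>With \<open>J\<close> as multiplication by \<open>\<i>\<close> the space is complex, and \<open>g\<close> is the real part of the complex
  bilinear form \<open>hc\<close>.\<close>

definition cs :: "complex \<Rightarrow> 'f \<Rightarrow> 'f" where
  "cs \<alpha> x = Re \<alpha> *\<^sub>R x + Im \<alpha> *\<^sub>R J x"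

definition clin :: "('f \<Rightarrow> complex) \<Rightarrow> bool" where
  "clin h \<longleftrightarrow> linear h \<and> (\<forall>x. h (J x) = \<i> * h x)"

lemma clin_cs: "clin h \<Longrightarrow> h (cs \<alpha> x) = \<alpha> * h x"
  by (simp add: clin_def cs_def linear_add linear_scale complex_eq_iff)

text \<open>The sign of the imaginary part makes \<open>hc x (J y)\<close> equal to i times
  \<open>hc x y\<close> rather than its conjugate multiple.\<close>

definition hc :: "'f \<Rightarrow> 'f \<Rightarrow> complex" where
  "hc x y = Complex (g x y) (- g x (J y))"

lemma hc_sym: "hc x y = hc y x"
  using J_swap[of x y] by (simp add: hc_def g_sym)

lemma clin_hc: "clin (hc x)" "clin (\<lambda>x. hc x y)"
proof -
  show "clin (hc x)" for x
    by (auto simp: clin_def hc_def complex_eq_iff g_simps J_simps intro!: linearI)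
  then show "clin (\<lambda>x. hc x y)"
    by (subst hc_sym) simp
qed

lemma linear_hc: "linear (hc x)" "linear (\<lambda>x. hc x y)"
  using clin_hc by (simp_all add: clin_def)

lemmas hc_simps = linear_add[OF linear_hc(1)] linear_add[OF linear_hc(2)]
  linear_scale[OF linear_hc(1)] linear_scale[OF linear_hc(2)]
  linear_diff[OF linear_hc(1)] linear_diff[OF linear_hc(2)]
  clin_cs[OF clin_hc(1)] clin_cs[OF clin_hc(2)]

lemma hc_nondeg: "(\<And>y. hc x y = 0) \<Longrightarrow> x = 0"
  by (rule g_nondeg) (simp add: hc_def complex_eq_iff)

lemma hc_orthogonal_complement:
  assumes "hc x x \<noteq> 0"
  shows "hc x (y - cs (hc x y / hc x x) x) = 0"
  using assms by (simp add: hc_simps)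

text \<open>If the complement of \<open>x\<close> were totally isotropic, polarisation would make
  \<open>hc\<close> vanish on it; being orthogonal to \<open>x\<close> as well, it would lie in the
  radical and be zero. The space would then be the complex line of \<open>x\<close>, of real
  dimension at most 2.\<close>

lemma exists_orthogonal_nonisotropic:
  assumes dim: "DIM('f) > 2" and x: "hc x x \<noteq> 0"
  shows "\<exists>z. hc x z = 0 \<and> hc z z \<noteq> 0"
proof (rule ccontr)
  assume "\<not> ?thesis"
  then have iso: "hc z z = 0" if "hc x z = 0" for z
    using that by blast
  have zero: "z = 0" if z: "hc x z = 0" for z
  proof (rule hc_nondeg)
    fix v
    define v' where "v' = v - cs (hc x v / hc x x) x"
    have v': "hc x v' = 0"
      unfolding v'_def by (rule hc_orthogonal_complement[OF x])
    have "hc (z + v') (z + v') = 0"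
      by (rule iso) (simp add: hc_simps z v')
    then have "hc z v' = 0"
      using iso[OF z] iso[OF v'] hc_sym[of v' z] by (simp add: hc_simps)
    then show "hc z v = 0"
      using z hc_sym[of z x] by (simp add: v'_def hc_simps)
  qed
  have "v \<in> span {x, J x}" for v
  proof -
    have "v = cs (hc x v / hc x x) x"
      using zero[OF hc_orthogonal_complement[OF x, of v]] by simp
    also have "\<dots> \<in> span {x, J x}"
      unfolding cs_def by (intro span_add span_scale span_base) auto
    finally show ?thesis .
  qed
  then have "DIM('f) \<le> card {x, J x}"
    by (metis (no_types, lifting) UNIV_eq_I dim_UNIV dim_le_card finite.emptyI finite_insert subset_UNIV)
  also have "\<dots> \<le> 2"
    by (simp add: card_insert_if)
  finally show False using dim by simp
qed

lemma exists_nonisotropic: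
  "\<exists>w. hc w w \<noteq> 0"
proof (rule ccontr)
  assume "\<not> ?thesis"
  then have iso: "hc w w = 0" for w by blast
  have "w = 0" for w :: 'f
  proof (rule hc_nondeg)
    show "hc w y = 0" for y
      using iso[of "w + y"] iso[of w] iso[of y] hc_sym[of y w] by (simp add: hc_simps)
  qed
  then show False
    using nonempty_Basis nonzero_Basis by blast
qed

end

text \<open>A quadratic polynomial with three zeros vanishes at 0. One of the triples 1, 2, 3 and 4,
  5, 6 avoids the exceptional value \<open>s0\<close>; the coefficients 3, -3, 1 and 15, -24, 10 are
  the Lagrange weights for extrapolation to 0.\<close>

lemma quadratic_vanishing:
  fixes a b c :: complex
  assumes "\<And>s::real. s \<noteq> 0 \<Longrightarrow> s \<noteq> s0 \<Longrightarrow> a + of_real s * b + of_real (s * s) * c = 0"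
  shows "a = 0"
proof (cases "s0 \<in> {1, 2, 3}")
  case True
  then have "a + 4 * b + 16 * c = 0" "a + 5 * b + 25 * c = 0" "a + 6 * b + 36 * c = 0"
    using assms[of 4] assms[of 5] assms[of 6] by auto
  moreover have "a = 15 * (a + 4 * b + 16 * c) - 24 * (a + 5 * b + 25 * c) + 10 * (a + 6 * b + 36 * c)"
    by (simp add: algebra_simps)
  ultimately show ?thesis by simp
next
  case False
  then have "a + b + c = 0" "a + 2 * b + 4 * c = 0" "a + 3 * b + 9 * c = 0"
    using assms[of 1] assms[of 2] assms[of 3] by auto
  moreover have "a = 3 * (a + b + c) - 3 * (a + 2 * b + 4 * c) + (a + 3 * b + 9 * c)"
    by (simp add: algebra_simps)
  ultimately show ?thesis by simp
qed

section \<open>Kaehler curvature tensors and their vanishing\<close>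

locale kaehler_curvature_tensor = norden_space g J
  for g :: "'f::euclidean_space \<Rightarrow> 'f \<Rightarrow> real" and J +
  fixes T :: "'f \<Rightarrow> 'f \<Rightarrow> 'f \<Rightarrow> 'f \<Rightarrow> real"
  assumes linear_T1: "linear (\<lambda>x. T x y z u)" and linear_T3: "linear (\<lambda>z. T x y z u)"
    and antisym12: "T x y z u = - T y x z u" and antisym34: "T x y z u = - T x y u z"
    and bianchi: "T x y z u + T y z x u + T z x y u = 0"
    and J_T: "T x y (J z) u = T x y z (J u)"
begin

text \<open>In a signed sum of the four cyclic identities, the two skew symmetries cancel everything
  except twice the difference of these terms.\<close>

lemma pair_sym: "T x y z u = T z u x y"
  using bianchi[of x y z u] bianchi[of y z u x] bianchi[of z u x y] bianchi[of u x y z]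
    antisym12[of x y z u] antisym12[of y z x u] antisym12[of z x y u]
    antisym34[of y z u x] antisym34[of z u y x] antisym34[of u y z x]
    antisym34[of z u x y] antisym34[of u x z y] antisym34[of x z u y]
    antisym34[of u x y z] antisym34[of x y u z] antisym34[of y u x z]
    antisym12[of u x y z] antisym12[of z x u y] antisym12[of y u z x] antisym12[of y u x z]
    antisym12[of x z u y] antisym12[of u y z x] antisym12[of z x y u] antisym12[of y z u x]
  by linarith

text \<open>Polarisation in the outer pair, then in the inner pair, makes \<open>T\<close> skew in
  its first three arguments; the cyclic sum is then three times one term.\<close>

lemma T_zero:
  assumes "\<And>x y. T x y y x = 0"
  shows "T x y z u = 0"
proof -
  have 1: "T x y y u = 0" for x y u
  proof -
    have "T (x + u) y y (x + u) = T x y y x + T x y y u + T u y y x + T u y y u"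
      using linear_add[OF linear_T1, of x u y y "x + u"] linear_add[OF linear_T3, of x y x u y]
        linear_add[OF linear_T3, of u y x u y] antisym34 by smt
    moreover have "T u y y x = T x y y u"
      using pair_sym[of u y y x] antisym12[of y x u y] antisym34[of x y u y] by simp
    ultimately show ?thesis
      using assms by simp
  qed
  have 2: "T x y z u = - T x z y u" for x y z u
  proof -
    have "T x (y + z) (y + z) u = T x y y u + T x y z u + T x z y u + T x z z u"
      using linear_add[OF linear_T1, of y z x "y + z" u] linear_add[OF linear_T3, of x y y z u]
        linear_add[OF linear_T3, of x z y z u] antisym12 by smt
    then show ?thesis using 1 by simp
  qed
  show ?thesis
    using bianchi[of x y z u] 2[of y z x u] 2[of x z y u] antisym12[of y x z u] antisym12[of z x y u] by simp
qed

text \<open>\<open>T x y z (J u)\<close> satisfies the axioms of the locale too. Pair symmetry for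
  it and for \<open>T\<close> carries \<open>J\<close> from the last pair of arguments to the
  first.\<close>

lemma J_T_12: "T (J x) y z u = T x y (J z) u" "T x (J y) z u = T x y (J z) u"
proof -
  interpret T': kaehler_curvature_tensor g J "\<lambda>x y z u. T x y z (J u)"
  proof (intro kaehler_curvature_tensor.intro kaehler_curvature_tensor_axioms.intro norden_space_axioms)
    show "T x y z (J u) = - T x y u (J z)" for x y z u
      using antisym34[of x y z "J u"] J_T[of x y u z] by simp
  qed (rule linear_T1 linear_T3 antisym12 bianchi J_T)+
  show *: "T x (J y) z u = T x y (J z) u" for x y z u
    using T'.pair_sym[of z u x y] pair_sym[of z u x "J y"] J_T[of x y z u] by simp
  show "T (J x) y z u = T x y (J z) u"
    using *[of y x z u] antisym12[of "J x" y z u] antisym12[of x y "J z" u] by simp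
qed

text \<open>Built from \<open>T\<close> as \<open>hc\<close> is from \<open>g\<close>. Since
  \<open>J\<close> moves freely among all four arguments, \<open>Tc\<close> is complex linear in
  each, so vectors may be rescaled by complex numbers.\<close>

definition Tc :: "'f \<Rightarrow> 'f \<Rightarrow> 'f \<Rightarrow> 'f \<Rightarrow> complex" where
  "Tc x y z u = Complex (T x y z u) (- T x y z (J u))"

lemma clin_Tc:
  "clin (\<lambda>x. Tc x y z u)" "clin (\<lambda>y. Tc x y z u)" "clin (\<lambda>z. Tc x y z u)" "clin (\<lambda>u. Tc x y z u)"
proof -
  have J2: "T x y (J (J z)) u = - T x y z u" "T x y z (J (J u)) = - T x y z u" for x y z u
    using linear_neg[OF linear_T3, of x y z u] J_T[of x y "J z" u] J_T[of x y z "J u"] by (auto simp: J_J)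
  have "linear (\<lambda>y. T x y z u)" "linear (\<lambda>u. T x y z u)" for x y z u
  proof -
    have e: "(\<lambda>y. T x y z u) = (\<lambda>y. - T y x z u)" "(\<lambda>u. T x y z u) = (\<lambda>u. - T x y u z)"
      by (rule ext, rule antisym12, rule ext, rule antisym34)
    show "linear (\<lambda>y. T x y z u)" "linear (\<lambda>u. T x y z u)"
      unfolding e by (rule linear_compose_neg, rule linear_T1, rule linear_compose_neg, rule linear_T3)
  qed
  note lin = this linear_T1 linear_T3
  have *: "clin (\<lambda>x. Complex (a x) (- b x))" if "linear a" "linear b" "\<And>x. a (J x) = b x" "\<And>x. b (J x) = - a x"
    for a b :: "'f \<Rightarrow> real"
    using that by (auto simp: clin_def complex_eq_iff linear_add linear_scale intro!: linearI)
  have J4: "T (J x) y z u = T x y z (J u)" "T x (J y) z u = T x y z (J u)" for x y z u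
    using J_T_12[of x y z u] J_T[of x y z u] by auto
  show "clin (\<lambda>x. Tc x y z u)" "clin (\<lambda>y. Tc x y z u)" "clin (\<lambda>z. Tc x y z u)" "clin (\<lambda>u. Tc x y z u)"
    unfolding Tc_def
    by (rule *; (rule lin linear_compose[OF linear_J lin(2), unfolded o_def])?; simp add: J4 J_T J2)+
qed

lemma linear_Tc:
  "linear (\<lambda>x. Tc x y z u)" "linear (\<lambda>y. Tc x y z u)" "linear (\<lambda>z. Tc x y z u)" "linear (\<lambda>u. Tc x y z u)"
  using clin_Tc by (simp_all add: clin_def)

lemmas Tc_simps = clin_Tc[THEN clin_cs] linear_Tc[THEN linear_add] linear_Tc[THEN linear_diff]
  linear_Tc[THEN linear_scale]

lemma Tc_swap: "Tc x x z u = 0" "Tc x y z z = 0"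
  using antisym12[of x x z u] antisym12[of x x z "J u"] antisym34[of x y z z] antisym34[of x y z "J z"]
    J_T[of x y z z] by (auto simp: Tc_def complex_eq_iff)

text \<open>A pair of vectors that is orthonormal for \<open>hc\<close> spans a totally real plane. Complex
  multiples, and for the degenerate planes a perturbation argument, reach all planes.\<close>

lemma vanishing:
  assumes dim: "DIM('f) > 2"
    and T0: "\<And>x y. g x x = 1 \<Longrightarrow> g y y = 1 \<Longrightarrow> g x y = 0 \<Longrightarrow> g x (J x) = 0 \<Longrightarrow> g x (J y) = 0 \<Longrightarrow> g y (J y) = 0 \<Longrightarrow>
      T x y y x = 0 \<and> T x y y (J x) = 0"
  shows "T x y z u = 0"
proof -
  have 1: "Tc x y y x = 0" if "hc x x \<noteq> 0" "hc y y \<noteq> 0" "hc x y = 0" for x y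
  proof -
    \<comment> \<open>A complex square root normalises every vector with nonzero
      \<open>hc\<close>-square, whatever its type for the real metric.\<close>
    define \<alpha> where "\<alpha> = csqrt (1 / hc x x)"
    define \<beta> where "\<beta> = csqrt (1 / hc y y)"
    have a: "\<alpha> * \<alpha> * hc x x = 1" "\<beta> * \<beta> * hc y y = 1"
      using that power2_csqrt[of "1 / hc x x"] power2_csqrt[of "1 / hc y y"]
      by (auto simp: \<alpha>_def \<beta>_def power2_eq_square)
    have "hc (cs \<alpha> x) (cs \<alpha> x) = 1" "hc (cs \<beta> y) (cs \<beta> y) = 1" "hc (cs \<alpha> x) (cs \<beta> y) = 0"
      using a that by (simp_all add: hc_simps mult_ac)
    then have "T (cs \<alpha> x) (cs \<beta> y) (cs \<beta> y) (cs \<alpha> x) = 0 \<and> T (cs \<alpha> x) (cs \<beta> y) (cs \<beta> y) (J (cs \<alpha> x)) = 0"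
      by (intro T0) (auto simp: hc_def complex_eq_iff)
    then have "Tc (cs \<alpha> x) (cs \<beta> y) (cs \<beta> y) (cs \<alpha> x) = 0"
      by (simp add: Tc_def complex_eq_iff)
    then show ?thesis
      using a by (auto simp: Tc_simps)
  qed
  have pert: "\<exists>s0. \<forall>s::real. s \<noteq> 0 \<longrightarrow> s \<noteq> s0 \<longrightarrow> hc (y + s *\<^sub>R z) (y + s *\<^sub>R z) \<noteq> 0"
    if "hc y y = 0" "hc z z \<noteq> 0" for y z
  proof (intro exI allI impI notI)
    fix s :: real
    \<comment> \<open>As \<open>hc y y = 0\<close>, the expression is
      \<open>s * (2 * hc y z + s * hc z z)\<close>. Besides 0 it has one complex root; its real part
      is the witness \<open>s0\<close>, since \<open>s\<close> is real.\<close>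
    assume s: "s \<noteq> 0" "s \<noteq> Re (- 2 * hc y z / hc z z)" "hc (y + s *\<^sub>R z) (y + s *\<^sub>R z) = 0"
    then have "of_real s * (2 * hc y z + of_real s * hc z z) = 0"
      using that hc_sym[of z y] by (simp add: hc_simps algebra_simps scaleR_conv_of_real)
    then have "2 * hc y z + of_real s * hc z z = 0"
      using s(1) unfolding mult_eq_0_iff by auto
    then have "of_real s = - 2 * hc y z / hc z z"
      using that(2) by (simp add: field_simps eq_neg_iff_add_eq_0)
    then show False using s(2) by (metis Re_complex_of_real)
  qed
  have 2: "Tc x y y x = 0" if x: "hc x x \<noteq> 0" and y: "hc x y = 0" for x y
  proof (cases "hc y y = 0")
    \<comment> \<open>An isotropic \<open>y\<close> is moved along a \<open>z\<close> that stays
      orthogonal to \<open>x\<close>. The values for generic \<open>s\<close> determine the constant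
      coefficient, which is the wanted value.\<close>
    case True
    obtain z where z: "hc x z = 0" "hc z z \<noteq> 0"
      using exists_orthogonal_nonisotropic[OF dim x] by blast
    obtain s0 :: real where s0: "\<And>s::real. s \<noteq> 0 \<Longrightarrow> s \<noteq> s0 \<Longrightarrow> hc (y + s *\<^sub>R z) (y + s *\<^sub>R z) \<noteq> 0"
      using pert[OF True z(2)] by blast
    show ?thesis
    proof (rule quadratic_vanishing)
      fix s :: real assume "s \<noteq> 0" "s \<noteq> s0"
      then have "Tc x (y + s *\<^sub>R z) (y + s *\<^sub>R z) x = 0"
        using s0 y z by (intro 1 x) (auto simp: hc_simps)
      then show "Tc x y y x + of_real s * (Tc x y z x + Tc x z y x) + of_real (s * s) * Tc x z z x = 0"
        by (simp add: Tc_simps scaleR_conv_of_real algebra_simps)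
    qed
  qed (use 1 that in blast)
  \<comment> \<open>Removing from \<open>y\<close> its component along \<open>x\<close> does not
    change the value, because \<open>Tc\<close> vanishes when its first two or last two arguments
    coincide.\<close>
  have 3: "Tc x y y x = 0" if x: "hc x x \<noteq> 0" for x y
    using 2[OF x hc_orthogonal_complement[OF x, of y]] by (simp add: Tc_simps Tc_swap)
  have 4: "Tc x y y x = 0" for x y
  proof (cases "hc x x = 0")
    case True
    obtain w where w: "hc w w \<noteq> 0"
      using exists_nonisotropic by blast
    obtain s0 :: real where s0: "\<And>s::real. s \<noteq> 0 \<Longrightarrow> s \<noteq> s0 \<Longrightarrow> hc (x + s *\<^sub>R w) (x + s *\<^sub>R w) \<noteq> 0"
      using pert[OF True w] by blast
    show ?thesis
    proof (rule quadratic_vanishing)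
      fix s :: real assume "s \<noteq> 0" "s \<noteq> s0"
      then have "Tc (x + s *\<^sub>R w) y y (x + s *\<^sub>R w) = 0"
        using s0 by (intro 3)
      then show "Tc x y y x + of_real s * (Tc x y y w + Tc w y y x) + of_real (s * s) * Tc w y y w = 0"
        by (simp add: Tc_simps scaleR_conv_of_real algebra_simps)
    qed
  qed (use 3 in blast)
  have "T x y y x = 0" for x y
    using 4[of x y] by (simp add: Tc_def complex_eq_iff)
  then show ?thesis by (rule T_zero)
qed

text \<open>The model on the right is itself a Kaehler curvature tensor. On the pairs in question
  \<open>pi1 - pi2\<close> contributes 1 and 0, \<open>pi3\<close> contributes 0 and 1 to the two
  values, so the difference from \<open>T\<close> falls under \<open>vanishing\<close>.\<close>

lemma constant_totally_real_form:
  assumes dim: "DIM('f) > 2"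
    and T: "\<And>x y. g x x = 1 \<Longrightarrow> g y y = 1 \<Longrightarrow> g x y = 0 \<Longrightarrow> g x (J x) = 0 \<Longrightarrow> g x (J y) = 0 \<Longrightarrow> g y (J y) = 0 \<Longrightarrow>
      T x y y x = \<nu> \<and> T x y y (J x) = \<nu>t"
  shows "T x y z u = \<nu> * (pi1 g x y z u - pi2 g J x y z u) + \<nu>t * pi3 g J x y z u"
proof -
  define P where "P x y z u = \<nu> * (pi1 g x y z u - pi2 g J x y z u) + \<nu>t * pi3 g J x y z u" for x y z u
  have sw: "g (J y) x = g x (J y)" for x y
    by (rule g_sym)
  have Jc: "g y (J x) = g x (J y)" for x y
    using J_swap[of x y] g_sym[of "J x" y] by simp
  interpret D: kaehler_curvature_tensor g J "\<lambda>x y z u. T x y z u - P x y z u"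
  proof (intro kaehler_curvature_tensor.intro kaehler_curvature_tensor_axioms.intro norden_space_axioms)
    show "linear (\<lambda>x. T x y z u - P x y z u)" for y z u
      by (rule linear_compose_sub[OF linear_T1])
        (auto simp: P_def pi1_def pi2_def pi3_def g_simps J_simps algebra_simps intro!: linearI)
    show "linear (\<lambda>z. T x y z u - P x y z u)" for x y u
      by (rule linear_compose_sub[OF linear_T3])
        (auto simp: P_def pi1_def pi2_def pi3_def g_simps J_simps algebra_simps intro!: linearI)
    show "T x y z u - P x y z u = - (T y x z u - P y x z u)" for x y z u
      using antisym12[of x y z u] by (simp add: P_def pi1_def pi2_def pi3_def algebra_simps)
    show "T x y z u - P x y z u = - (T x y u z - P x y u z)" for x y z u
      using antisym34[of x y z u] by (simp add: P_def pi1_def pi2_def pi3_def algebra_simps)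
    show "T x y z u - P x y z u + (T y z x u - P y z x u) + (T z x y u - P z x y u) = 0" for x y z u
      using bianchi[of x y z u] g_sym[of x y] g_sym[of y z] g_sym[of x z] Jc[of x y] Jc[of y z] Jc[of x z]
      by (simp add: P_def pi1_def pi2_def pi3_def algebra_simps)
    show "T x y (J z) u - P x y (J z) u = T x y z (J u) - P x y z (J u)" for x y z u
      using J_T[of x y z u] by (simp add: P_def pi1_def pi2_def pi3_def J_simps g_simps algebra_simps)
  qed
  have "T x y z u - P x y z u = 0"
  proof (rule D.vanishing[OF dim])
    fix x y assume *: "g x x = 1" "g y y = 1" "g x y = 0" "g x (J x) = 0" "g x (J y) = 0" "g y (J y) = 0"
    then show "T x y y x - P x y y x = 0 \<and> T x y y (J x) - P x y y (J x) = 0"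
      using T[OF *] g_sym[of x y] Jc[of x y]
      by (simp add: P_def pi1_def pi2_def pi3_def J_simps g_simps)
  qed
  then show ?thesis by (simp add: P_def)
qed

end

section \<open>The curvature of the ambient manifold\<close>

context affine_manifold
begin

lemma nabla_tvec:
  assumes "c \<in> A" "p \<in> cdom c"
  shows "nabla (\<lambda>q. tvec A c q v) (\<lambda>q. tvec A c q w) p = tvec A c p (christoffel c (cmap c p) v w)"
  using nabla_tvec_coords[OF assms] tvec_change(2)[OF assms] by metis

lemma coord_connection:
  assumes "c \<in> A"
  shows "coord_connection (cmap c ` cdom c) (christoffel c)"
  using assms by unfold_locales
    (auto intro: open_cmap_image open_cdom bilinear_christoffel smooth_christoffel)

lemma nabla_lie_bracket_tvec:
  assumes c: "c \<in> A" and p: "p \<in> cdom c" and Z: "smooth_vf_on A (cdom c) Z"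
  shows "nabla (lie_bracket A (\<lambda>q. tvec A c q x) (\<lambda>q. tvec A c q y)) Z p = 0"
proof -
  note C = c open_cdom[OF c] order_refl
  show ?thesis
    by (rule nabla_zero_left[OF C(2) lie_bracket_tvec[OF c] _ Z p],
        assumption, rule smooth_vf_on_cong[OF C _ smooth_vf_on_zero[OF C]])
      (simp add: lie_bracket_tvec[OF c])
qed

lemma curvature_tvec:
  assumes c: "c \<in> A" and p: "p \<in> cdom c"
  shows "tcoord A c p (curvature A nabla (\<lambda>q. tvec A c q x) (\<lambda>q. tvec A c q y) (\<lambda>q. tvec A c q z) p)
    = coord_connection.Rm (christoffel c) (cmap c p) x y z"
proof -
  note C = c open_cdom[OF c] order_refl
  let ?E = "\<lambda>v q. tvec A c q v"
  note lin = linear_tcoord[OF c p]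
  have EE: "tcoord A c p (nabla (?E x) (nabla (?E y) (?E z)) p)
      = dd (\<lambda>u. christoffel c u y z) (cmap c p) x + christoffel c (cmap c p) x (christoffel c (cmap c p) y z)"
    for x y
  proof -
    have "coords c (nabla (?E y) (?E z)) u = christoffel c u y z" if "u \<in> cmap c ` cdom c" for u
      using that nabla_tvec_coords[OF c] by (auto simp: cinv_cmap c)
    then have "dd (coords c (nabla (?E y) (?E z))) (cmap c p) x = dd (\<lambda>u. christoffel c u y z) (cmap c p) x"
      using p by (intro dd_cong_open[OF open_cmap_image[OF C]]) auto
    then show ?thesis
      using nabla_coords[OF C smooth_vf_on_tvec[OF c] nabla_smooth[OF C(2)
            smooth_vf_on_tvec[OF c] smooth_vf_on_tvec[OF c]] p, of x y z]
      by (simp add: tvec_change(1)[OF c p] nabla_tvec_coords[OF c p])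
  qed
  then show ?thesis
    unfolding curvature_def coord_connection.Rm_def[OF coord_connection[OF c]]
    by (simp add: linear_diff[OF lin] nabla_lie_bracket_tvec[OF c p smooth_vf_on_tvec[OF c]] linear_0[OF lin])
qed

end

locale levi_civita_manifold = affine_manifold A nabla
  for A :: "('m::{t2_space,second_countable_topology}, 'e::euclidean_space) chart set" and nabla +
  fixes g :: "'m \<Rightarrow> 'e \<Rightarrow> 'e \<Rightarrow> real"
  assumes levi_civita: "levi_civita A g nabla"
begin

lemma torsion_free:
  "open W \<Longrightarrow> smooth_vf_on A W X \<Longrightarrow> smooth_vf_on A W Y \<Longrightarrow> p \<in> W \<Longrightarrow>
    nabla X Y p - nabla Y X p = lie_bracket A X Y p"
  using levi_civita by (auto simp: levi_civita_def)

lemma metric_compatible: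
  "open W \<Longrightarrow> smooth_vf_on A W X \<Longrightarrow> smooth_vf_on A W Y \<Longrightarrow> smooth_vf_on A W Z \<Longrightarrow> p \<in> W \<Longrightarrow>
    mderiv A (\<lambda>q. g q (Y q) (Z q)) p (X p) = g p (nabla X Y p) (Z p) + g p (Y p) (nabla X Z p)"
  using levi_civita by (auto simp: levi_civita_def)

lemma christoffel_sym:
  assumes "c \<in> A" "p \<in> cdom c"
  shows "christoffel c (cmap c p) v w = christoffel c (cmap c p) w v"
proof -
  have "nabla (\<lambda>q. tvec A c q v) (\<lambda>q. tvec A c q w) p = nabla (\<lambda>q. tvec A c q w) (\<lambda>q. tvec A c q v) p"
    using torsion_free[OF open_cdom[OF assms(1)] smooth_vf_on_tvec[OF assms(1)]
        smooth_vf_on_tvec[OF assms(1)] assms(2), of v w] lie_bracket_tvec[OF assms, of v w] by simp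
  then show ?thesis
    using nabla_tvec_coords[OF assms] by metis
qed

end

section \<open>From the ambient manifold to its coordinates\<close>

locale kaehler_norden_manifold =
  fixes B :: "('n::{t2_space,second_countable_topology}, 'f::euclidean_space) chart set"
    and J :: "'n \<Rightarrow> 'f \<Rightarrow> 'f" and g :: "'n \<Rightarrow> 'f \<Rightarrow> 'f \<Rightarrow> real" and nabla
  assumes kaehler_norden: "kaehler_norden B J g nabla"
begin

sublocale levi_civita_manifold B nabla g
  using kaehler_norden by unfold_locales (auto simp: kaehler_norden_def levi_civita_def)

lemma linear_J: "linear (J p)"
  and J_J: "J p (J p x) = - x"
  and smooth_J: "c \<in> B \<Longrightarrow> smooth_vf_on B (cdom c) (\<lambda>q. J q (tvec B c q v))"
  using kaehler_norden by (auto simp: kaehler_norden_def almost_complex_def)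

lemma pseudo_riemannian: "pseudo_riemannian B g"
  using kaehler_norden by (simp add: kaehler_norden_def)

lemma bilinear_g: "bilinear (g p)" and g_sym: "g p x y = g p y x"
  and g_nondeg: "(\<And>y. g p x y = 0) \<Longrightarrow> x = 0"
  and smooth_g: "c \<in> B \<Longrightarrow> smooth_fun_on B (cdom c) (\<lambda>q. g q (tvec B c q v) (tvec B c q w))"
  using pseudo_riemannian unfolding pseudo_riemannian_def by meson+

lemma norden_space: "norden_space (g p) (J p)"
  using kaehler_norden
  by (intro norden_space.intro bilinear_g linear_J J_J g_sym g_nondeg)
    (auto simp: kaehler_norden_def)

lemma nabla_J: "open W \<Longrightarrow> smooth_vf_on B W X \<Longrightarrow> smooth_vf_on B W Y \<Longrightarrow> p \<in> W \<Longrightarrow>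
    nabla X (\<lambda>q. J q (Y q)) p = J p (nabla X Y p)"
  using kaehler_norden by (auto simp: kaehler_norden_def)

definition gc :: "('n, 'f) chart \<Rightarrow> 'f \<Rightarrow> 'f \<Rightarrow> 'f \<Rightarrow> real" where
  "gc c u v w = g (cinv c u) (tvec B c (cinv c u) v) (tvec B c (cinv c u) w)"

definition Jc :: "('n, 'f) chart \<Rightarrow> 'f \<Rightarrow> 'f \<Rightarrow> 'f" where
  "Jc c u v = coords c (\<lambda>q. J q (tvec B c q v)) u"

lemma gc_tcoord: "c \<in> B \<Longrightarrow> p \<in> cdom c \<Longrightarrow> gc c (cmap c p) (tcoord B c p x) (tcoord B c p y) = g p x y"
  by (simp add: gc_def cinv_cmap tvec_change)

lemma Jc_tcoord: "c \<in> B \<Longrightarrow> p \<in> cdom c \<Longrightarrow> Jc c (cmap c p) (tcoord B c p x) = tcoord B c p (J p x)"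
  by (simp add: Jc_def cinv_cmap tvec_change)

text \<open>Each clause is an invariant identity evaluated on coordinate fields. Torsion-freeness
  becomes the symmetry of the Christoffel symbols because such fields commute.\<close>

lemma kaehler_norden_coords:
  assumes c: "c \<in> B"
  shows "kaehler_norden_coords (cmap c ` cdom c) (christoffel c) (gc c) (Jc c)"
proof (intro kaehler_norden_coords.intro coord_connection[OF c] kaehler_norden_coords_axioms.intro)
  note C = c open_cdom[OF c] order_refl
  let ?V = "cmap c ` cdom c" and ?E = "\<lambda>v q. tvec B c q v"
  note E = smooth_vf_on_tvec[OF c]
  fix y assume "y \<in> ?V"
  then obtain p where p: "p \<in> cdom c" and y: "y = cmap c p" by blast
  have cp: "cinv c (cmap c p) = p"
    by (rule cinv_cmap[OF c p])
  note lin = linear_tvec[OF c p] linear_tcoord[OF c p]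
  show "christoffel c y v w = christoffel c y w v" for v w
    unfolding y by (rule christoffel_sym[OF c p])
  show "bilinear (gc c y)"
    unfolding gc_def y cp bilinear_def linear_iff
    using bilinear_g[of p] by (simp add: linear_add[OF lin(1)] linear_scale[OF lin(1)]
        bilinear_ladd bilinear_radd bilinear_lmul bilinear_rmul)
  show "linear (Jc c y)"
    unfolding Jc_def y cp linear_iff
    by (simp add: linear_add[OF lin(1)] linear_scale[OF lin(1)] linear_add[OF lin(2)] linear_scale[OF lin(2)]
        linear_add[OF linear_J] linear_scale[OF linear_J])
  show "dd (\<lambda>y. gc c y s r) y v = gc c y (christoffel c y v s) r + gc c y s (christoffel c y v r)" for v s r
  proof -
    have "dd (\<lambda>y. gc c y s r) y v = mderiv B (\<lambda>q. g q (?E s q) (?E r q)) p (?E v p)"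
      using mderiv_chart[OF c p smooth_fun_on_mderiv_differentiable[OF smooth_g[OF c] c p p], of s r "?E v p"]
      by (simp add: gc_def[abs_def] o_def y tvec_change(1)[OF c p])
    then show ?thesis
      using metric_compatible[OF C(2) E E E p, of s r v]
      by (simp add: nabla_tvec[OF c p] gc_def y cp)
  qed
  show "dd (\<lambda>y. Jc c y s) y v + christoffel c y v (Jc c y s) = Jc c y (christoffel c y v s)" for v s
    using nabla_coords[OF C E smooth_J[OF c] p, of v s] nabla_J[OF C(2) E E p, of v s]
    by (simp add: Jc_def[abs_def] y cp tvec_change(1)[OF c p] nabla_tvec[OF c p])
next
  note C = c open_cdom[OF c] order_refl
  show "smooth_on (cmap c ` cdom c) (\<lambda>y. gc c y v w)" for v w
    using smooth_g[OF c, of v w] unfolding smooth_fun_on_chart[OF C] by (simp add: gc_def[abs_def] o_def)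
  show "smooth_on (cmap c ` cdom c) (\<lambda>y. Jc c y v)" for v
    using smooth_J[OF c, of v] unfolding smooth_vf_on_chart[OF C] by (simp add: Jc_def[abs_def])
qed

lemma tvec_self: "tvec B (chart_at B p) p v = v"
  using tangent_ext_self by (simp add: tangent_ext_def)

lemma gc_self: "gc (chart_at B p) (cmap (chart_at B p) p) = g p"
  and Jc_self: "Jc (chart_at B p) (cmap (chart_at B p) p) = J p"
  by (simp_all add: fun_eq_iff gc_def Jc_def cinv_cmap chart_at tvec_self tcoord_self)

abbreviation "curv p \<equiv> coord_connection.Rm (christoffel (chart_at B p)) (cmap (chart_at B p) p)"

lemma curvature_tensor_eq: "curvature_tensor B g nabla p x y z u = g p (curv p x y z) u"
  using curvature_tvec[OF chart_at, of p x y z] unfolding curvature_tensor_def tangent_ext_def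
  by (simp add: tcoord_self)

lemma J_curv: "curv p x y (J p z) = J p (curv p x y z)"
proof -
  have "cmap (chart_at B p) p \<in> cmap (chart_at B p) ` cdom (chart_at B p)"
    using chart_at by blast
  from kaehler_norden_coords.Rm_J[OF kaehler_norden_coords[OF chart_at(1)] this]
  show ?thesis by (simp add: Jc_self)
qed

lemma kaehler_curvature_tensor: "kaehler_curvature_tensor (g p) (J p) (\<lambda>x y z u. g p (curv p x y z) u)"
proof -
  interpret norden_space "g p" "J p" by (rule norden_space)
  let ?y = "cmap (chart_at B p) p"
  interpret R: kaehler_norden_coords "cmap (chart_at B p) ` cdom (chart_at B p)" "christoffel (chart_at B p)"
    "gc (chart_at B p)" "Jc (chart_at B p)"
    by (rule kaehler_norden_coords[OF chart_at(1)])
  have y: "?y \<in> cmap (chart_at B p) ` cdom (chart_at B p)"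
    using chart_at by blast
  show ?thesis
  proof (intro kaehler_curvature_tensor.intro kaehler_curvature_tensor_axioms.intro norden_space_axioms)
    show "linear (\<lambda>x. g p (curv p x y z) u)" "linear (\<lambda>z. g p (curv p x y z) u)" for x y z u
      using linear_compose[OF R.linear_Rm1[OF y], of "\<lambda>x. g p x u"] linear_compose[OF R.linear_Rm[OF y], of "\<lambda>x. g p x u"]
        bilinear_g unfolding bilinear_def by (auto simp: o_def)
    show "g p (curv p x y z) u = - g p (curv p y x z) u" for x y z u
      by (subst R.Rm_antisym) (simp add: g_simps)
    show "g p (curv p x y z) u = - g p (curv p x y u) z" for x y z u
      using R.Rm_G_skew[OF y, of x y z u] by (simp add: gc_self g_sym[of z])
    show "g p (curv p x y z) u + g p (curv p y z x) u + g p (curv p z x y) u = 0" for x y z u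
    proof -
      have "g p (curv p x y z + curv p y z x + curv p z x y) u = 0"
        unfolding R.Rm_bianchi[OF y] by (simp add: g_simps)
      then show ?thesis by (simp add: g_simps)
    qed
    show "g p (curv p x y (J p z)) u = g p (curv p x y z) (J p u)" for x y z u
      by (simp add: J_curv J_swap)
  qed
qed

text \<open>An orthonormal pair with these relations is independent, spans a plane orthogonal to its
  image under \<open>J\<close>, and has \<open>pi1 = 1\<close>; both quotients in the hypothesis
  reduce to their numerators.\<close>

lemma curv_constant_totally_real:
  assumes const: "const_totally_real_curv B J g nabla \<nu> \<nu>t" and dim: "DIM('f) > 2"
  shows "g p (curv p x y z) u
    = \<nu> p * (pi1 (g p) x y z u - pi2 (g p) (J p) x y z u) + \<nu>t p * pi3 (g p) (J p) x y z u"
proof -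
  interpret kaehler_curvature_tensor "g p" "J p" "\<lambda>x y z u. g p (curv p x y z) u"
    by (rule kaehler_curvature_tensor)
  show ?thesis
  proof (rule constant_totally_real_form[OF dim])
    fix x y assume o: "g p x x = 1" "g p y y = 1" "g p x y = 0"
      "g p x (J p x) = 0" "g p x (J p y) = 0" "g p y (J p y) = 0"
    have nz: "x \<noteq> 0" "y \<noteq> 0"
      using o by (auto simp: g_simps)
    have xy: "x \<notin> span {y}"
      using o nz by (auto simp: span_singleton g_simps)
    then have ind: "x \<noteq> y" "independent {x, y}"
      using nz by (auto simp: independent_insert span_base)
    have pi: "pi1 (g p) x y y x = 1"
      using o g_sym[of y x] by (simp add: pi1_def)
    have Jyx: "g p y (J p x) = 0"
      using o J_swap[of x y] g_sym[of "J p x" y] by simp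
    have "g p (J p v) w = 0" if "v \<in> span {x, y}" "w \<in> span {x, y}" for v w
    proof -
      obtain a b a' b' where v: "v = a *\<^sub>R x + b *\<^sub>R y" and w: "w = a' *\<^sub>R x + b' *\<^sub>R y"
        using \<open>v \<in> span {x, y}\<close> \<open>w \<in> span {x, y}\<close>
        unfolding span_insert span_singleton by (auto simp: algebra_simps)
      show ?thesis
        unfolding J_swap v w using o Jyx by (simp add: g_simps J_simps)
    qed
    with const ind pi show "g p (curv p x y y) x = \<nu> p \<and> g p (curv p x y y) (J p x) = \<nu>t p"
      unfolding const_totally_real_curv_def curvature_tensor_eq by (metis div_by_1 zero_neq_one)
  qed
qed

end

section \<open>Traces\<close>

lemma trace_matrix_sum: "tr L = (\<Sum>i\<in>UNIV. L (axis i 1) $ i)"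
  by (simp add: trace_def matrix_def)

lemma tr_diff: "tr (\<lambda>x. L x - M x) = tr L - tr M"
  by (simp add: trace_matrix_sum sum_subtractf)

lemma tr_minus: "tr (\<lambda>x. - L x) = - tr L"
  by (simp add: trace_matrix_sum sum_negf)

lemma tr_comp_commute: "linear L \<Longrightarrow> linear M \<Longrightarrow> tr (\<lambda>x. L (M x)) = tr (\<lambda>x. M (L x))"
  using trace_mul_sym[of "matrix L" "matrix M"] matrix_compose[of L M] matrix_compose[of M L]
  by (simp add: o_def)

lemma linear_axis_expand:
  fixes L :: "real ^ 'k \<Rightarrow> 'b::real_vector"
  assumes "linear L"
  shows "L w = (\<Sum>i\<in>UNIV. w $ i *\<^sub>R L (axis i 1))"
proof -
  have "L w = L (\<Sum>i\<in>UNIV. w $ i *\<^sub>R axis i 1)"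
    using basis_expansion[of w] by (simp add: scalar_mult_eq_scaleR)
  then show ?thesis using assms by (simp add: linear_sum linear_scale)
qed

lemma tr_rank_one:
  assumes "linear h"
  shows "tr (\<lambda>x. h x *\<^sub>R w) = h w"
  using linear_axis_expand[OF assms, of w] by (simp add: trace_matrix_sum mult.commute)

lemma tr_ident: "tr (\<lambda>x :: real ^ 'k. x) = real CARD('k)"
  by (simp add: trace_matrix_sum)

text \<open>By \<open>pos\<close> the operator \<open>M\<close> is invertible, and skewness then
  says that \<open>L\<close> is conjugate to minus its adjoint; its trace is its own
  negative.\<close>

lemma tr_skew:
  fixes L :: "real ^ 'k \<Rightarrow> real ^ 'k"
  assumes L: "linear L" and M: "linear M" and pos: "\<And>x. x \<bullet> M x = 0 \<Longrightarrow> x = 0"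
    and skew: "\<And>x y. x \<bullet> M (L y) = - (L x \<bullet> M y)"
  shows "tr L = 0"
proof -
  have "inj M"
    using pos by (intro linear_injective_0[OF M, THEN iffD2]) auto
  then obtain M' where M': "linear M'" "\<And>x. M' (M x) = x" "\<And>x. M (M' x) = x"
    using linear_injective_isomorphism[OF M] by auto
  have "M (L y) = - adjoint L (M y)" for y
    by (rule vector_eq_ldot[THEN iffD1]) (simp add: skew adjoint_works[OF L])
  then have L': "L y = - M' (adjoint L (M y))" for y
    using M'(2)[of "L y"] linear_neg[OF M'(1), of "adjoint L (M y)"] by simp
  have "tr L = - tr (\<lambda>y. M' (adjoint L (M y)))"
    by (rule trans[OF arg_cong[OF ext[OF L'], of "\<lambda>L. tr L"] tr_minus])
  also have "tr (\<lambda>y. M' (adjoint L (M y))) = tr (\<lambda>y. adjoint L (M (M' y)))"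
    using tr_comp_commute[OF M'(1) linear_compose[OF M adjoint_linear[OF L]]] by (simp add: o_def)
  also have "\<dots> = tr (adjoint L)"
    using M'(3) by simp
  also have "\<dots> = tr L"
    using L by (simp add: matrix_adjoint trace_def transpose_def)
  finally show ?thesis by simp
qed

section \<open>Contractions with an inverse Gram matrix\<close>

locale metric_trace =
  fixes g :: "real ^ 'k \<Rightarrow> real ^ 'k \<Rightarrow> real" and F G
  assumes bil: "bilinear g" and sym: "g x y = g y x"
    and basis: "independent F" "span F = UNIV" and gram: "inverse_gram g F G"
begin

lemma finite_F: "finite F"
  using basis(1) by (rule independent_imp_finite)

lemma completeness: "(\<Sum>a\<in>F. \<Sum>b\<in>F. (G a b * g v b) *\<^sub>R a) = v"
proof -
  define E where "E v = (\<Sum>a\<in>F. \<Sum>b\<in>F. (G a b * g v b) *\<^sub>R a)" for v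
  have lin: "linear E"
    by (rule linearI)
      (simp_all add: E_def bilinear_ladd[OF bil] bilinear_lmul[OF bil] algebra_simps sum.distrib scaleR_sum_right)
  have F: "E v = v" if "v \<in> F" for v
  proof -
    have "E v = (\<Sum>a\<in>F. (\<Sum>b\<in>F. G a b * g b v) *\<^sub>R a)"
      by (simp add: E_def scaleR_sum_left sym[of v])
    also have "\<dots> = (\<Sum>a\<in>F. if a = v then v else 0)"
      using gram that by (intro sum.cong refl) (auto simp: inverse_gram_def)
    also have "\<dots> = v"
      using finite_F that by simp
    finally show ?thesis .
  qed
  have "E v = v" for v
    by (rule linear_eq_on_span[OF lin linear_ident, of F]) (use F basis in auto)
  then show ?thesis by (simp add: E_def)
qed

lemma tr_gram:
  assumes L: "linear L"
  shows "(\<Sum>a\<in>F. \<Sum>b\<in>F. G a b * g (L a) b) = tr L"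
proof -
  have lin: "linear (\<lambda>x. g x b)" for b using bil by (simp add: bilinear_def)
  have exp: "L x = (\<Sum>a\<in>F. \<Sum>b\<in>F. (G a b * g x b) *\<^sub>R L a)" for x
    using arg_cong[OF completeness[of x], of L] by (simp add: linear_sum[OF L] linear_scale[OF L])
  have "tr L = (\<Sum>i\<in>UNIV. (\<Sum>a\<in>F. \<Sum>b\<in>F. (G a b * g (axis i 1) b) *\<^sub>R L a) $ i)"
    unfolding trace_matrix_sum by (rule sum.cong[OF refl]) (rule arg_cong[OF exp])
  also have "\<dots> = (\<Sum>i\<in>UNIV. \<Sum>a\<in>F. \<Sum>b\<in>F. G a b * (L a $ i * g (axis i 1) b))"
    by (simp add: mult_ac)
  also have "\<dots> = (\<Sum>a\<in>F. \<Sum>b\<in>F. \<Sum>i\<in>UNIV. G a b * (L a $ i * g (axis i 1) b))"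
    by (subst sum.swap, rule sum.cong[OF refl], subst sum.swap, rule refl)
  also have "\<dots> = (\<Sum>a\<in>F. \<Sum>b\<in>F. G a b * g (L a) b)"
  proof (intro sum.cong refl)
    fix a b
    have "g (L a) b = (\<Sum>i\<in>UNIV. L a $ i * g (axis i 1) b)"
      using linear_axis_expand[OF lin, of "L a" b] by simp
    then show "(\<Sum>i\<in>UNIV. G a b * (L a $ i * g (axis i 1) b)) = G a b * g (L a) b"
      by (simp add: sum_distrib_left)
  qed
  finally show ?thesis by simp
qed

text \<open>The tensors to be contracted are sums of products of two forms \<open>g (L _) _\<close>.
  Only two patterns of indices occur: each factor contracted with itself, or the two chained by
  \<open>completeness\<close>.\<close>

lemma scalar_curv_product:
  assumes L: "linear L" and M: "linear M"
  shows "scalar_curv F G (\<lambda>a b c d. g (L b) c * g (M a) d) = tr L * tr M"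
    and "scalar_curv F G (\<lambda>a b c d. g (L a) c * g (M b) d) = tr (\<lambda>x. M (L x))"
proof -
  have "scalar_curv F G (\<lambda>a b c d. g (L b) c * g (M a) d)
      = (\<Sum>a\<in>F. \<Sum>b\<in>F. \<Sum>c\<in>F. \<Sum>d\<in>F. (G b c * g (L b) c) * (G a d * g (M a) d))"
    by (simp add: scalar_curv_def mult_ac)
  also have "\<dots> = (\<Sum>a\<in>F. (\<Sum>b\<in>F. \<Sum>c\<in>F. G b c * g (L b) c) * (\<Sum>d\<in>F. G a d * g (M a) d))"
    by (simp only: sum_distrib_left[symmetric] sum_distrib_right[symmetric])
  also have "\<dots> = (\<Sum>b\<in>F. \<Sum>c\<in>F. G b c * g (L b) c) * (\<Sum>a\<in>F. \<Sum>d\<in>F. G a d * g (M a) d)"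
    by (simp only: sum_distrib_left)
  finally show "scalar_curv F G (\<lambda>a b c d. g (L b) c * g (M a) d) = tr L * tr M"
    by (simp add: tr_gram L M)
  have gM: "linear (\<lambda>x. g (M x) d)" for d
    using bil linear_compose[OF M, of "\<lambda>x. g x d"] by (simp add: bilinear_def o_def)
  have "g (M v) d = (\<Sum>b\<in>F. \<Sum>c\<in>F. (G b c * g v c) * g (M b) d)" for v d
    using arg_cong[OF completeness[of v], of "\<lambda>x. g (M x) d"] by (simp add: linear_sum[OF gM] linear_scale[OF gM])
  note exp = this[symmetric]
  have "scalar_curv F G (\<lambda>a b c d. g (L a) c * g (M b) d)
      = (\<Sum>a\<in>F. \<Sum>b\<in>F. \<Sum>c\<in>F. \<Sum>d\<in>F. G a d * ((G b c * g (L a) c) * g (M b) d))"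
    by (simp add: scalar_curv_def mult_ac)
  also have "\<dots> = (\<Sum>a\<in>F. \<Sum>d\<in>F. \<Sum>b\<in>F. \<Sum>c\<in>F. G a d * ((G b c * g (L a) c) * g (M b) d))"
    by (rule sum.cong[OF refl], rule trans[OF sum.cong[OF refl sum.swap] sum.swap])
  also have "\<dots> = (\<Sum>a\<in>F. \<Sum>d\<in>F. G a d * (\<Sum>b\<in>F. \<Sum>c\<in>F. (G b c * g (L a) c) * g (M b) d))"
    by (simp only: sum_distrib_left)
  also have "\<dots> = (\<Sum>a\<in>F. \<Sum>d\<in>F. G a d * g (M (L a)) d)"
    by (simp only: exp)
  also have "\<dots> = tr (\<lambda>x. M (L x))"
    using tr_gram[OF linear_compose[OF L M]] by (simp add: o_def)
  finally show "scalar_curv F G (\<lambda>a b c d. g (L a) c * g (M b) d) = tr (\<lambda>x. M (L x))" .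
qed

end

lemma scalar_curv_add:
  "scalar_curv F G (\<lambda>a b c d. P a b c d + Q a b c d) = scalar_curv F G P + scalar_curv F G Q"
  by (simp add: scalar_curv_def distrib_left sum.distrib)

lemma scalar_curv_diff:
  "scalar_curv F G (\<lambda>a b c d. P a b c d - Q a b c d) = scalar_curv F G P - scalar_curv F G Q"
  by (simp add: scalar_curv_def right_diff_distrib sum_subtractf)

lemma scalar_curv_mult: "scalar_curv F G (\<lambda>a b c d. k * P a b c d) = k * scalar_curv F G P"
  by (simp add: scalar_curv_def sum_distrib_left mult_ac)


section \<open>Almost contact structures with Norden metric\<close>

locale almost_contact_norden =
  fixes \<phi> :: "'e::euclidean_space \<Rightarrow> 'e" and \<xi> :: 'e and \<eta> :: "'e \<Rightarrow> real" and g :: "'e \<Rightarrow> 'e \<Rightarrow> real"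
  assumes bilinear_gM: "bilinear g" and gM_sym: "g x y = g y x" and linear_\<phi>: "linear \<phi>"
    and \<phi>_\<phi>: "\<phi> (\<phi> x) = - x + \<eta> x *\<^sub>R \<xi>" and \<phi>_\<xi>: "\<phi> \<xi> = 0" and \<eta>_\<phi>: "\<eta> (\<phi> x) = 0"
    and \<eta>_g: "\<eta> x = g x \<xi>" and \<eta>_\<xi>: "\<eta> \<xi> = 1" and \<phi>_g: "g (\<phi> x) y = g x (\<phi> y)"
begin

lemmas gM_simps = bilinear_ladd[OF bilinear_gM] bilinear_radd[OF bilinear_gM]
  bilinear_lmul[OF bilinear_gM] bilinear_rmul[OF bilinear_gM]
  bilinear_lneg[OF bilinear_gM] bilinear_rneg[OF bilinear_gM]
  bilinear_lsub[OF bilinear_gM] bilinear_rsub[OF bilinear_gM]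
  bilinear_lzero[OF bilinear_gM] bilinear_rzero[OF bilinear_gM]

lemma linear_\<eta>: "linear \<eta>"
  unfolding \<eta>_g[abs_def] using bilinear_gM by (simp add: bilinear_def)

definition H :: "'e \<Rightarrow> 'e" where "H x = x - \<eta> x *\<^sub>R \<xi>"

lemma linear_H: "linear H"
  unfolding H_def by (rule linearI) (simp_all add: linear_add[OF linear_\<eta>] linear_scale[OF linear_\<eta>] algebra_simps)

lemma g_H: "g (H x) y = g x y - \<eta> x * \<eta> y"
  by (simp add: H_def gM_simps \<eta>_g[of y] gM_sym[of \<xi> y])

lemma \<phi>_H: "\<phi> (H x) = \<phi> x" "H (\<phi> x) = \<phi> x" "\<phi> (\<phi> x) = - H x" "H (H x) = H x"
  by (simp_all add: H_def linear_diff[OF linear_\<phi>] linear_scale[OF linear_\<phi>] \<phi>_\<xi> \<eta>_\<phi> \<phi>_\<phi>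
      linear_diff[OF linear_\<eta>] linear_scale[OF linear_\<eta>] \<eta>_\<xi>)

text \<open>The terms \<open>pi4\<close> here and \<open>pi5\<close> in \<open>E3\<close> turn
  \<open>g\<close> into \<open>g (H _) _\<close>: \<open>E1\<close> and \<open>E3\<close> are
  \<open>pi1 - pi2\<close> and \<open>pi3\<close> for the metric and complex structure of ker
  \<eta>, extended by 0 to \<xi>.\<close>

definition E1 :: "'e \<Rightarrow> 'e \<Rightarrow> 'e \<Rightarrow> 'e \<Rightarrow> real" where
  "E1 x y z u = pi1 g x y z u - pi2 g \<phi> x y z u - pi4 g \<eta> x y z u"

definition E3 :: "'e \<Rightarrow> 'e \<Rightarrow> 'e \<Rightarrow> 'e \<Rightarrow> real" where
  "E3 x y z u = pi3 g \<phi> x y z u + pi5 g \<phi> \<eta> x y z u"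

lemma E1_eq: "E1 x y z u = g (H y) z * g (H x) u - g (H x) z * g (H y) u - g (\<phi> y) z * g (\<phi> x) u + g (\<phi> x) z * g (\<phi> y) u"
  by (simp add: E1_def pi1_def pi2_def pi4_def g_H \<phi>_g algebra_simps)

lemma E3_eq: "E3 x y z u = g (H x) z * g (\<phi> y) u + g (\<phi> x) z * g (H y) u - g (H y) z * g (\<phi> x) u - g (\<phi> y) z * g (H x) u"
  by (simp add: E3_def pi3_def pi5_def g_H \<phi>_g algebra_simps)

lemma g_H_\<phi>: "g (H x) (\<phi> y) = g (\<phi> x) y" "g (\<phi> x) (\<phi> y) = - g (H x) y"
  using \<phi>_H by (simp_all add: \<phi>_g[symmetric] gM_simps)

text \<open>On ker \<eta> the map \<phi> is multiplication by i, and \<open>E1 + i E3\<close> is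
  complex linear in its last argument.\<close>

lemma E1_\<phi>: "E1 x y z (\<phi> u) = - E3 x y z u" and E3_\<phi>: "E3 x y z (\<phi> u) = E1 x y z u"
  by (simp_all add: E1_eq E3_eq g_H_\<phi>)

lemma kaehlerian: "E1 x y (\<phi> z) (\<phi> u) = - E1 x y z u" "E3 x y (\<phi> z) (\<phi> u) = - E3 x y z u"
  by (simp_all add: E1_eq E3_eq g_H_\<phi> algebra_simps)

end

section \<open>Scalar curvatures of the model tensors\<close>

locale almost_contact_norden_operator = almost_contact_norden \<phi> \<xi> \<eta> g
  for \<phi> :: "real ^ 'k \<Rightarrow> real ^ 'k" and \<xi> \<eta> g +
  fixes S :: "real ^ 'k \<Rightarrow> real ^ 'k"
  assumes linear_S: "linear S" and S_sym: "g (S x) y = g x (S y)"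
begin

text \<open>For \<open>g\<close> the map \<phi> is symmetric, which says nothing about its trace. It
  is skew, however, for the positive definite form obtained by averaging the Euclidean product over
  \<open>H\<close> and \<phi> and adding the square of \<eta>, because \<phi> carries the pair
  \<open>(H, \<phi>)\<close> to \<open>(\<phi>, - H)\<close>.\<close>

lemma tr_\<phi>: "tr \<phi> = 0"
proof (rule tr_skew[OF linear_\<phi>])
  let ?M = "\<lambda>y. adjoint H (H y) + adjoint \<phi> (\<phi> y) + \<eta> y *\<^sub>R adjoint \<eta> 1"
  have M: "x \<bullet> ?M y = H x \<bullet> H y + \<phi> x \<bullet> \<phi> y + \<eta> x * \<eta> y" for x y
    by (simp add: inner_add_right adjoint_works[OF linear_H] adjoint_works[OF linear_\<phi>]
        adjoint_works[OF linear_\<eta>] mult.commute)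
  show "linear ?M"
    by (intro linear_compose_add linear_compose[OF linear_H adjoint_linear[OF linear_H], unfolded o_def]
        linear_compose[OF linear_\<phi> adjoint_linear[OF linear_\<phi>], unfolded o_def])
      (auto intro!: linearI simp: linear_add[OF linear_\<eta>] linear_scale[OF linear_\<eta>] algebra_simps)
  show "x = 0" if "x \<bullet> ?M x = 0" for x
  proof -
    have "H x \<bullet> H x = 0" "\<eta> x * \<eta> x = 0"
      using that inner_ge_zero[of "H x"] inner_ge_zero[of "\<phi> x"] zero_le_square[of "\<eta> x"]
      unfolding M by linarith+
    then show "x = 0" by (simp add: H_def)
  qed
  show "x \<bullet> ?M (\<phi> y) = - (\<phi> x \<bullet> ?M y)" for x y
    unfolding M by (simp add: \<phi>_H \<eta>_\<phi>)
qed

lemma tr_H: "tr H = real CARD('k) - 1"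
  using tr_diff[of "\<lambda>x. x" "\<lambda>x. \<eta> x *\<^sub>R \<xi>"] tr_rank_one[OF linear_\<eta>, of \<xi>]
  by (simp add: H_def[abs_def] tr_ident \<eta>_\<xi>)

lemma tr_H_comp: "linear L \<Longrightarrow> tr (\<lambda>x. H (L x)) = tr L - \<eta> (L \<xi>)"
  using tr_diff[of L "\<lambda>x. \<eta> (L x) *\<^sub>R \<xi>"] tr_rank_one[OF linear_compose[OF _ linear_\<eta>], of L \<xi>]
  by (simp add: H_def[abs_def] o_def)

definition a_inv :: real where
  "a_inv = (tr S)\<^sup>2 - tr (S \<circ> S) - (tr (S \<circ> \<phi>))\<^sup>2 + tr ((S \<circ> \<phi>) \<circ> (S \<circ> \<phi>))
    - 2 * \<eta> (S \<xi>) * tr S + 2 * g (S \<xi>) (S \<xi>)"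

definition b_inv :: real where
  "b_inv = tr (S \<circ> S \<circ> \<phi>) - tr S * tr (S \<circ> \<phi>) + \<eta> (S \<xi>) * tr (S \<circ> \<phi>) - g (\<phi> (S \<xi>)) (S \<xi>)"

context
  fixes F G assumes basis: "independent F" "span F = UNIV" and gram: "inverse_gram g F G"
begin

interpretation metric_trace g F G
  by (unfold_locales) (rule bilinear_gM gM_sym basis gram)+

lemma scalar_curv_E:
  assumes L: "linear L"
  shows "scalar_curv F G (\<lambda>x y. E1 (L x) (L y))
      = (tr (\<lambda>x. H (L x)))\<^sup>2 - tr (\<lambda>x. H (L (H (L x)))) - (tr (\<lambda>x. \<phi> (L x)))\<^sup>2 + tr (\<lambda>x. \<phi> (L (\<phi> (L x))))"
    and "scalar_curv F G (\<lambda>x y. E3 (L x) (L y))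
      = 2 * tr (\<lambda>x. H (L (\<phi> (L x)))) - 2 * tr (\<lambda>x. H (L x)) * tr (\<lambda>x. \<phi> (L x))"
proof -
  have lin: "linear (\<lambda>x. H (L x))" "linear (\<lambda>x. \<phi> (L x))"
    using linear_comp[OF L] linear_H linear_\<phi> by auto
  show "scalar_curv F G (\<lambda>x y. E1 (L x) (L y))
      = (tr (\<lambda>x. H (L x)))\<^sup>2 - tr (\<lambda>x. H (L (H (L x)))) - (tr (\<lambda>x. \<phi> (L x)))\<^sup>2 + tr (\<lambda>x. \<phi> (L (\<phi> (L x))))"
    unfolding E1_eq[abs_def]
    by (simp add: scalar_curv_add scalar_curv_diff scalar_curv_product[OF lin(1) lin(1)]
        scalar_curv_product[OF lin(2) lin(2)] power2_eq_square)
  show "scalar_curv F G (\<lambda>x y. E3 (L x) (L y))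
      = 2 * tr (\<lambda>x. H (L (\<phi> (L x)))) - 2 * tr (\<lambda>x. H (L x)) * tr (\<lambda>x. \<phi> (L x))"
    unfolding E3_eq[abs_def] using tr_comp_commute[OF lin]
    by (simp add: scalar_curv_add scalar_curv_diff scalar_curv_product[OF lin(1) lin(2)]
        scalar_curv_product[OF lin(2) lin(1)])
qed

text \<open>With k the dimension, \<open>H\<close> has trace k - 1, \<phi> has trace 0 and its
  square is \<open>- H\<close>; this leaves (k - 1)^2 - 2 (k - 1).\<close>

lemma scalar_curv_E_ident:
  "scalar_curv F G E1 = (real CARD('k) - 1) * (real CARD('k) - 3)" "scalar_curv F G E3 = 0"
  using scalar_curv_E[OF linear_ident] tr_minus[of H]
  by (simp_all add: \<phi>_H tr_\<phi> tr_H power2_eq_square algebra_simps)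

lemma scalar_curv_E_S:
  "scalar_curv F G (\<lambda>x y. E1 (S x) (S y)) = a_inv" "scalar_curv F G (\<lambda>x y. E3 (S x) (S y)) = 2 * b_inv"
proof -
  note lS = linear_S linear_comp[OF linear_S linear_S] linear_comp[OF linear_S linear_\<phi>]
    linear_comp[OF linear_\<phi> linear_S]
  have \<eta>S: "\<eta> (S x) = g x (S \<xi>)" for x
    by (simp add: \<eta>_g S_sym)
  have "tr (\<lambda>x. H (S (H (S x)))) = tr (\<lambda>x. H (S (S x)) - \<eta> (S x) *\<^sub>R H (S \<xi>))"
    by (simp add: H_def[of "S _"] linear_diff[OF linear_S] linear_scale[OF linear_S] linear_diff[OF linear_H]
        linear_scale[OF linear_H])
  also have "\<dots> = tr (\<lambda>x. H (S (S x))) - \<eta> (S (H (S \<xi>)))"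
    using tr_diff[of "\<lambda>x. H (S (S x))" "\<lambda>x. \<eta> (S x) *\<^sub>R H (S \<xi>)"]
      tr_rank_one[OF linear_comp[OF linear_S linear_\<eta>], of "H (S \<xi>)"] by simp
  also have "\<dots> = tr (\<lambda>x. S (S x)) - 2 * g (S \<xi>) (S \<xi>) + \<eta> (S \<xi>) * \<eta> (S \<xi>)"
    unfolding tr_H_comp[OF lS(2)] \<eta>S by (simp add: g_H \<eta>S \<eta>_g[of "S \<xi>"] S_sym)
  \<comment> \<open>The last summand will cancel the square of \<open>\<eta> (S \<xi>)\<close>
    produced by squaring the trace of \<open>H S\<close>; hence no such term in
    \<open>a_inv\<close>.\<close>
  finally have HSHS: "tr (\<lambda>x. H (S (H (S x)))) = tr (\<lambda>x. S (S x)) - 2 * g (S \<xi>) (S \<xi>) + \<eta> (S \<xi>) * \<eta> (S \<xi>)" .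
  have cyc: "tr (\<lambda>x. \<phi> (S x)) = tr (\<lambda>x. S (\<phi> x))" "tr (\<lambda>x. \<phi> (S (\<phi> (S x)))) = tr (\<lambda>x. S (\<phi> (S (\<phi> x))))"
    "tr (\<lambda>x. S (\<phi> (S x))) = tr (\<lambda>x. S (S (\<phi> x)))"
    using tr_comp_commute[OF linear_\<phi> linear_S] tr_comp_commute[OF linear_\<phi> linear_comp[OF lS(3) linear_S]]
      tr_comp_commute[OF lS(4) linear_S] by simp_all
  have HSfS: "tr (\<lambda>x. H (S (\<phi> (S x)))) = tr (\<lambda>x. S (S (\<phi> x))) - g (\<phi> (S \<xi>)) (S \<xi>)"
    using tr_H_comp[OF linear_comp[OF lS(3) linear_S]] cyc(3) by (simp add: \<eta>S)
  show "scalar_curv F G (\<lambda>x y. E1 (S x) (S y)) = a_inv"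
    unfolding scalar_curv_E[OF linear_S] a_inv_def tr_H_comp[OF linear_S] HSHS cyc
    by (simp add: o_def power2_eq_square algebra_simps)
  show "scalar_curv F G (\<lambda>x y. E3 (S x) (S y)) = 2 * b_inv"
    unfolding scalar_curv_E[OF linear_S] b_inv_def tr_H_comp[OF linear_S] HSfS cyc
    by (simp add: o_def algebra_simps)
qed

lemma scalar_curvatures:
  assumes K: "\<And>x y z u. K x y z u
    = (\<nu> * E1 x y z u + \<nu>t * E3 x y z u) - C * (C * E1 (S x) (S y) z u + s * E3 (S x) (S y) z u)"
  shows "scalar_curv F G K = \<nu> * ((real CARD('k) - 1) * (real CARD('k) - 3)) - C * (a_inv * C + 2 * b_inv * s)"
    and "assoc_scalar_curv F G \<phi> K = \<nu>t * ((real CARD('k) - 1) * (real CARD('k) - 3)) - C * (a_inv * s - 2 * b_inv * C)"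
proof -
  have lin: "scalar_curv F G (\<lambda>x y z u. (p * P x y z u + q * Q x y z u) - k * (l * P' x y z u + j * Q' x y z u))
     = (p * scalar_curv F G P + q * scalar_curv F G Q) - k * (l * scalar_curv F G P' + j * scalar_curv F G Q')"
    for p q k l j P Q P' Q'
    by (simp only: scalar_curv_add scalar_curv_diff scalar_curv_mult)
  have K': "K = (\<lambda>x y z u. (\<nu> * E1 x y z u + \<nu>t * E3 x y z u)
      - C * (C * E1 (S x) (S y) z u + s * E3 (S x) (S y) z u))"
    using K by (intro ext)
  show "scalar_curv F G K = \<nu> * ((real CARD('k) - 1) * (real CARD('k) - 3)) - C * (a_inv * C + 2 * b_inv * s)"
    unfolding K' lin scalar_curv_E_ident scalar_curv_E_S by (simp add: algebra_simps)
  \<comment> \<open>Inserting \<phi> rotates coefficients: (\<nu>, \<nu>t) becomes (\<nu>t, -\<nu>)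
    and (C, s) becomes (s, -C). The first scalar curvature formula then applies.\<close>
  have "assoc_scalar_curv F G \<phi> K = scalar_curv F G (\<lambda>x y z u. (\<nu>t * E1 x y z u + (- \<nu>) * E3 x y z u)
      - C * (s * E1 (S x) (S y) z u + (- C) * E3 (S x) (S y) z u))"
    unfolding assoc_scalar_curv_def scalar_curv_def K E1_\<phi> E3_\<phi> by (simp add: algebra_simps)
  then show "assoc_scalar_curv F G \<phi> K = \<nu>t * ((real CARD('k) - 1) * (real CARD('k) - 3)) - C * (a_inv * s - 2 * b_inv * C)"
    unfolding lin scalar_curv_E_ident scalar_curv_E_S by (simp add: algebra_simps)
qed

end

end

section \<open>Time-like hyperplanes in a Norden space\<close>

text \<open>\<open>C\<close> and \<open>m\<close> are the cosine and the tangent of the angle, so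
  that its sine is \<open>C * m\<close>. The pointwise algebra needs only their polynomial relation
  \<open>C_m\<close>.\<close>

locale norden_hyperplane = norden_space g' J
  for g' :: "'f::euclidean_space \<Rightarrow> 'f \<Rightarrow> real" and J +
  fixes df :: "'e::euclidean_space \<Rightarrow> 'f" and N :: 'f and C m :: real
    and \<phi> :: "'e \<Rightarrow> 'e" and \<xi> :: 'e and \<eta> :: "'e \<Rightarrow> real" and g :: "'e \<Rightarrow> 'e \<Rightarrow> real"
  assumes linear_df: "linear df" and inj_df: "inj df" and dim: "DIM('f) = DIM('e) + 1"
    and N_N: "g' N N = - 1" and df_N: "g' (df x) N = 0" and N_JN: "g' N (J N) = m"
    and C_m: "C * C * (1 + m * m) = 1"
    and df_\<phi>: "df (\<phi> x) = J (df x) + (C * g' (df x) (J N)) *\<^sub>R (C *\<^sub>R N - (C * m) *\<^sub>R J N)"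
    and df_\<xi>: "df \<xi> = (C * m) *\<^sub>R N + C *\<^sub>R J N"
    and \<eta>_def: "\<eta> x = C * g' (df x) (J N)"
    and g_def: "g x y = g' (df x) (df y)"
begin

lemmas df_simps = linear_add[OF linear_df] linear_diff[OF linear_df] linear_scale[OF linear_df]
  linear_neg[OF linear_df] linear_0[OF linear_df]

lemma df_eq: "df x = df y \<Longrightarrow> x = y"
  using inj_df by (simp add: inj_eq)

lemma normal_products: "g' (J N) (J N) = 1" "g' (J N) N = m" "g' N (df x) = 0"
  using J_anti[of N N] N_N N_JN J_swap[of N N] df_N[of x] g_sym[of N "df x"] by simp_all

text \<open>The component in the complex line spanned by \<open>N\<close> is \<open>\<alpha> s *\<^sub>R N + \<beta> s *\<^sub>R J N\<close>; \<open>P\<close> is the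
  projection onto the complement.\<close>

definition \<alpha> :: "'f \<Rightarrow> real" where "\<alpha> s = C * C * (m * g' s (J N) - g' s N)"
definition \<beta> :: "'f \<Rightarrow> real" where "\<beta> s = C * C * (m * g' s N + g' s (J N))"
definition P :: "'f \<Rightarrow> 'f" where "P s = s - \<alpha> s *\<^sub>R N - \<beta> s *\<^sub>R J N"

lemma C_m': "C * C * m * m = 1 - C * C"
  using C_m by (simp add: algebra_simps)

lemma \<alpha>\<beta>_normal: "\<alpha> N = 1" "\<beta> N = 0" "\<alpha> (J N) = 0" "\<beta> (J N) = 1"
  using C_m' by (simp_all add: \<alpha>_def \<beta>_def N_N N_JN normal_products algebra_simps)

text \<open>\<alpha> and \<beta> are the real and imaginary part of \<open>hc s N / hc N N\<close>,
  a complex linear functional; the denominator is -(1 + i m), and rationalising the quotient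
  produces the factor \<open>C * C\<close>.\<close>

lemma \<alpha>\<beta>_J: "\<alpha> (J s) = - \<beta> s" "\<beta> (J s) = \<alpha> s"
  by (simp_all add: \<alpha>_def \<beta>_def J_anti J_swap[of s N] algebra_simps)

lemma linear_\<alpha>\<beta>: "linear \<alpha>" "linear \<beta>"
  by (auto intro!: linearI simp: \<alpha>_def \<beta>_def g_simps algebra_simps)

lemmas \<alpha>\<beta>_simps = linear_\<alpha>\<beta>[THEN linear_add] linear_\<alpha>\<beta>[THEN linear_diff] linear_\<alpha>\<beta>[THEN linear_scale]
  linear_\<alpha>\<beta>[THEN linear_neg]

lemma linear_P: "linear P"
  by (rule linearI) (simp_all add: P_def \<alpha>\<beta>_simps algebra_simps)

lemmas P_simps = linear_add[OF linear_P] linear_diff[OF linear_P] linear_scale[OF linear_P]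
  linear_neg[OF linear_P]

lemma P_N: "P N = 0" "P (J N) = 0"
  by (simp_all add: P_def \<alpha>\<beta>_normal)

lemma P_J: "P (J s) = J (P s)"
  by (simp add: P_def \<alpha>\<beta>_J J_simps)

lemma P_P: "P (P s) = P s"
  by (simp add: P_def[of s] P_simps P_N)

lemma P_df_\<xi>: "P (df \<xi>) = 0"
  by (simp add: df_\<xi> P_simps P_N)

lemma P_orth: "g' (P s) N = 0" "g' (P s) (J N) = 0"
proof -
  have "\<alpha> (P s) = 0" "\<beta> (P s) = 0"
    by (simp_all add: P_def \<alpha>\<beta>_simps \<alpha>\<beta>_normal)
  moreover have "C \<noteq> 0" using C_m by auto
  ultimately have e: "m * g' (P s) (J N) = g' (P s) N" "m * g' (P s) N + g' (P s) (J N) = 0"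
    by (simp_all add: \<alpha>_def \<beta>_def)
  \<comment> \<open>The equations \<open>e\<close> are a homogeneous linear system in the two
    products, with determinant 1 + m^2 up to sign.\<close>
  then have "(1 + m * m) * g' (P s) (J N) = 0"
    by (simp add: algebra_simps)
  moreover have "1 + m * m \<noteq> 0"
    using C_m by auto
  ultimately show "g' (P s) (J N) = 0"
    by simp
  with e show "g' (P s) N = 0" by simp
qed

lemma P_sym: "g' (P s) w = g' s (P w)"
proof -
  have "g' (P s) w = g' (P s) (P w)"
    by (simp add: P_def[of w] g_simps P_orth)
  also have "\<dots> = g' s (P w)"
    using P_orth[of w] g_sym[of N "P w"] g_sym[of "J N" "P w"] by (simp add: P_def[of s] g_simps)
  finally show ?thesis .
qed

text \<open>The vector \<open>df \<xi>\<close> is tangent and lies in the complex line of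
  \<open>N\<close>, so projecting a tangent vector off that line removes exactly its
  \<xi>-component.\<close>

lemma P_df: "P (df x) = df x - \<eta> x *\<^sub>R df \<xi>"
  by (simp add: P_def \<alpha>_def \<beta>_def df_N df_\<xi> \<eta>_def algebra_simps)

text \<open>The correction term in the definition of \<phi> is \<open>- \<eta> x\<close> times
  \<open>J (df \<xi>)\<close>: thus \<phi> is \<open>J\<close> after projection to the
  \<open>J\<close>-invariant complement.\<close>

lemma df_\<phi>': "df (\<phi> x) = J (P (df x))"
  by (simp add: P_df df_\<phi> df_\<xi> \<eta>_def J_simps algebra_simps)

lemma \<eta>_\<xi>: "\<eta> \<xi> = 1"
proof -
  have "\<eta> \<xi> = C * C * (1 + m * m)"
    by (simp add: \<eta>_def df_\<xi> g_simps N_JN normal_products algebra_simps)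
  then show ?thesis using C_m by simp
qed

lemma \<eta>_P: "df x = P s + k *\<^sub>R df \<xi> \<Longrightarrow> \<eta> x = k"
  using \<eta>_\<xi> by (simp add: \<eta>_def[of x] \<eta>_def[of \<xi>] g_simps P_orth mult_ac)

lemma g_df_P: "g' (df x) (P (df y)) = g x y - \<eta> x * \<eta> y" "g' (df x) (J (P (df y))) = g x (\<phi> y)"
proof -
  have "g' (df x) (df \<xi>) = \<eta> x"
    by (simp add: df_\<xi> g_simps df_N \<eta>_def)
  then show "g' (df x) (P (df y)) = g x y - \<eta> x * \<eta> y"
    by (simp add: P_df g_simps g_def)
  show "g' (df x) (J (P (df y))) = g x (\<phi> y)"
    by (simp add: g_def df_\<phi>')
qed

sublocale M: almost_contact_norden \<phi> \<xi> \<eta> g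
proof unfold_locales
  show "bilinear g"
    unfolding g_def bilinear_def linear_iff by (simp add: df_simps g_simps)
  show "g x y = g y x" for x y
    by (simp add: g_def g_sym)
  show "\<phi> (x + y) = \<phi> x + \<phi> y" "\<phi> (c *\<^sub>R x) = c *\<^sub>R \<phi> x" for x y c
    by (rule df_eq, simp add: df_\<phi>' df_simps P_simps J_simps)+
  show "\<phi> (\<phi> x) = - x + \<eta> x *\<^sub>R \<xi>" for x
  proof (rule df_eq)
    have "df (\<phi> (\<phi> x)) = - P (df x)"
      by (simp add: df_\<phi>' P_J P_P J_J)
    then show "df (\<phi> (\<phi> x)) = df (- x + \<eta> x *\<^sub>R \<xi>)"
      by (simp add: P_df df_simps)
  qed
  show "\<phi> \<xi> = 0"
    by (rule df_eq) (simp add: df_\<phi>' P_df_\<xi> df_simps J_simps)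
  show "\<eta> (\<phi> x) = 0" for x
    unfolding \<eta>_def[of "\<phi> x"] df_\<phi>' P_J[symmetric] P_orth by simp
  show "\<eta> x = g x \<xi>" for x
    by (simp add: g_def df_\<xi> g_simps df_N \<eta>_def)
  show "\<eta> \<xi> = 1" by (rule \<eta>_\<xi>)
  show "g (\<phi> x) y = g x (\<phi> y)" for x y
    by (simp add: g_def df_\<phi>' J_swap P_sym P_J)
qed

text \<open>As \<open>N\<close> is not orthogonal to itself it is not tangent, and by dimension it
  spans the whole space together with the tangent vectors. A tangent vector orthogonal to all of
  these is 0.\<close>

lemma gM_nondeg:
  assumes "\<And>y. g x y = 0"
  shows "x = 0"
proof -
  have "N \<notin> span (range df)"
  proof
    assume "N \<in> span (range df)"
    then obtain y where "N = df y"
      by (auto simp: span_eq_iff[THEN iffD2, OF linear_subspace_image[OF linear_df subspace_UNIV]])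
    then show False using df_N[of y] N_N by simp
  qed
  then have "dim (insert N (range df)) = DIM('f)"
    using dim_image_eq[OF linear_df, of UNIV] inj_df dim by (simp add: dim_insert)
  then have full: "span (insert N (range df)) = UNIV"
    by (simp add: dim_eq_full)
  have "df x = 0"
  proof (rule g_nondeg)
    fix v
    have "v \<in> span (insert N (range df))" using full by simp
    then show "g' (df x) v = 0"
      using assms by (induction rule: span_induct_alt) (auto simp: g_simps df_N g_def)
  qed
  then show ?thesis
    by (intro df_eq) (simp add: df_simps)
qed

text \<open>The equation of Gauss for the \<open>J\<close>-invariant distribution \<open>ker \<eta>\<close>.\<close>

lemma gauss_equation:
  assumes R: "\<And>x y z u. g' (R x y z) u = \<nu> * (pi1 g' x y z u - pi2 g' J x y z u) + \<nu>t * pi3 g' J x y z u"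
    and \<kappa>: "df \<kappa> = P (R (df x) (df y) s)
      + (\<alpha>y *\<^sub>R P (df (S x)) + \<beta>y *\<^sub>R J (P (df (S x)))) - (\<alpha>x *\<^sub>R P (df (S y)) + \<beta>x *\<^sub>R J (P (df (S y))))"
    and s: "s = P (df z)"
    and \<alpha>y: "\<alpha>y = C * C * (m * g' s (J (df (S y))) - g' s (df (S y)))"
    and \<beta>y: "\<beta>y = C * C * (m * g' s (df (S y)) + g' s (J (df (S y))))"
    and \<alpha>x: "\<alpha>x = C * C * (m * g' s (J (df (S x))) - g' s (df (S x)))"
    and \<beta>x: "\<beta>x = C * C * (m * g' s (df (S x)) + g' s (J (df (S x))))"
  shows "g \<kappa> u = (\<nu> * M.E1 x y z u + \<nu>t * M.E3 x y z u)
    - C * (C * M.E1 (S x) (S y) z u + C * m * M.E3 (S x) (S y) z u)"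
proof -
  \<comment> \<open>Only the last two arguments are projected. This suffices, since every product in
    \<open>pi1\<close>, \<open>pi2\<close>, \<open>pi3\<close> pairs one of the first two arguments
    with one of the last two.\<close>
  have Rt: "g' (R (df x) (df y) s) (P (df u)) = \<nu> * M.E1 x y z u + \<nu>t * M.E3 x y z u"
    unfolding R pi1_def pi2_def pi3_def s g_df_P M.E1_def M.E3_def pi4_def pi5_def
    by (simp add: algebra_simps)
  have sS: "g' s (df w) = g (M.H w) z" "g' s (J (df w)) = g (\<phi> w) z" for w
    using g_df_P[of w z] g_sym[of s] J_swap[of "df w" s] by (simp_all add: s M.g_H M.\<phi>_g)
  have Su: "g' (P (df w)) (df u) = g (M.H w) u" "g' (J (P (df w))) (df u) = g (\<phi> w) u" for w
    using g_df_P(1)[of w u] by (simp add: P_sym M.g_H, simp add: g_def df_\<phi>')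
  have "g \<kappa> u = g' (R (df x) (df y) s) (P (df u))
      + (\<alpha>y * g' (P (df (S x))) (df u) + \<beta>y * g' (J (P (df (S x)))) (df u))
      - (\<alpha>x * g' (P (df (S y))) (df u) + \<beta>x * g' (J (P (df (S y)))) (df u))"
    by (simp add: g_def[of \<kappa>] \<kappa> g_simps P_sym)
  also have "\<dots> = (\<nu> * M.E1 x y z u + \<nu>t * M.E3 x y z u)
    - C * (C * M.E1 (S x) (S y) z u + C * m * M.E3 (S x) (S y) z u)"
    unfolding Rt Su \<alpha>y \<beta>y \<alpha>x \<beta>x sS M.E1_eq M.E3_eq by (simp add: algebra_simps)
  finally show ?thesis .
qed

end

section \<open>Hypersurfaces of Kaehler manifolds with Norden metric\<close>

lemma smooth_on_det:
  fixes M :: "'a::real_normed_vector \<Rightarrow> real ^ 'k ^ 'k"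
  assumes "open U" "\<And>i j. smooth_on U (\<lambda>u. M u $ i $ j)"
  shows "smooth_on U (\<lambda>u. det (M u))"
  unfolding det_def
  by (intro smooth_on_sum[OF assms(1)] smooth_on_mult[OF assms(1) smooth_on_const] smooth_on_prod[OF assms(1)] assms(2))

text \<open>Cramer's rule exhibits the components of \<open>x\<close>, whose regularity is unknown,
  as quotients of determinants with smooth entries.\<close>

lemma smooth_on_solution:
  fixes M :: "'a::real_normed_vector \<Rightarrow> real ^ 'k ^ 'k"
  assumes U: "open U" and M: "\<And>i j. smooth_on U (\<lambda>u. M u $ i $ j)" and d: "\<And>u. u \<in> U \<Longrightarrow> det (M u) \<noteq> 0"
    and y: "\<And>i. smooth_on U (\<lambda>u. (M u *v x u) $ i)"
  shows "smooth_on U x"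
proof (rule smooth_on_components[OF U])
  fix b :: "real ^ 'k" assume "b \<in> Basis"
  then obtain k where b: "b = axis k 1"
    by (auto simp: Basis_vec_def)
  let ?M = "\<lambda>u. \<chi> i j. if j = k then (M u *v x u) $ i else M u $ i $ j"
  have "smooth_on U (\<lambda>u. det (?M u) * inverse (det (M u)))"
  proof (intro smooth_on_mult[OF U] smooth_on_inverse[OF U] smooth_on_det[OF U] M d)
    show "smooth_on U (\<lambda>u. ?M u $ i $ j)" for i j
      using M y by (cases "j = k") simp_all
  qed
  then show "smooth_on U (\<lambda>u. x u \<bullet> b)"
  proof (rule smooth_on_cong[OF U, rotated])
    fix u assume u: "u \<in> U"
    have "x u = (\<chi> k. det (\<chi> i j. if j = k then (M u *v x u) $ i else M u $ i $ j) / det (M u))"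
      using cramer[OF d[OF u], of "x u" "M u *v x u"] by simp
    then have "x u $ k = det (?M u) / det (M u)"
      by (metis (no_types, lifting) vec_lambda_beta)
    then show "det (?M u) * inverse (det (M u)) = x u \<bullet> b"
      by (simp add: b inner_axis divide_inverse)
  qed
qed

locale norden_hypersurface = B: kaehler_norden_manifold B J g' nabla'
  for B :: "('n::{t2_space,second_countable_topology}, 'f::euclidean_space) chart set"
    and J and g' and nabla' +
  fixes A :: "('m::{t2_space,second_countable_topology}, real ^ 'k) chart set"
    and f N \<phi> \<xi> \<eta> g nabla S
  assumes hypersurface: "timelike_hypersurface A B g' f N"
    and induced: "induced_structure A B J g' f N \<phi> \<xi> \<eta> g"
    and levi_civita_g: "levi_civita A g nabla"
    and gauss_weingarten: "second_fundamental_tensor A B nabla' f N g nabla S"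
begin

sublocale A: levi_civita_manifold A nabla g
  using hypersurface levi_civita_g
  by unfold_locales (auto simp: timelike_hypersurface_def levi_civita_def)

sublocale map_to_affine_manifold A B f nabla'
  using hypersurface by unfold_locales (auto simp: timelike_hypersurface_def immersion_def)

abbreviation df :: "'m \<Rightarrow> real ^ 'k \<Rightarrow> 'f" where "df \<equiv> tmap A B f"
abbreviation JN :: "'m \<Rightarrow> 'f" where "JN q \<equiv> J (f q) (N q)"
abbreviation cov :: "('m \<Rightarrow> 'f) \<Rightarrow> 'm \<Rightarrow> real ^ 'k \<Rightarrow> 'f" where "cov \<equiv> cov_deriv_along A B nabla' f"

definition m :: "'m \<Rightarrow> real" where "m q = g' (f q) (N q) (JN q)"
definition C :: "'m \<Rightarrow> real" where "C q = cos (arctan (m q))"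

lemma linear_df: "linear (df q)"
proof -
  let ?c = "chart_at A q" and ?d = "chart_at B (f q)"
  let ?F = "\<lambda>u. cmap ?d (f (cinv ?c u))"
  note c = A.chart_at[of q] and d = B.chart_at[of "f q"]
  have "df q v = dd ?F (cmap ?c q) v" for v
    using tcoord_tmap[OF c(1) d(1) c(2) d(2), of v] by (simp add: A.tcoord_self B.tcoord_self)
  moreover have "linear (dd ?F (cmap ?c q))"
    using smooth_onD[OF smooth_coords[OF c(1) d(1) order_refl]] c d by (intro linear_dd) auto
  ultimately show ?thesis by (simp add: linear_iff)
qed

lemma cos_sin_m: "cos (hyp_angle J g' f N q) = C q" "sin (hyp_angle J g' f N q) = C q * m q"
    "C q * C q * (1 + m q * m q) = 1"
proof -
  have c: "cos (arctan (m q)) \<noteq> 0"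
    by (rule cos_arctan_not_zero)
  show "cos (hyp_angle J g' f N q) = C q"
    by (simp add: hyp_angle_def C_def m_def)
  show "sin (hyp_angle J g' f N q) = C q * m q"
    using c tan_arctan[of "m q"] by (simp add: hyp_angle_def C_def tan_def divide_simps m_def[symmetric] mult.commute)
  show "C q * C q * (1 + m q * m q) = 1"
    using tan_sec[OF c] c by (simp add: C_def tan_arctan power2_eq_square divide_simps mult.commute)
qed

sublocale H: norden_hyperplane "g' (f q)" "J (f q)" "df q" "N q" "C q" "m q" "\<phi> q" "\<xi> q" "\<eta> q" "g q" for q
proof (intro norden_hyperplane.intro norden_hyperplane_axioms.intro B.norden_space linear_df cos_sin_m)
  show "inj (df q)" "DIM('f) = DIM(real ^ 'k) + 1" "g' (f q) (N q) (N q) = - 1" "g' (f q) (df q x) (N q) = 0" for x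
    using hypersurface by (auto simp: timelike_hypersurface_def immersion_def)
  show "g' (f q) (N q) (JN q) = m q"
    by (simp add: m_def)
  show "df q (\<phi> q x) = J (f q) (df q x)
      + (C q * g' (f q) (df q x) (JN q)) *\<^sub>R (C q *\<^sub>R N q - (C q * m q) *\<^sub>R JN q)"
    "df q (\<xi> q) = (C q * m q) *\<^sub>R N q + C q *\<^sub>R JN q"
    "\<eta> q x = C q * g' (f q) (df q x) (JN q)" "g q x y = g' (f q) (df q x) (df q y)" for x y
    using induced unfolding induced_structure_def Let_def by (auto simp: cos_sin_m)
qed

lemma gauss:
  assumes "open W" "smooth_vf_on A W X" "smooth_vf_on A W Y" "q \<in> W"
  shows "cov (\<lambda>r. df r (Y r)) q (X q) = df q (nabla X Y q) - g q (S q (X q)) (Y q) *\<^sub>R N q"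
  using gauss_weingarten assms by (simp add: second_fundamental_tensor_def)

lemma weingarten: "cov N q x = - df q (S q x)"
  using gauss_weingarten by (simp add: second_fundamental_tensor_def)

lemma smooth_N: "smooth_section_along A B f W N"
  using hypersurface smooth_section_along_subset[of A B f UNIV N W] by (simp add: timelike_hypersurface_def)

end

section \<open>Calculus of sections along the hypersurface in fixed charts\<close>

locale hypersurface_chart = norden_hypersurface B J g' nabla' A f N \<phi> \<xi> \<eta> g nabla S
  for B :: "('n::{t2_space,second_countable_topology}, 'f::euclidean_space) chart set"
    and J g' nabla'
    and A :: "('m::{t2_space,second_countable_topology}, real ^ 'k) chart set"
    and f N \<phi> \<xi> \<eta> g nabla S +
  fixes c d W
  assumes c: "c \<in> A" and d: "d \<in> B" and open_W: "open W" and W: "W \<subseteq> cdom c \<inter> f -` cdom d"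
begin

abbreviation "U \<equiv> cmap c ` W"
abbreviation "F u \<equiv> cmap d (f (cinv c u))"
abbreviation "sec s u \<equiv> tcoord B d (f (cinv c u)) (s (cinv c u))"
abbreviation "smooth_sec \<equiv> smooth_section_along A B f W"
abbreviation "smooth_vf \<equiv> smooth_vf_on A W"
abbreviation "smooth_fun \<equiv> smooth_fun_on A W"

lemma in_W: "q \<in> W \<Longrightarrow> q \<in> cdom c" "q \<in> W \<Longrightarrow> f q \<in> cdom d"
  "q \<in> W \<Longrightarrow> cinv c (cmap c q) = q" "q \<in> W \<Longrightarrow> cmap c q \<in> U"
  using W c A.cinv_cmap by auto

lemma tvec_W: "q \<in> W \<Longrightarrow> tcoord A c q (tvec A c q v) = v" "q \<in> W \<Longrightarrow> tvec A c q (tcoord A c q v) = v"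
  using A.tvec_change[OF c] in_W by simp_all

lemma cW: "c \<in> A" "open W" "W \<subseteq> cdom c"
  using c open_W W by auto

lemma open_U: "open U"
  by (rule A.open_cmap_image[OF cW])

sublocale KN: kaehler_norden_coords "cmap d ` cdom d" "B.christoffel d" "B.gc d" "B.Jc d"
  by (rule B.kaehler_norden_coords[OF d])

sublocale PB: pullback_connection "cmap d ` cdom d" "B.christoffel d" U F
  using in_W by unfold_locales (auto simp: open_U intro!: smooth_coords[OF c d W])

lemma smooth_sec_iff: "smooth_sec s \<longleftrightarrow> smooth_on U (sec s)"
  by (rule smooth_section_along_chart[OF c d open_W W])

lemma smooth_fun_iff: "smooth_fun h \<longleftrightarrow> smooth_on U (\<lambda>u. h (cinv c u))"
  using A.smooth_fun_on_chart[OF cW] by (simp add: o_def)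

lemma mderiv_eq: "smooth_fun h \<Longrightarrow> q \<in> W \<Longrightarrow>
    mderiv A h q v = dd (\<lambda>u. h (cinv c u)) (cmap c q) (tcoord A c q v)"
  using A.mderiv_chart[OF c, of q h v] A.smooth_fun_on_mderiv_differentiable[of W h c q] c in_W
  by (simp add: o_def)

lemma cov_coords: "smooth_sec s \<Longrightarrow> q \<in> W \<Longrightarrow>
    tcoord B d (f q) (cov s q v) = PB.nb (sec s) (tcoord A c q v) (cmap c q)"
  using cov_deriv_along_coords[OF c d open_W W, of q s v] in_W by (simp add: PB.nb_def)

lemma linear_tcoord: "q \<in> W \<Longrightarrow> linear (tcoord B d (f q))"
  using in_W by (intro B.linear_tcoord d)

lemma tcoord_inj: "q \<in> W \<Longrightarrow> tcoord B d (f q) x = tcoord B d (f q) y \<Longrightarrow> x = y"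
  using B.tvec_change(2)[OF d] in_W by metis

lemma sec_J: "u \<in> U \<Longrightarrow> sec (\<lambda>q. J (f q) (s q)) u = B.Jc d (F u) (sec s u)"
  using in_W by (auto simp: B.Jc_tcoord d)

lemma gc_sec: "u \<in> U \<Longrightarrow> B.gc d (F u) (sec s u) (sec r u) = g' (f (cinv c u)) (s (cinv c u)) (r (cinv c u))"
  using in_W by (auto simp: B.gc_tcoord d)

lemma sec_linear:
  assumes "u \<in> U"
  shows "sec (\<lambda>q. s q + r q) u = sec s u + sec r u" "sec (\<lambda>q. s q - r q) u = sec s u - sec r u"
    "sec (\<lambda>q. h q *\<^sub>R s q) u = h (cinv c u) *\<^sub>R sec s u"
proof -
  have "linear (tcoord B d (f (cinv c u)))"
    using assms in_W by (auto intro: linear_tcoord)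
  then show "sec (\<lambda>q. s q + r q) u = sec s u + sec r u" "sec (\<lambda>q. s q - r q) u = sec s u - sec r u"
    "sec (\<lambda>q. h q *\<^sub>R s q) u = h (cinv c u) *\<^sub>R sec s u"
    by (simp_all add: linear_add linear_diff linear_scale)
qed

lemma smooth_sec_add: "smooth_sec s \<Longrightarrow> smooth_sec r \<Longrightarrow> smooth_sec (\<lambda>q. s q + r q)"
  unfolding smooth_sec_iff
  by (rule smooth_on_cong[OF open_U sec_linear(1)[symmetric] smooth_on_add[OF open_U]])

lemma smooth_sec_diff: "smooth_sec s \<Longrightarrow> smooth_sec r \<Longrightarrow> smooth_sec (\<lambda>q. s q - r q)"
  unfolding smooth_sec_iff
  by (rule smooth_on_cong[OF open_U sec_linear(2)[symmetric] smooth_on_diff[OF open_U]])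

lemma smooth_sec_scaleR: "smooth_fun h \<Longrightarrow> smooth_sec s \<Longrightarrow> smooth_sec (\<lambda>q. h q *\<^sub>R s q)"
  unfolding smooth_sec_iff smooth_fun_iff
  by (rule smooth_on_cong[OF open_U sec_linear(3)[symmetric] smooth_on_scaleR[OF open_U]])

lemma smooth_sec_J: "smooth_sec s \<Longrightarrow> smooth_sec (\<lambda>q. J (f q) (s q))"
  unfolding smooth_sec_iff
  by (rule smooth_on_cong[OF open_U sec_J[symmetric]
        PB.smooth_pullback_linear[OF KN.linear_J KN.smooth_J KN.parallel_J]])

lemma smooth_fun_g': "smooth_sec s \<Longrightarrow> smooth_sec r \<Longrightarrow> smooth_fun (\<lambda>q. g' (f q) (s q) (r q))"
  unfolding smooth_sec_iff smooth_fun_iff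
  by (rule smooth_on_cong[OF open_U gc_sec PB.smooth_pullback_bilinear[OF KN.bilinear_G KN.smooth_G]])

lemma smooth_fun_mult:
  fixes h k :: "'m \<Rightarrow> real"
  shows "smooth_fun h \<Longrightarrow> smooth_fun k \<Longrightarrow> smooth_fun (\<lambda>q. h q * k q)"
  unfolding smooth_fun_iff by (rule smooth_on_mult[OF open_U])

lemma smooth_fun_add:
  fixes h k :: "'m \<Rightarrow> real"
  shows "smooth_fun h \<Longrightarrow> smooth_fun k \<Longrightarrow> smooth_fun (\<lambda>q. h q + k q)"
  unfolding smooth_fun_iff by (rule smooth_on_add[OF open_U])

lemma smooth_fun_diff:
  fixes h k :: "'m \<Rightarrow> real"
  shows "smooth_fun h \<Longrightarrow> smooth_fun k \<Longrightarrow> smooth_fun (\<lambda>q. h q - k q)"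
  unfolding smooth_fun_iff by (rule smooth_on_diff[OF open_U])

lemma smooth_fun_m: "smooth_fun m"
  unfolding m_def[abs_def] by (rule smooth_fun_g'[OF smooth_N smooth_sec_J[OF smooth_N]])

lemma smooth_fun_C: "smooth_fun C"
  using smooth_on_cos_arctan[OF open_U smooth_fun_m[unfolded smooth_fun_iff]]
  by (simp add: smooth_fun_iff C_def)

lemma smooth_sec_cong: "(\<And>q. q \<in> W \<Longrightarrow> s q = r q) \<Longrightarrow> smooth_sec s \<Longrightarrow> smooth_sec r"
  unfolding smooth_sec_iff by (rule smooth_on_cong[OF open_U]) (auto simp: in_W)

lemma cov_cong:
  assumes "\<And>q. q \<in> W \<Longrightarrow> s q = r q" "smooth_sec s" "q \<in> W"
  shows "cov s q v = cov r q v"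
proof (rule tcoord_inj[OF assms(3)])
  have "smooth_sec r"
    using assms(1,2) by (rule smooth_sec_cong)
  moreover have "PB.nb (sec s) (tcoord A c q v) (cmap c q) = PB.nb (sec r) (tcoord A c q v) (cmap c q)"
    by (rule PB.nb_cong) (use assms in \<open>auto simp: in_W\<close>)
  ultimately show "tcoord B d (f q) (cov s q v) = tcoord B d (f q) (cov r q v)"
    using assms by (simp add: cov_coords)
qed

lemma cov_diff:
  assumes s: "smooth_sec s" and r: "smooth_sec r" and q: "q \<in> W"
  shows "cov (\<lambda>q. s q - r q) q v = cov s q v - cov r q v"
proof (rule tcoord_inj[OF q])
  let ?v = "tcoord A c q v"
  have "PB.nb (sec (\<lambda>q. s q - r q)) ?v (cmap c q) = PB.nb (\<lambda>u. sec s u - sec r u) ?v (cmap c q)"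
    by (rule PB.nb_cong[OF sec_linear(2) in_W(4)[OF q]])
  also have "\<dots> = PB.nb (sec s) ?v (cmap c q) - PB.nb (sec r) ?v (cmap c q)"
    using s r q by (intro PB.nb_diff) (auto simp: smooth_sec_iff)
  finally show "tcoord B d (f q) (cov (\<lambda>q. s q - r q) q v) = tcoord B d (f q) (cov s q v - cov r q v)"
    using s r q by (simp add: cov_coords smooth_sec_diff linear_diff[OF linear_tcoord])
qed

lemma cov_scaleR:
  assumes h: "smooth_fun h" and s: "smooth_sec s" and q: "q \<in> W"
  shows "cov (\<lambda>q. h q *\<^sub>R s q) q v = mderiv A h q v *\<^sub>R s q + h q *\<^sub>R cov s q v"
proof (rule tcoord_inj[OF q])
  let ?v = "tcoord A c q v"
  have "PB.nb (sec (\<lambda>q. h q *\<^sub>R s q)) ?v (cmap c q) = PB.nb (\<lambda>u. h (cinv c u) *\<^sub>R sec s u) ?v (cmap c q)"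
    by (rule PB.nb_cong[OF sec_linear(3) in_W(4)[OF q]])
  also have "\<dots> = dd (\<lambda>u. h (cinv c u)) (cmap c q) ?v *\<^sub>R sec s (cmap c q)
      + h (cinv c (cmap c q)) *\<^sub>R PB.nb (sec s) ?v (cmap c q)"
    using h s q by (intro PB.nb_scaleR) (auto simp: smooth_sec_iff smooth_fun_iff)
  finally show "tcoord B d (f q) (cov (\<lambda>q. h q *\<^sub>R s q) q v)
      = tcoord B d (f q) (mderiv A h q v *\<^sub>R s q + h q *\<^sub>R cov s q v)"
    using h s q linear_tcoord[OF q]
    by (simp add: cov_coords smooth_sec_scaleR linear_add linear_scale mderiv_eq in_W)
qed

lemma cov_J:
  assumes s: "smooth_sec s" and q: "q \<in> W"
  shows "cov (\<lambda>q. J (f q) (s q)) q v = J (f q) (cov s q v)"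
proof (rule tcoord_inj[OF q])
  let ?v = "tcoord A c q v"
  have "PB.nb (sec (\<lambda>q. J (f q) (s q))) ?v (cmap c q) = PB.nb (\<lambda>u. B.Jc d (F u) (sec s u)) ?v (cmap c q)"
    by (rule PB.nb_cong[OF sec_J in_W(4)[OF q]])
  also have "\<dots> = B.Jc d (F (cmap c q)) (PB.nb (sec s) ?v (cmap c q))"
    using s q by (intro PB.nb_parallel_endo[OF KN.linear_J KN.smooth_J KN.parallel_J]) (auto simp: smooth_sec_iff)
  finally show "tcoord B d (f q) (cov (\<lambda>q. J (f q) (s q)) q v) = tcoord B d (f q) (J (f q) (cov s q v))"
    using s q B.Jc_tcoord[OF d in_W(2)[OF q], of "cov s q v"] by (simp add: cov_coords smooth_sec_J in_W)
qed

lemma cov_metric: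
  assumes s: "smooth_sec s" and r: "smooth_sec r" and q: "q \<in> W"
  shows "mderiv A (\<lambda>q. g' (f q) (s q) (r q)) q v = g' (f q) (cov s q v) (r q) + g' (f q) (s q) (cov r q v)"
proof -
  let ?v = "tcoord A c q v"
  have "mderiv A (\<lambda>q. g' (f q) (s q) (r q)) q v
      = dd (\<lambda>u. g' (f (cinv c u)) (s (cinv c u)) (r (cinv c u))) (cmap c q) ?v"
    by (rule mderiv_eq[OF smooth_fun_g'[OF s r] q])
  also have "\<dots> = dd (\<lambda>u. B.gc d (F u) (sec s u) (sec r u)) (cmap c q) ?v"
    by (rule dd_cong_open[OF open_U in_W(4)[OF q] gc_sec[symmetric]])
  also have "\<dots> = B.gc d (F (cmap c q)) (PB.nb (sec s) ?v (cmap c q)) (sec r (cmap c q))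
      + B.gc d (F (cmap c q)) (sec s (cmap c q)) (PB.nb (sec r) ?v (cmap c q))"
    using s r q by (intro PB.dd_parallel_form[OF KN.bilinear_G KN.smooth_G KN.parallel_G])
      (auto simp: smooth_sec_iff)
  finally show ?thesis
    using s r q in_W by (simp add: cov_coords[symmetric] B.gc_tcoord d)
qed

lemma linear_cov:
  assumes s: "smooth_sec s" and q: "q \<in> W"
  shows "linear (cov s q)"
proof -
  have "cov s q = (\<lambda>v. tvec B d (f q) (PB.nb (sec s) (tcoord A c q v) (cmap c q)))"
    using B.tvec_change(2)[OF d in_W(2)[OF q]] cov_coords[OF s q] by (metis ext)
  moreover have "linear (\<lambda>v. tvec B d (f q) (PB.nb (sec s) (tcoord A c q v) (cmap c q)))"
    using q s by (intro linear_comp[OF A.linear_tcoord[OF c in_W(1)[OF q]]]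
        linear_comp[OF PB.linear_nb B.linear_tvec[OF d in_W(2)[OF q]]]) (auto simp: smooth_sec_iff)
  ultimately show ?thesis by simp
qed

lemma sec_df: "u \<in> U \<Longrightarrow> sec (\<lambda>q. df q (X q)) u = dd F u (A.coords c X u)"
  using in_W by (auto simp: tcoord_tmap[OF c d])

lemma smooth_sec_df: "smooth_vf X \<Longrightarrow> smooth_sec (\<lambda>q. df q (X q))"
  unfolding smooth_sec_iff A.smooth_vf_on_chart[OF cW]
  by (rule smooth_on_cong[OF open_U sec_df[symmetric] smooth_on_linear_family[OF open_U
          linear_dd[OF smooth_onD[OF PB.smooth_F]] smooth_on_dd[OF PB.smooth_F]]])

text \<open>Pairing the smooth section \<open>df X\<close> with the images of the coordinate vectors
  gives a linear system for the components of \<open>X\<close>. Its matrix is the Gram matrix of the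
  induced metric, invertible by \<open>H.gM_nondeg\<close>.\<close>

lemma smooth_vf_of_df:
  assumes "smooth_sec (\<lambda>q. df q (X q))"
  shows "smooth_vf X"
  unfolding A.smooth_vf_on_chart[OF cW]
proof (rule smooth_on_solution[OF open_U])
  let ?M = "\<lambda>u. \<chi> i j. B.gc d (F u) (dd F u (axis i 1)) (dd F u (axis j 1))"
  have F: "smooth_on U (\<lambda>u. dd F u v)" for v
    by (rule smooth_on_dd[OF PB.smooth_F])
  show "smooth_on U (\<lambda>u. ?M u $ i $ j)" for i j
    using PB.smooth_pullback_bilinear[OF KN.bilinear_G KN.smooth_G F F] by simp
  have row: "(?M u *v x) $ i = B.gc d (F u) (dd F u (axis i 1)) (dd F u x)" if u: "u \<in> U" for u x i
  proof -
    have "bilinear (B.gc d (F u))"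
      using u in_W by (intro KN.bilinear_G) auto
    then have "linear (\<lambda>x. B.gc d (F u) (dd F u (axis i 1)) (dd F u x))"
      using linear_comp[OF linear_dd[OF smooth_onD[OF PB.smooth_F u]],
          of "\<lambda>y. B.gc d (F u) (dd F u (axis i 1)) y"] by (auto simp: bilinear_def)
    from linear_axis_expand[OF this, of x] show ?thesis
      by (simp add: matrix_vector_mult_def mult.commute)
  qed
  show "smooth_on U (\<lambda>u. (?M u *v A.coords c X u) $ i)" for i
  proof (rule smooth_on_cong[OF open_U _ PB.smooth_pullback_bilinear[OF KN.bilinear_G KN.smooth_G F
          assms[unfolded smooth_sec_iff]]])
    show "B.gc d (F u) (dd F u (axis i 1)) (sec (\<lambda>q. df q (X q)) u) = (?M u *v A.coords c X u) $ i"
      if "u \<in> U" for u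
      unfolding row[OF that] sec_df[OF that] ..
  qed
  show "det (?M u) \<noteq> 0" if u: "u \<in> U" for u
  proof -
    obtain q where q: "q \<in> W" "u = cmap c q" using u by blast
    have "x = 0" if x: "?M u *v x = 0" for x
    proof -
      have gM: "B.gc d (F u) (dd F u y) (dd F u x) = g q (tvec A c q y) (tvec A c q x)" for x y
      proof -
        have "dd F u y = tcoord B d (f q) (df q (tvec A c q y))" for y
          using tcoord_tmap[OF c d in_W(1,2)[OF q(1)]] tvec_W(1)[OF q(1)] q(2) by simp
        then show ?thesis
          using B.gc_tcoord[OF d in_W(2)[OF q(1)]] q in_W by (simp add: H.g_def)
      qed
      have lin: "linear (\<lambda>y. g q (tvec A c q y) (tvec A c q x))"
        using H.M.bilinear_gM[of q] linear_comp[OF A.linear_tvec[OF c in_W(1)[OF q(1)]],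
            of "\<lambda>y. g q y (tvec A c q x)"] by (simp add: bilinear_def)
      have "g q (tvec A c q (axis i 1)) (tvec A c q x) = 0" for i
        using row[OF u, of x i] x gM[of "axis i 1" x] by simp
      then have "g q (tvec A c q y) (tvec A c q x) = 0" for y
        using linear_axis_expand[OF lin, of y] by simp
      then have "g q (tvec A c q x) z = 0" for z
        using tvec_W(2)[OF q(1), of z] H.M.gM_sym[of q z "tvec A c q x"] by metis
      then have "tvec A c q x = 0"
        by (rule H.gM_nondeg)
      then show "x = 0"
        using tvec_W(1)[OF q(1), of x] linear_0[OF A.linear_tcoord[OF c in_W(1)[OF q(1)]]]
        by simp
    qed
    then show ?thesis
      unfolding invertible_det_nz[symmetric] invertible_left_inverse matrix_left_invertible_ker
      by (intro allI impI)
  qed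
qed

lemma smooth_fun_\<alpha>\<beta>:
  assumes "smooth_sec s"
  shows "smooth_fun (\<lambda>q. H.\<alpha> q (s q))" "smooth_fun (\<lambda>q. H.\<beta> q (s q))"
  unfolding H.\<alpha>_def H.\<beta>_def
  by (intro smooth_fun_mult smooth_fun_diff smooth_fun_add smooth_fun_C smooth_fun_m smooth_fun_g' assms smooth_N
      smooth_sec_J)+

lemma smooth_sec_P: "smooth_sec s \<Longrightarrow> smooth_sec (\<lambda>q. H.P q (s q))"
  unfolding H.P_def
  by (intro smooth_sec_diff smooth_sec_scaleR smooth_fun_\<alpha>\<beta> smooth_N smooth_sec_J)

lemma smooth_fun_\<eta>: "smooth_vf X \<Longrightarrow> smooth_fun (\<lambda>q. \<eta> q (X q))"
  unfolding H.\<eta>_def by (intro smooth_fun_mult smooth_fun_C smooth_fun_g' smooth_sec_df smooth_sec_J smooth_N)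

lemma smooth_vf_\<xi>: "smooth_vf \<xi>"
  by (rule smooth_vf_of_df, unfold H.df_\<xi>)
    (intro smooth_sec_add smooth_sec_scaleR smooth_fun_mult smooth_fun_C smooth_fun_m smooth_N smooth_sec_J)

lemma smooth_vf_\<phi>: "smooth_vf X \<Longrightarrow> smooth_vf (\<lambda>q. \<phi> q (X q))"
  by (rule smooth_vf_of_df, unfold H.df_\<phi>') (intro smooth_sec_J smooth_sec_P smooth_sec_df)


section \<open>The canonical connection and its curvature\<close>

abbreviation "D \<equiv> canonical_connection A \<phi> \<xi> \<eta> nabla"
abbreviation "E v q \<equiv> tvec A c q v"

text \<open>On the distribution \<open>ker \<eta>\<close>, which is \<open>J\<close>-invariant, the canonical connection is the
  orthogonal projection of the ambient connection; and \<open>\<xi>\<close> is parallel for it.\<close>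

lemma df_canonical_connection:
  assumes X: "smooth_vf X" and Y: "smooth_vf Y" and q: "q \<in> W"
  shows "df q (D X Y q) = H.P q (cov (\<lambda>r. H.P r (df r (Y r))) q (X q))
    + mderiv A (\<lambda>r. \<eta> r (Y r)) q (X q) *\<^sub>R df q (\<xi> q)"
proof -
  define e where "e = (\<lambda>r. \<eta> r (Y r))"
  define h where "h = (\<lambda>r. Y r - e r *\<^sub>R \<xi> r)"
  define a where "a = nabla X h q"
  define b where "b = nabla X (\<lambda>r. \<phi> r (Y r)) q"
  define e' where "e' = mderiv A e q (X q)"
  define \<kappa> where "\<kappa> = cov (\<lambda>r. df r (h r)) q (X q)"
  have e: "smooth_fun e"
    unfolding e_def by (rule smooth_fun_\<eta>[OF Y])
  have e\<xi>: "smooth_vf (\<lambda>r. e r *\<^sub>R \<xi> r)"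
    by (rule A.smooth_vf_on_scaleR[OF cW e smooth_vf_\<xi>])
  have h: "smooth_vf h"
    unfolding h_def by (rule A.smooth_vf_on_diff[OF cW Y e\<xi>])
  have P: "H.P r (df r (Y r)) = df r (h r)" for r
    by (simp add: H.P_df h_def e_def H.df_simps)
  have Pa: "H.P q \<kappa> = H.P q (df q a)"
    unfolding \<kappa>_def a_def gauss[OF open_W X h q] by (simp add: H.P_simps H.P_N)
  \<comment> \<open>\<open>J\<close> commutes with the ambient derivative and with
    \<open>H.P\<close>, and \<open>H.P\<close> kills the normal term of Gauss' formula. Hence
    \<open>\<phi> b\<close> involves \<open>J\<close> twice, which gives the minus sign.\<close>
  have P\<phi>: "df q (\<phi> q b) = - H.P q \<kappa>"
  proof -
    have "J (f q) \<kappa> = cov (\<lambda>r. df r (\<phi> r (Y r))) q (X q)"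
      unfolding \<kappa>_def H.df_\<phi>' P by (rule cov_J[OF smooth_sec_df[OF h] q, symmetric])
    then have "H.P q (J (f q) \<kappa>) = H.P q (df q b)"
      unfolding b_def gauss[OF open_W X smooth_vf_\<phi>[OF Y] q] by (simp add: H.P_simps H.P_N)
    then have "H.P q (df q b) = J (f q) (H.P q \<kappa>)"
      by (simp add: H.P_J)
    then show ?thesis
      by (simp add: H.df_\<phi>' H.J_J)
  qed
  have nY: "nabla X Y q = a + e' *\<^sub>R \<xi> q + e q *\<^sub>R nabla X \<xi> q"
  proof -
    have "nabla X Y q = nabla X (\<lambda>r. h r + e r *\<^sub>R \<xi> r) q"
      by (simp add: h_def)
    also have "\<dots> = a + nabla X (\<lambda>r. e r *\<^sub>R \<xi> r) q"
      unfolding a_def by (rule A.nabla_add_right[OF open_W X h e\<xi> q])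
    finally show ?thesis
      by (simp add: A.nabla_scaleR_right[OF open_W e X smooth_vf_\<xi> q] e'_def)
  qed
  have n\<phi>\<phi>: "nabla X (\<lambda>r. \<phi> r (\<phi> r (Y r))) q = - a"
  proof -
    have "(\<lambda>r. \<phi> r (\<phi> r (Y r))) = (\<lambda>r. (- 1) *\<^sub>R h r)"
      by (simp add: H.M.\<phi>_\<phi> h_def e_def fun_eq_iff)
    moreover have "smooth_fun (\<lambda>r. - 1 :: real)"
      by (rule A.smooth_fun_on_locally_const[OF open_W]) simp
    ultimately show ?thesis
      using A.nabla_scaleR_right[OF open_W _ X h q, of "\<lambda>_. - 1"] by (simp add: a_def)
  qed
  have \<eta>\<xi>: "\<eta> q (nabla X \<xi> q) = 0"
  proof -
    have "g r (\<xi> r) (\<xi> r) = 1" for r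
      using H.M.\<eta>_g[of r "\<xi> r"] H.\<eta>_\<xi>[of r] by simp
    then show ?thesis
      using A.metric_compatible[OF open_W X smooth_vf_\<xi> smooth_vf_\<xi> q] H.M.gM_sym[of q "\<xi> q"]
      by (simp add: H.M.\<eta>_g)
  qed
  have \<eta>n: "\<eta> q (nabla X Y q) = \<eta> q a + e'"
    unfolding nY by (simp add: linear_add[OF H.M.linear_\<eta>] linear_scale[OF H.M.linear_\<eta>] \<eta>\<xi> H.\<eta>_\<xi>)
  have "D X Y q = a + e' *\<^sub>R \<xi> q + e q *\<^sub>R nabla X \<xi> q
      + (1 / 2) *\<^sub>R (- a - \<phi> q b + (e' - (\<eta> q a + e')) *\<^sub>R \<xi> q) - e q *\<^sub>R nabla X \<xi> q"
    unfolding canonical_connection_def Let_def n\<phi>\<phi> \<eta>n unfolding nY by (simp add: b_def e_def e'_def)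
  also have "\<dots> = (1 / 2) *\<^sub>R (a - \<eta> q a *\<^sub>R \<xi> q - \<phi> q b) + e' *\<^sub>R \<xi> q"
  proof -
    have "a = (1 / 2) *\<^sub>R a + (1 / 2) *\<^sub>R a"
      by (simp add: scaleR_add_left[symmetric])
    then show ?thesis
      by (simp add: algebra_simps)
  qed
  \<comment> \<open>The factor 1/2 of the canonical connection averages two expressions of one
    vector: \<open>H.P q (df q a)\<close> and \<open>- df q (\<phi> q b)\<close> both equal
    \<open>H.P q \<kappa>\<close>.\<close>
  finally have "df q (D X Y q) = (1 / 2) *\<^sub>R (H.P q (df q a) - df q (\<phi> q b)) + e' *\<^sub>R df q (\<xi> q)"
    by (simp add: H.df_simps H.P_df)
  also have "H.P q (df q a) - df q (\<phi> q b) = H.P q \<kappa> + H.P q \<kappa>"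
    by (simp add: Pa P\<phi>)
  also have "(1 / 2) *\<^sub>R (H.P q \<kappa> + H.P q \<kappa>) = H.P q \<kappa>"
    by (simp add: scaleR_add_right scaleR_add_left[symmetric])
  finally show ?thesis
    by (simp add: P \<kappa>_def e'_def e_def)
qed

lemma smooth_vf_E: "smooth_vf (E v)"
  using A.smooth_vf_on_subset[OF A.smooth_vf_on_tvec[OF c]] W by auto

lemma sec_cov: "smooth_sec s \<Longrightarrow> u \<in> U \<Longrightarrow> sec (\<lambda>r. cov s r (E y r)) u = PB.nb (sec s) y u"
  using in_W by (auto simp: cov_coords tvec_W)

lemma smooth_sec_cov: "smooth_sec s \<Longrightarrow> smooth_sec (\<lambda>r. cov s r (E y r))"
  unfolding smooth_sec_iff
  by (rule smooth_on_cong[OF open_U sec_cov[symmetric] PB.smooth_nb]) (simp_all add: smooth_sec_iff)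

lemma mderiv_E: "smooth_fun h \<Longrightarrow> u \<in> U \<Longrightarrow> mderiv A h (cinv c u) (E y (cinv c u)) = dd (\<lambda>u. h (cinv c u)) u y"
  using in_W by (auto simp: mderiv_eq tvec_W)

lemma smooth_fun_mderiv: "smooth_fun h \<Longrightarrow> smooth_fun (\<lambda>r. mderiv A h r (E y r))"
  unfolding smooth_fun_iff
  by (rule smooth_on_cong[OF open_U mderiv_E[symmetric] smooth_on_dd]) (simp_all add: smooth_fun_iff)

lemma mderiv_commute:
  fixes h :: "'m \<Rightarrow> real"
  assumes h: "smooth_fun h" and q: "q \<in> W"
  shows "mderiv A (\<lambda>r. mderiv A h r (E y r)) q (E x q) = mderiv A (\<lambda>r. mderiv A h r (E x r)) q (E y q)"
proof -
  have "mderiv A (\<lambda>r. mderiv A h r (E y r)) q (E x q)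
      = dd (\<lambda>u. dd (\<lambda>u. h (cinv c u)) u y) (cmap c q) x" for x y
  proof -
    have "mderiv A (\<lambda>r. mderiv A h r (E y r)) q (E x q)
        = dd (\<lambda>u. mderiv A h (cinv c u) (E y (cinv c u))) (cmap c q) x"
      using mderiv_E[OF smooth_fun_mderiv[OF h] in_W(4)[OF q]] in_W(3)[OF q] by simp
    also have "\<dots> = dd (\<lambda>u. dd (\<lambda>u. h (cinv c u)) u y) (cmap c q) x"
      by (rule dd_cong_open[OF open_U in_W(4)[OF q] mderiv_E[OF h]])
    finally show ?thesis .
  qed
  then show ?thesis
    using mixed_dd[OF open_U h[unfolded smooth_fun_iff] in_W(4)[OF q], of x y] by simp
qed

lemma smooth_vf_canonical_connection:
  assumes Y: "smooth_vf Y"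
  shows "smooth_vf (D (E y) Y)"
proof (rule smooth_vf_of_df, rule smooth_sec_cong[OF df_canonical_connection[OF smooth_vf_E Y, symmetric]])
  show "smooth_sec (\<lambda>q. H.P q (cov (\<lambda>r. H.P r (df r (Y r))) q (E y q))
    + mderiv A (\<lambda>r. \<eta> r (Y r)) q (E y q) *\<^sub>R df q (\<xi> q))"
    by (intro smooth_sec_add smooth_sec_P smooth_sec_cov smooth_sec_df Y smooth_sec_scaleR
        smooth_fun_mderiv smooth_fun_\<eta> smooth_vf_\<xi>)
qed

lemma cov_commutator:
  assumes s: "smooth_sec s" and q: "q \<in> W"
  shows "tcoord B d (f q) (cov (\<lambda>r. cov s r (E y r)) q (E x q) - cov (\<lambda>r. cov s r (E x r)) q (E y q))
    = KN.Rm (cmap d (f q)) (tcoord B d (f q) (df q (E x q))) (tcoord B d (f q) (df q (E y q))) (tcoord B d (f q) (s q))"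
proof -
  have ch: "tcoord A c q (E x q) = x" for x
    using tvec_W(1)[OF q] .
  have "tcoord B d (f q) (cov (\<lambda>r. cov s r (E y r)) q (E x q)) = PB.nb (PB.nb (sec s) y) x (cmap c q)" for x y
  proof -
    have "PB.nb (sec (\<lambda>r. cov s r (E y r))) x (cmap c q) = PB.nb (PB.nb (sec s) y) x (cmap c q)"
      by (rule PB.nb_cong[OF sec_cov[OF s] in_W(4)[OF q]])
    then show ?thesis
      using cov_coords[OF smooth_sec_cov[OF s] q, of y "E x q"] ch by simp
  qed
  then show ?thesis
    using PB.nb_commutator[OF s[unfolded smooth_sec_iff] in_W(4)[OF q], of y x] q
      tcoord_tmap[OF c d in_W(1,2)[OF q]] ch
    by (simp add: linear_diff[OF linear_tcoord[OF q]] in_W)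
qed

text \<open>Differentiating the normal part \<open>\<alpha> N + \<beta> JN\<close> and projecting,
  derivatives of the coefficients are lost with \<open>N\<close> and \<open>JN\<close>. What remains
  are the derivatives of \<open>N\<close> and \<open>JN\<close>, given by Weingarten's formula and
  parallelism of \<open>J\<close>; its minus sign cancels that of the subtraction.\<close>

lemma P_cov_P:
  assumes s: "smooth_sec s" and q: "q \<in> W"
  shows "H.P q (cov (\<lambda>r. H.P r (s r)) q v)
    = H.P q (cov s q v) + H.\<alpha> q (s q) *\<^sub>R H.P q (df q (S q v)) + H.\<beta> q (s q) *\<^sub>R J (f q) (H.P q (df q (S q v)))"
proof -
  note \<alpha>\<beta> = smooth_fun_\<alpha>\<beta>[OF s] and JN = smooth_sec_J[OF smooth_N]
  note 1 = smooth_sec_scaleR[OF \<alpha>\<beta>(1) smooth_N] and 2 = smooth_sec_scaleR[OF \<alpha>\<beta>(2) JN]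
  show ?thesis
    unfolding H.P_def[of _ "s _"] cov_diff[OF smooth_sec_diff[OF s 1] 2 q] cov_diff[OF s 1 q]
      cov_scaleR[OF \<alpha>\<beta>(1) smooth_N q] cov_scaleR[OF \<alpha>\<beta>(2) JN q] cov_J[OF smooth_N q] weingarten
    by (simp add: H.P_simps H.P_N H.J_simps H.P_J)
qed

text \<open>A projected section is orthogonal to \<open>N\<close> and \<open>JN\<close>;
  differentiating these two zero products shifts the derivative to the normals. This expresses the
  second fundamental form of ker \<eta> by \<open>S\<close>.\<close>

lemma cov_P_normal:
  assumes s: "smooth_sec s" and q: "q \<in> W"
  defines "\<sigma> \<equiv> \<lambda>r. H.P r (s r)"
  shows "g' (f q) (cov \<sigma> q v) (N q) = g' (f q) (\<sigma> q) (df q (S q v))"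
    and "g' (f q) (cov \<sigma> q v) (JN q) = g' (f q) (\<sigma> q) (J (f q) (df q (S q v)))"
proof -
  have \<sigma>: "smooth_sec \<sigma>"
    unfolding \<sigma>_def by (rule smooth_sec_P[OF s])
  show "g' (f q) (cov \<sigma> q v) (N q) = g' (f q) (\<sigma> q) (df q (S q v))"
    using cov_metric[OF \<sigma> smooth_N q, of v] by (simp add: \<sigma>_def H.P_orth weingarten H.g_simps)
  show "g' (f q) (cov \<sigma> q v) (JN q) = g' (f q) (\<sigma> q) (J (f q) (df q (S q v)))"
    using cov_metric[OF \<sigma> smooth_sec_J[OF smooth_N] q, of v]
    by (simp add: \<sigma>_def H.P_orth cov_J[OF smooth_N q] weingarten H.g_simps H.J_simps)
qed

text \<open>The counterpart of \<open>nabla_zero_left\<close> for \<open>D\<close>, checked summand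
  by summand because the axioms \<open>affine_connection\<close> have not been established for it.
  It disposes of the bracket term, which vanishes on \<open>W\<close> only.\<close>

lemma canonical_connection_zero:
  assumes L: "\<And>q. q \<in> W \<Longrightarrow> L q = 0" and Z: "smooth_vf Z" and q: "q \<in> W"
  shows "D L Z q = 0"
proof -
  have sL: "smooth_vf L"
    by (rule A.smooth_vf_on_cong[OF cW _ A.smooth_vf_on_zero[OF cW]]) (simp add: L)
  have "nabla L Y q = 0" if "smooth_vf Y" for Y
    by (rule A.nabla_zero_left[OF open_W _ sL that q]) (rule L)
  note n = this[OF Z] this[OF smooth_vf_\<phi>[OF Z]] this[OF smooth_vf_\<phi>[OF smooth_vf_\<phi>[OF Z]]] this[OF smooth_vf_\<xi>]
  have "linear (mderiv A (\<lambda>q. \<eta> q (Z q)) q)"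
    using A.linear_mderiv[OF c in_W(1)[OF q]]
      A.smooth_fun_on_mderiv_differentiable[OF smooth_fun_\<eta>[OF Z] c q in_W(1)[OF q]] by blast
  then show ?thesis
    unfolding canonical_connection_def Let_def n
    by (simp add: linear_0 L[OF q] linear_0[OF H.M.linear_\<phi>] linear_0[OF H.M.linear_\<eta>])
qed

text \<open>The formula for \<open>D\<close> is applied twice. The inner projection costs the
  correction of \<open>P_cov_P\<close>, which is the quadratic term of Gauss' equation; the
  \<xi>-components are mixed second derivatives of \<open>\<eta> (E z)\<close> and cancel.\<close>

lemma df_canonical_curvature:
  assumes q: "q \<in> W"
  defines "s \<equiv> \<lambda>z r. H.P r (df r (E z r))"
  shows "df q (curvature A D (E x) (E y) (E z) q)
    = H.P q (cov (\<lambda>r. cov (s z) r (E y r)) q (E x q) - cov (\<lambda>r. cov (s z) r (E x r)) q (E y q))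
      + (H.\<alpha> q (cov (s z) q (E y q)) *\<^sub>R H.P q (df q (S q (E x q)))
         + H.\<beta> q (cov (s z) q (E y q)) *\<^sub>R J (f q) (H.P q (df q (S q (E x q)))))
      - (H.\<alpha> q (cov (s z) q (E x q)) *\<^sub>R H.P q (df q (S q (E y q)))
         + H.\<beta> q (cov (s z) q (E x q)) *\<^sub>R J (f q) (H.P q (df q (S q (E y q)))))"
proof -
  let ?e = "\<lambda>r. \<eta> r (E z r)"
  let ?\<tau> = "\<lambda>y r. cov (s z) r (E y r)"
  have s: "smooth_sec (s z)"
    unfolding s_def by (intro smooth_sec_P smooth_sec_df smooth_vf_E)
  have e: "smooth_fun ?e"
    by (rule smooth_fun_\<eta>[OF smooth_vf_E])
  have DD: "df q (D (E x) (D (E y) (E z)) q) = H.P q (cov (?\<tau> y) q (E x q))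
      + (H.\<alpha> q (?\<tau> y q) *\<^sub>R H.P q (df q (S q (E x q))) + H.\<beta> q (?\<tau> y q) *\<^sub>R J (f q) (H.P q (df q (S q (E x q)))))
      + mderiv A (\<lambda>r. mderiv A ?e r (E y r)) q (E x q) *\<^sub>R df q (\<xi> q)" for x y
  proof -
    let ?W = "D (E y) (E z)"
    have W: "smooth_vf ?W"
      by (rule smooth_vf_canonical_connection[OF smooth_vf_E])
    have dfW: "df r (?W r) = H.P r (?\<tau> y r) + mderiv A ?e r (E y r) *\<^sub>R df r (\<xi> r)" if "r \<in> W" for r
      unfolding s_def by (rule df_canonical_connection[OF smooth_vf_E smooth_vf_E that])
    have 1: "H.P r (df r (?W r)) = H.P r (?\<tau> y r)" if "r \<in> W" for r
      by (simp add: dfW[OF that] H.P_simps H.P_P H.P_df_\<xi>)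
    have 2: "\<eta> r (?W r) = mderiv A ?e r (E y r)" if "r \<in> W" for r
      by (rule H.\<eta>_P[OF dfW[OF that]])
    have "df q (D (E x) ?W q) = H.P q (cov (\<lambda>r. H.P r (df r (?W r))) q (E x q))
        + mderiv A (\<lambda>r. \<eta> r (?W r)) q (E x q) *\<^sub>R df q (\<xi> q)"
      by (rule df_canonical_connection[OF smooth_vf_E W q])
    also have "cov (\<lambda>r. H.P r (df r (?W r))) q (E x q) = cov (\<lambda>r. H.P r (?\<tau> y r)) q (E x q)"
      by (rule cov_cong[OF 1 smooth_sec_P[OF smooth_sec_df[OF W]] q])
    also have "mderiv A (\<lambda>r. \<eta> r (?W r)) q (E x q) = mderiv A (\<lambda>r. mderiv A ?e r (E y r)) q (E x q)"
      by (rule A.mderiv_cong[OF open_W q 2])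
    finally show ?thesis
      by (simp add: P_cov_P[OF smooth_sec_cov[OF s] q])
  qed
  have "D (lie_bracket A (E x) (E y)) (E z) q = 0"
    by (rule canonical_connection_zero[OF _ smooth_vf_E q]) (simp add: A.lie_bracket_tvec[OF c] in_W)
  then show ?thesis
    unfolding curvature_def H.df_simps DD using mderiv_commute[OF e q, of y x]
    by (simp add: H.P_simps H.df_simps)
qed

text \<open>Linearity of \<open>S\<close> has to be derived: Weingarten's formula expresses
  \<open>df (S x)\<close> by the derivative of \<open>N\<close>, which is linear in the direction,
  and \<open>df\<close> is injective.\<close>

lemma linear_S:
  assumes q: "q \<in> W"
  shows "linear (S q)"
proof (rule linearI; rule H.df_eq[of q])
  have S: "df q (S q x) = - cov N q x" for x
    by (simp add: weingarten)
  note lin = linear_cov[OF smooth_N q]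
  show "df q (S q (x + y)) = df q (S q x + S q y)" for x y
    by (simp add: S H.df_simps linear_add[OF lin])
  show "df q (S q (k *\<^sub>R x)) = df q (k *\<^sub>R S q x)" for k x
    by (simp add: S H.df_simps linear_scale[OF lin])
qed

text \<open>On coordinate fields \<open>g (S v) w\<close> is the normal product of the ambient
  derivative of \<open>df w\<close> along \<open>v\<close>. In coordinates this is a second
  derivative of \<open>F\<close> plus a Christoffel term, both symmetric in \<open>v\<close> and
  \<open>w\<close>.\<close>

lemma S_sym:
  assumes q: "q \<in> W"
  shows "g q (S q x) y = g q x (S q y)"
proof -
  have "g q (S q (E v q)) (E w q) = g' (f q) (cov (\<lambda>r. df r (E w r)) q (E v q)) (N q)" for v w
    unfolding gauss[OF open_W smooth_vf_E smooth_vf_E q] by (simp add: H.g_simps H.df_N H.N_N)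
  moreover have "cov (\<lambda>r. df r (E w r)) q (E v q) = cov (\<lambda>r. df r (E v r)) q (E w q)" for v w
  proof (rule tcoord_inj[OF q])
    have "tcoord B d (f q) (cov (\<lambda>r. df r (E w r)) q (E v q))
        = dd (\<lambda>u. dd F u w) (cmap c q) v + B.christoffel d (F (cmap c q)) (dd F (cmap c q) v) (dd F (cmap c q) w)"
      for v w
    proof -
      have e: "sec (\<lambda>r. df r (E w r)) u = dd F u w" if "u \<in> U" for u
        using sec_df[OF that, of "E w"] that in_W by (auto simp: tvec_W)
      have "tcoord B d (f q) (cov (\<lambda>r. df r (E w r)) q (E v q)) = PB.nb (sec (\<lambda>r. df r (E w r))) v (cmap c q)"
        using cov_coords[OF smooth_sec_df[OF smooth_vf_E] q] tvec_W(1)[OF q] by simp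
      also have "\<dots> = PB.nb (\<lambda>u. dd F u w) v (cmap c q)"
        by (rule PB.nb_cong[OF e in_W(4)[OF q]])
      finally show ?thesis
        by (simp add: PB.nb_def)
    qed
    moreover have "F (cmap c q) \<in> cmap d ` cdom d"
      using q in_W by simp
    ultimately show "tcoord B d (f q) (cov (\<lambda>r. df r (E w r)) q (E v q))
        = tcoord B d (f q) (cov (\<lambda>r. df r (E v r)) q (E w q))"
      using mixed_dd[OF open_U PB.smooth_F in_W(4)[OF q], of v w] KN.\<Gamma>_sym by simp
  qed
  ultimately have "g q (S q (E v q)) (E w q) = g q (S q (E w q)) (E v q)" for v w
    by simp
  from this[of "tcoord A c q x" "tcoord A c q y"] show ?thesis
    using tvec_W(2)[OF q] H.M.gM_sym[of q "S q y" x] by simp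
qed

end

section \<open>The curvature formula at a point\<close>

context norden_hypersurface
begin

text \<open>The charts are those distinguished at \<open>p\<close> and \<open>f p\<close>, so that
  at these points components and vectors coincide and the fields \<open>E v\<close> are the
  extensions used by \<open>curvature_tensor\<close>.\<close>

lemma canonical_hypersurface_chart:
  "hypersurface_chart B J g' nabla' A f N \<phi> \<xi> \<eta> g nabla S (chart_at A p) (chart_at B (f p))
    (cdom (chart_at A p) \<inter> f -` cdom (chart_at B (f p)))"
  using open_Int[OF A.open_cdom[OF A.chart_at(1)] open_preimage[OF B.chart_at(1)]] A.chart_at(1) B.chart_at(1)
  by unfold_locales auto

lemma operator: "almost_contact_norden_operator (\<phi> p) (\<xi> p) (\<eta> p) (g p) (S p)"
proof -
  interpret hypersurface_chart B J g' nabla' A f N \<phi> \<xi> \<eta> g nabla S "chart_at A p" "chart_at B (f p)"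
    "cdom (chart_at A p) \<inter> f -` cdom (chart_at B (f p))"
    by (rule canonical_hypersurface_chart)
  have p: "p \<in> cdom (chart_at A p) \<inter> f -` cdom (chart_at B (f p))"
    using A.chart_at B.chart_at by auto
  show ?thesis
    using linear_S[OF p] S_sym[OF p] H.M.almost_contact_norden_axioms
    by (intro almost_contact_norden_operator.intro almost_contact_norden_operator_axioms.intro)
qed

lemma canonical_curvature_formula:
  assumes const: "const_totally_real_curv B J g' nabla' \<nu> \<nu>t" and dim: "DIM('f) > 2"
  shows "canonical_curvature A \<phi> \<xi> \<eta> g nabla p x y z u
    = (\<nu> (f p) * H.M.E1 p x y z u + \<nu>t (f p) * H.M.E3 p x y z u)
      - C p * (C p * H.M.E1 p (S p x) (S p y) z u + C p * m p * H.M.E3 p (S p x) (S p y) z u)"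
proof -
  let ?c = "chart_at A p" and ?d = "chart_at B (f p)"
  let ?W = "cdom ?c \<inter> f -` cdom ?d"
  interpret hypersurface_chart B J g' nabla' A f N \<phi> \<xi> \<eta> g nabla S ?c ?d ?W
    by (rule canonical_hypersurface_chart)
  have p: "p \<in> ?W"
    using A.chart_at B.chart_at by auto
  have Ep: "E v p = v" for v
    using A.tangent_ext_self[of p v] by (simp add: tangent_ext_def)
  let ?s = "\<lambda>r. H.P r (df r (E z r))"
  have s: "smooth_sec (\<lambda>r. df r (E z r))"
    by (rule smooth_sec_df[OF smooth_vf_E])
  let ?\<kappa> = "curvature A D (E x) (E y) (E z) p"
  have R: "cov (\<lambda>r. cov ?s r (E y r)) p x - cov (\<lambda>r. cov ?s r (E x r)) p y
      = B.curv (f p) (df p x) (df p y) (?s p)"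
    using cov_commutator[OF smooth_sec_P[OF s] p, of y x] by (simp only: B.tcoord_self Ep)
  have \<alpha>\<beta>: "H.\<alpha> p (cov ?s p v) = C p * C p * (m p * g' (f p) (?s p) (J (f p) (df p (S p v))) - g' (f p) (?s p) (df p (S p v)))"
    "H.\<beta> p (cov ?s p v) = C p * C p * (m p * g' (f p) (?s p) (df p (S p v)) + g' (f p) (?s p) (J (f p) (df p (S p v))))"
    for v
    by (simp_all only: H.\<alpha>_def H.\<beta>_def cov_P_normal[OF s p])
  have sp: "?s p = H.P p (df p z)"
    by (simp only: Ep)
  have "g p ?\<kappa> u = (\<nu> (f p) * H.M.E1 p x y z u + \<nu>t (f p) * H.M.E3 p x y z u)
      - C p * (C p * H.M.E1 p (S p x) (S p y) z u + C p * m p * H.M.E3 p (S p x) (S p y) z u)"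
    by (rule H.gauss_equation[where q = p and R = "B.curv (f p)" and S = "S p" and x = x and y = y and z = z
          and s = "?s p" and \<nu> = "\<nu> (f p)" and \<nu>t = "\<nu>t (f p)",
          OF B.curv_constant_totally_real[OF const dim] _ sp \<alpha>\<beta>(1)[of y] \<alpha>\<beta>(2)[of y] \<alpha>\<beta>(1)[of x] \<alpha>\<beta>(2)[of x]])
      (use df_canonical_curvature[OF p, of x y z] in \<open>simp only: Ep R\<close>)
  then show ?thesis
    by (simp add: canonical_curvature_def curvature_tensor_def tangent_ext_def)
qed

end

theorem proposition2p2:
  fixes n :: nat
    and B :: "('n::{t2_space,second_countable_topology}, real ^ 'l) chart set"
    and J :: "'n \<Rightarrow> real ^ 'l \<Rightarrow> real ^ 'l"
    and g' :: "'n \<Rightarrow> real ^ 'l \<Rightarrow> real ^ 'l \<Rightarrow> real"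
    and nabla' :: "('n \<Rightarrow> real ^ 'l) \<Rightarrow> ('n \<Rightarrow> real ^ 'l) \<Rightarrow> 'n \<Rightarrow> real ^ 'l"
    and \<nu> \<nu>t :: "'n \<Rightarrow> real"
    and A :: "('m::{t2_space,second_countable_topology}, real ^ 'k) chart set"
    and f :: "'m \<Rightarrow> 'n"
    and N :: "'m \<Rightarrow> real ^ 'l"
    and \<phi> :: "'m \<Rightarrow> real ^ 'k \<Rightarrow> real ^ 'k"
    and \<xi> :: "'m \<Rightarrow> real ^ 'k"
    and \<eta> :: "'m \<Rightarrow> real ^ 'k \<Rightarrow> real"
    and g :: "'m \<Rightarrow> real ^ 'k \<Rightarrow> real ^ 'k \<Rightarrow> real"
    and nabla :: "('m \<Rightarrow> real ^ 'k) \<Rightarrow> ('m \<Rightarrow> real ^ 'k) \<Rightarrow> 'm \<Rightarrow> real ^ 'k"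
    and S :: "'m \<Rightarrow> real ^ 'k \<Rightarrow> real ^ 'k"
    and K :: "'m \<Rightarrow> real ^ 'k \<Rightarrow> real ^ 'k \<Rightarrow> real ^ 'k \<Rightarrow> real ^ 'k \<Rightarrow> real"
    and t :: "'m \<Rightarrow> real"
    and a b :: "'m \<Rightarrow> real"
  assumes "n \<ge> 1" and "CARD('l) = 2 * n + 2" and "CARD('k) = 2 * n + 1"
    and "kaehler_norden B J g' nabla'"
    and "const_totally_real_curv B J g' nabla' \<nu> \<nu>t"
    and "timelike_hypersurface A B g' f N"
    and "t = hyp_angle J g' f N"
    and "induced_structure A B J g' f N \<phi> \<xi> \<eta> g"
    and "levi_civita A g nabla"
    and "second_fundamental_tensor A B nabla' f N g nabla S"
    and "K = canonical_curvature A \<phi> \<xi> \<eta> g nabla"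
    and "a = (\<lambda>p. (tr (S p))\<^sup>2 - tr (S p \<circ> S p) - (tr (S p \<circ> \<phi> p))\<^sup>2
               + tr ((S p \<circ> \<phi> p) \<circ> (S p \<circ> \<phi> p))
               - 2 * \<eta> p (S p (\<xi> p)) * tr (S p) + 2 * g p (S p (\<xi> p)) (S p (\<xi> p)))"
    and "b = (\<lambda>p. tr (S p \<circ> S p \<circ> \<phi> p) - tr (S p) * tr (S p \<circ> \<phi> p)
               + \<eta> p (S p (\<xi> p)) * tr (S p \<circ> \<phi> p) - g p (\<phi> p (S p (\<xi> p))) (S p (\<xi> p)))"
  shows "\<forall>p.
    (\<forall>x y z u. K p x y z u = - K p x y (\<phi> p z) (\<phi> p u)) \<and>
    (\<forall>x y z u. K p x y z u =
        (\<nu> (f p) * (pi1 (g p) x y z u - pi2 (g p) (\<phi> p) x y z u - pi4 (g p) (\<eta> p) x y z u)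
         + \<nu>t (f p) * (pi3 (g p) (\<phi> p) x y z u + pi5 (g p) (\<phi> p) (\<eta> p) x y z u))
        - cos (t p) *
          (cos (t p) * (pi1 (g p) (S p x) (S p y) z u - pi2 (g p) (\<phi> p) (S p x) (S p y) z u
                        - pi4 (g p) (\<eta> p) (S p x) (S p y) z u)
           + sin (t p) * (pi3 (g p) (\<phi> p) (S p x) (S p y) z u
                          + pi5 (g p) (\<phi> p) (\<eta> p) (S p x) (S p y) z u))) \<and>
    (\<forall>F G. independent F \<and> span F = UNIV \<and> inverse_gram (g p) F G \<longrightarrow>
        scalar_curv F G (K p) =
          4 * real n * (real n - 1) * \<nu> (f p)
          - cos (t p) * (a p * cos (t p) + 2 * b p * sin (t p)) \<and>
        assoc_scalar_curv F G (\<phi> p) (K p) =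
          4 * real n * (real n - 1) * \<nu>t (f p)
          - cos (t p) * (a p * sin (t p) - 2 * b p * cos (t p)))"
proof (intro allI conjI impI)
  interpret norden_hypersurface B J g' nabla' A f N \<phi> \<xi> \<eta> g nabla S
    using assms by unfold_locales
  fix p
  interpret O: almost_contact_norden_operator "\<phi> p" "\<xi> p" "\<eta> p" "g p" "S p"
    by (rule operator)
  have t: "cos (t p) = C p" "sin (t p) = C p * m p"
    using cos_sin_m assms(7) by simp_all
  have "DIM(real ^ 'l) > 2"
    using assms(1,2) by simp
  then have K: "K p x y z u = (\<nu> (f p) * H.M.E1 p x y z u + \<nu>t (f p) * H.M.E3 p x y z u)
      - C p * (C p * H.M.E1 p (S p x) (S p y) z u + C p * m p * H.M.E3 p (S p x) (S p y) z u)" for x y z u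
    unfolding assms(11) by (rule canonical_curvature_formula[OF assms(5)])
  \<comment> \<open>The two factors are 2n and 2n - 2.\<close>
  have card: "(real CARD('k) - 1) * (real CARD('k) - 3) = 4 * real n * (real n - 1)"
    by (simp add: assms(3) algebra_simps)
  show "K p x y z u = - K p x y (\<phi> p z) (\<phi> p u)" for x y z u
    unfolding K H.M.kaehlerian by (simp add: algebra_simps)
  show "K p x y z u =
        (\<nu> (f p) * (pi1 (g p) x y z u - pi2 (g p) (\<phi> p) x y z u - pi4 (g p) (\<eta> p) x y z u)
         + \<nu>t (f p) * (pi3 (g p) (\<phi> p) x y z u + pi5 (g p) (\<phi> p) (\<eta> p) x y z u))
        - cos (t p) *
          (cos (t p) * (pi1 (g p) (S p x) (S p y) z u - pi2 (g p) (\<phi> p) (S p x) (S p y) z u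
                        - pi4 (g p) (\<eta> p) (S p x) (S p y) z u)
           + sin (t p) * (pi3 (g p) (\<phi> p) (S p x) (S p y) z u
                          + pi5 (g p) (\<phi> p) (\<eta> p) (S p x) (S p y) z u))" for x y z u
    unfolding K t H.M.E1_def H.M.E3_def ..
  fix F G assume "independent F \<and> span F = UNIV \<and> inverse_gram (g p) F G"
  then have basis: "independent F" "span F = UNIV" "inverse_gram (g p) F G"
    by auto
  note sc = O.scalar_curvatures[OF basis K]
  show "scalar_curv F G (K p) = 4 * real n * (real n - 1) * \<nu> (f p)
      - cos (t p) * (a p * cos (t p) + 2 * b p * sin (t p))"
    unfolding sc card t assms(12,13) O.a_inv_def O.b_inv_def by simp
  show "assoc_scalar_curv F G (\<phi> p) (K p) = 4 * real n * (real n - 1) * \<nu>t (f p)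
      - cos (t p) * (a p * sin (t p) - 2 * b p * cos (t p))"
    unfolding sc card t assms(12,13) O.a_inv_def O.b_inv_def by simp
qed

end
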